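(* Let $n$ be a positive integer. The bispectral Darboux transformations from the function $e^{xz}I_n$, for operators $L,Q,P$ with invertible leading terms, are precisely the functions of the form $$\Phi(x,z)=W(x)P(x,\partial_x)(e^{xz}I_n),$$ where $W(x)$ is an invertible $M_n(\mathbb{C})$-valued rational function and $P(x,\partial_x)$ is a monic matrix differential operator of some order $k$ that has a nondegenerate vector kernel with a basis of the form $$e^{\alpha_1x}p_1(x),\ldots,e^{\alpha_{kn}x}p_{kn}(x)$$ for some (not necessarily distinct) $\alpha_j\in\mathbb{C}$ and vector-valued polynomials $p_j(x)\in\mathbb{C}[x]^n$.
   Context: A bispectral Darboux transformation from $e^{xz}I_n$ for operators $L,Q,P$ with invertible leading terms means a function $\Phi(x,z)=P(x,\partial_x)(e^{xz}I_n)$ arising from a factorization $L(x,\partial_x)=Q(x,\partial_x)P(x,\partial_x)$, where $L$ is an $M_n(\mathbb{C})$-valued differential operator with constant coefficients, $Q$ and $P$ are $M_n(\mathbb{C})$-valued differential operators with rational coefficients, and the leading coefficients of $L,Q,P$ are invertible matrix-valued rational functions (determinant not identically zero). (Here $I_n$ is the identity matrix.) The vector kernel of a differential operator $P(x,\partial_x)$ with meromorphic $M_n(\mathbb{C})$-valued coefficients on $\mathbb{C}$ is $\operatorname{vker}P=\{\text{meromorphic } f\colon\mathbb{C}\to\mathbb{C}^n\mid P(x,\partial_x)f(x)=0\}$. A subspace of dimension $nk$ of the space of $\mathbb{C}^n$-valued meromorphic functions is nondegenerate if it has a basis $f_1,\ldots,f_{nk}$ whose Wronski matrix, the $nk\times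 nk$ matrix with block rows $(f_1^{(i)},\ldots,f_{nk}^{(i)})$, $i=0,\ldots,k-1$, has determinant that is a nonzero meromorphic function. "Monic" means leading coefficient $I_n$. *)

theory Defs
  imports
    "HOL-Complex_Analysis.Complex_Analysis"
    "Jordan_Normal_Form.Determinant"
begin

unbundle no vec_syntax
hide_const (open) Finite_Cartesian_Product.vec Finite_Cartesian_Product.mat Determinants.det

text \<open>
  Meromorphic functions are represented by total functions, whose values on a closed discrete
  subset of the plane are irrelevant. Accordingly, identities between meromorphic functions are
  stated off such a set, i.e. with the quantifier \<open>\<forall>\<^sub>\<approx>\<close> of the filter \<open>cosparse UNIV\<close>.
  Vectors and matrices are those of \<open>Jordan_Normal_Form\<close>, with indices starting at 0.
\<close>

definition meromorphic_vec :: "nat \<Rightarrow> (complex \<Rightarrow> complex vec) \<Rightarrow> bool" where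
  "meromorphic_vec n f \<longleftrightarrow>
     (\<forall>x. f x \<in> carrier_vec n) \<and> (\<forall>r<n. (\<lambda>x. f x $ r) meromorphic_on UNIV)"

definition meromorphic_mat :: "nat \<Rightarrow> (complex \<Rightarrow> complex mat) \<Rightarrow> bool" where
  "meromorphic_mat n A \<longleftrightarrow>
     (\<forall>x. A x \<in> carrier_mat n n) \<and>
     (\<forall>r<n. \<forall>s<n. (\<lambda>x. A x $$ (r, s)) meromorphic_on UNIV)"

definition rational_fun :: "(complex \<Rightarrow> complex) \<Rightarrow> bool" where
  "rational_fun f \<longleftrightarrow> (\<exists>p q. q \<noteq> 0 \<and> (\<forall>\<^sub>\<approx>x. f x = poly p x / poly q x))"

definition rational_mat :: "nat \<Rightarrow> (complex \<Rightarrow> complex mat) \<Rightarrow> bool" where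
  "rational_mat n A \<longleftrightarrow>
     (\<forall>x. A x \<in> carrier_mat n n) \<and> (\<forall>r<n. \<forall>s<n. rational_fun (\<lambda>x. A x $$ (r, s)))"

text \<open>Invertibility over the field of meromorphic functions: the determinant is not the zero
  function.\<close>

definition invertible_mat_fun :: "(complex \<Rightarrow> complex mat) \<Rightarrow> bool" where
  "invertible_mat_fun A \<longleftrightarrow> \<not> (\<forall>\<^sub>\<approx>x. det (A x) = 0)"

definition vec_deriv :: "nat \<Rightarrow> nat \<Rightarrow> (complex \<Rightarrow> complex vec) \<Rightarrow> complex \<Rightarrow> complex vec" where
  "vec_deriv n i f x = vec n (\<lambda>r. (deriv ^^ i) (\<lambda>y. f y $ r) x)"

definition mat_deriv :: "nat \<Rightarrow> nat \<Rightarrow> (complex \<Rightarrow> complex mat) \<Rightarrow> complex \<Rightarrow> complex mat" where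
  "mat_deriv n i F x = mat n n (\<lambda>(r, s). (deriv ^^ i) (\<lambda>y. F y $$ (r, s)) x)"

text \<open>
  A differential operator \<open>\<Sum>i\<le>k. a i x \<partial>\<^sup>i\<close> of size \<open>n\<close> is given by \<open>k\<close> and its coefficients \<open>a\<close>;
  its leading coefficient is \<open>a k\<close>, and values of \<open>a\<close> beyond \<open>k\<close> are ignored. It acts on
  vector-valued functions (\<open>dop_vec\<close>) and on matrix-valued functions (\<open>dop_mat\<close>).
\<close>

type_synonym coeffs = "nat \<Rightarrow> complex \<Rightarrow> complex mat"

definition dop_vec ::
  "nat \<Rightarrow> nat \<Rightarrow> coeffs \<Rightarrow> (complex \<Rightarrow> complex vec) \<Rightarrow> complex \<Rightarrow> complex vec" where
  "dop_vec n k a f x = vec n (\<lambda>r. \<Sum>i\<le>k. (a i x *\<^sub>v vec_deriv n i f x) $ r)"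

definition dop_mat ::
  "nat \<Rightarrow> nat \<Rightarrow> coeffs \<Rightarrow> (complex \<Rightarrow> complex mat) \<Rightarrow> complex \<Rightarrow> complex mat" where
  "dop_mat n k a F x = mat n n (\<lambda>rs. \<Sum>i\<le>k. (a i x * mat_deriv n i F x) $$ rs)"

definition exp_mat :: "nat \<Rightarrow> complex \<Rightarrow> complex \<Rightarrow> complex mat" where
  "exp_mat n z x = exp (x * z) \<cdot>\<^sub>m 1\<^sub>m n"

text \<open>The product of differential operators is composition of their actions, so \<open>L = Q P\<close> means
  that both sides act in the same way on all meromorphic vector-valued functions.\<close>

definition factorization ::
  "nat \<Rightarrow> nat \<Rightarrow> coeffs \<Rightarrow> nat \<Rightarrow> coeffs \<Rightarrow> nat \<Rightarrow> coeffs \<Rightarrow> bool" where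
  "factorization n l L q Q p P \<longleftrightarrow>
     (\<forall>f. meromorphic_vec n f \<longrightarrow>
        (\<forall>\<^sub>\<approx>x. dop_vec n l L f x = dop_vec n q Q (dop_vec n p P f) x))"

text \<open>Below, \<open>\<Phi>\<close> is a function of \<open>x\<close> and \<open>z\<close>, meromorphic in \<open>x\<close>; the exceptional set of \<open>x\<close>
  is uniform in \<open>z\<close>.\<close>

definition bispectral_darboux :: "nat \<Rightarrow> (complex \<Rightarrow> complex \<Rightarrow> complex mat) \<Rightarrow> bool" where
  "bispectral_darboux n \<Phi> \<longleftrightarrow>
     (\<exists>l q p (L :: nat \<Rightarrow> complex mat) Q P.
        (\<forall>i\<le>l. L i \<in> carrier_mat n n) \<and>
        (\<forall>i\<le>q. rational_mat n (Q i)) \<and>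
        (\<forall>i\<le>p. rational_mat n (P i)) \<and>
        invertible_mat_fun (\<lambda>x. L l) \<and> invertible_mat_fun (Q q) \<and> invertible_mat_fun (P p) \<and>
        factorization n l (\<lambda>i x. L i) q Q p P \<and>
        (\<forall>\<^sub>\<approx>x. \<forall>z. \<Phi> x z = dop_mat n p P (exp_mat n z) x))"

definition vker :: "nat \<Rightarrow> nat \<Rightarrow> coeffs \<Rightarrow> (complex \<Rightarrow> complex vec) set" where
  "vker n k a = {f. meromorphic_vec n f \<and> (\<forall>\<^sub>\<approx>x. dop_vec n k a f x = 0\<^sub>v n)}"

definition fun_lincomb ::
  "nat \<Rightarrow> nat \<Rightarrow> (nat \<Rightarrow> complex) \<Rightarrow> (nat \<Rightarrow> complex \<Rightarrow> complex vec) \<Rightarrow> complex \<Rightarrow> complex vec" where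
  "fun_lincomb n N c f x = vec n (\<lambda>r. \<Sum>j<N. c j * f j x $ r)"

text \<open>\<open>f 0, \<dots>, f (N - 1)\<close> is a basis over the complex numbers of the space \<open>V\<close> of
  meromorphic functions.\<close>

definition is_basis ::
  "nat \<Rightarrow> (complex \<Rightarrow> complex vec) set \<Rightarrow> nat \<Rightarrow> (nat \<Rightarrow> complex \<Rightarrow> complex vec) \<Rightarrow> bool" where
  "is_basis n V N f \<longleftrightarrow>
     (\<forall>j<N. f j \<in> V) \<and>
     (\<forall>c. (\<forall>\<^sub>\<approx>x. fun_lincomb n N c f x = 0\<^sub>v n) \<longrightarrow> (\<forall>j<N. c j = 0)) \<and>
     (\<forall>g\<in>V. \<exists>c. \<forall>\<^sub>\<approx>x. g x = fun_lincomb n N c f x)"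

text \<open>Row \<open>n * i + r\<close> of the Wronski matrix holds the \<open>r\<close>-th components of the \<open>i\<close>-th
  derivatives.\<close>

definition wronski_mat ::
  "nat \<Rightarrow> nat \<Rightarrow> (nat \<Rightarrow> complex \<Rightarrow> complex vec) \<Rightarrow> complex \<Rightarrow> complex mat" where
  "wronski_mat n k f x =
     mat (n * k) (n * k) (\<lambda>(s, j). vec_deriv n (s div n) (f j) x $ (s mod n))"

definition nondegenerate :: "nat \<Rightarrow> nat \<Rightarrow> (complex \<Rightarrow> complex vec) set \<Rightarrow> bool" where
  "nondegenerate n k V \<longleftrightarrow>
     (\<exists>f. is_basis n V (n * k) f \<and> invertible_mat_fun (wronski_mat n k f))"

definition monic_dop :: "nat \<Rightarrow> nat \<Rightarrow> coeffs \<Rightarrow> bool" where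
  "monic_dop n k a \<longleftrightarrow> (\<forall>i\<le>k. meromorphic_mat n (a i)) \<and> (\<forall>\<^sub>\<approx>x. a k x = 1\<^sub>m n)"

definition quasi_exp :: "nat \<Rightarrow> complex \<Rightarrow> complex poly vec \<Rightarrow> complex \<Rightarrow> complex vec" where
  "quasi_exp n \<alpha> p x = vec n (\<lambda>r. exp (\<alpha> * x) * poly (p $ r) x)"

end

theory Submission
  imports Defs "HOL-Computational_Algebra.Fundamental_Theorem_Algebra"
begin

hide_const (open) Module.smult

text \<open>
  \<^emph>\<open>From a factorization to a kernel.\<close> Let \<open>L = Q P\<close>, put \<open>d = det L(z)\<close> and let \<open>M(z)\<close> be the adjugate
  of \<open>L(z)\<close>, so that \<open>M Q P = d(\<partial>) I\<close>. Every meromorphic solution of \<open>P f = 0\<close> then solves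
  \<open>d(\<partial>) f = 0\<close> and is an exponential polynomial; as exponentials are independent over the rational
  functions, its components \<open>e\<^sup>\<alpha>\<^sup>x p(x)\<close> are again in the kernel of \<open>P\<close>. A solution of a system of
  order \<open>k\<close> is determined by its jet of length \<open>k\<close> at one generic point. This bounds the dimension of
  the kernel by \<open>n k\<close>, shows that the Wronski matrix of \<open>n k\<close> independent solutions is invertible at
  generic points and, applied to the kernels of \<open>M\<close> and \<open>Q\<close>, also bounds the dimension of the
  kernel of \<open>P\<close> from below. No existence theorem for differential equations is needed.

  \<^emph>\<open>From a kernel to a factorization.\<close> By Cramer's rule for the Wronski matrix, a monic operator whose
  kernel has a basis \<open>e\<^sup>\<alpha>\<^sup>x p(x)\<close> has rational coefficients. With \<open>d\<close> the product of
  \<open>(z - \<alpha>)\<^bsup>deg p + 1\<^esup>\<close> over the basis, the operator \<open>d(\<partial>) I\<close> annihilates the kernel. Dividing it by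
  \<open>W P\<close> leaves a remainder of order less than \<open>k\<close> which annihilates the kernel and therefore vanishes.
\<close>

text \<open>A linear system need not have enough global meromorphic solutions: local solutions can
  be multivalued around the poles of the coefficients. So the size of the kernel of \<open>P\<close>
  cannot be read off from the order of \<open>P\<close> and has to come from the factorization. The
  solutions of d(\<partial>) f = 0 are all explicit and entire, n deg d independent ones, and the
  kernel of \<open>P\<close> is cut out of their span by finitely many jet conditions. For the count
  to close, deg d must be exactly the sum of the orders of \<open>M\<close> and \<open>L\<close>,
  and the order of \<open>L\<close> must be at least the sum of the orders of \<open>Q\<close> and
  \<open>P\<close>; both facts rest on invertible leading coefficients. A factorization is known
  only through its action on meromorphic functions, so information on the orders is extracted by
  applying it to a test function. In both directions the auxiliary operator with constant
  coefficients is a scalar polynomial in \<partial> times the identity and therefore acts on each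
  component separately.\<close>

section \<open>Identities off sparse sets, and underdetermined linear systems\<close>

lemma cosparse_eventually_nhds:
  assumes "\<forall>\<^sub>\<approx>x. P (x :: complex)"
  shows "\<forall>\<^sub>\<approx>x. eventually P (nhds x)"
proof -
  have "closed {x. \<not> P x}"
    using assms by (simp add: eventually_cosparse sparse_in_UNIV_imp_closed)
  hence "open {x. P x}"
    by (simp add: closed_def Collect_neg_eq)
  with assms show ?thesis
    by (auto simp: eventually_nhds elim!: eventually_mono)
qed

lemma cosparse_frequently: "\<forall>\<^sub>\<approx>x. P (x :: complex) \<Longrightarrow> \<exists>x. P x"
  using eventually_happens[of P "cosparse (UNIV :: complex set)"] by simp

lemma eventually_cosparse_all_less:
  fixes m :: nat
  shows "(\<forall>i<m. \<forall>\<^sub>\<approx>x. P i (x :: complex)) \<Longrightarrow> \<forall>\<^sub>\<approx>x. \<forall>i<m. P i x"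
  using eventually_ball_finite[of "{..<m}" "\<lambda>x i. P i x" "cosparse UNIV"] by (simp add: Ball_def)

lemma eventually_cosparse_all_le:
  fixes m :: nat
  shows "(\<forall>i\<le>m. \<forall>\<^sub>\<approx>x. P i (x :: complex)) \<Longrightarrow> \<forall>\<^sub>\<approx>x. \<forall>i\<le>m. P i x"
  using eventually_ball_finite[of "{..m}" "\<lambda>x i. P i x" "cosparse UNIV"] by (simp add: Ball_def)

text \<open>A derivative depends on a whole neighbourhood. As a sparse subset of the plane is
  closed, an identity off such a set holds near each point outside it and may be differentiated
  there.\<close>

lemma higher_deriv_cosparse_cong:
  assumes "\<forall>\<^sub>\<approx>x. f x = (g x :: complex)"
  shows "\<forall>\<^sub>\<approx>x. (deriv ^^ i) f x = (deriv ^^ i) g x"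
  using cosparse_eventually_nhds[OF assms]
  by eventually_elim (intro higher_deriv_cong_ev refl)

text \<open>An identity off a sparse set may fail at the very point where a jet is evaluated;
  continuity of both sides restores it there.\<close>

lemma continuous_eq_at:
  fixes f g :: "complex \<Rightarrow> complex"
  assumes "isCont f x" "isCont g x" "\<forall>\<^sub>\<approx>x. f x = g x"
  shows "f x = g x"
proof -
  have ev: "\<forall>\<^sub>F y in at x. f y = g y"
    using assms(3) eventually_cosparse_imp_eventually_at by blast
  have "f \<midarrow>x\<rightarrow> f x" "g \<midarrow>x\<rightarrow> g x"
    using assms by (auto simp: isCont_def)
  hence "f \<midarrow>x\<rightarrow> g x"
    using ev by (simp add: tendsto_cong)
  thus ?thesis
    using \<open>f \<midarrow>x\<rightarrow> f x\<close> LIM_unique by blast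
qed

text \<open>Identity theorem in the form of a dichotomy: a meromorphic function on the plane is zero
  off a sparse set or nonzero off a sparse set, and the latter contradicts vanishing near a
  point.\<close>

lemma meromorphic_zero_near_imp_zero:
  assumes "f meromorphic_on UNIV" "\<forall>\<^sub>F y in nhds x. f y = (0 :: complex)"
  shows "\<forall>\<^sub>\<approx>x. f x = 0"
proof -
  have "(\<forall>\<^sub>\<approx>x. f x = 0) \<or> (\<forall>\<^sub>\<approx>x. f x \<noteq> 0)"
    using meromorphic_imp_constant_or_avoid[OF assms(1), of 0] by auto
  thus ?thesis
  proof
    assume "\<forall>\<^sub>\<approx>x. f x \<noteq> 0"
    hence "\<forall>\<^sub>F y in at x. f y \<noteq> 0"
      using eventually_cosparse_imp_eventually_at by blast
    moreover have "\<forall>\<^sub>F y in at x. f y = 0"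
      using assms(2) by (simp add: eventually_nhds_conv_at)
    ultimately have "\<forall>\<^sub>F y in at x. False"
      by eventually_elim auto
    thus ?thesis by simp
  qed
qed

lemma analytic_zero_jets_imp_zero_near:
  assumes "f analytic_on {x}" "\<And>i. (deriv ^^ i) f x = (0 :: complex)"
  shows "\<forall>\<^sub>F y in nhds x. f y = 0"
proof -
  obtain e where e: "e > 0" "f holomorphic_on ball x e"
    using assms(1) by (auto simp: analytic_on_def)
  have "f w = 0" if "w \<in> ball x e" for w
    by (rule holomorphic_fun_eq_0_on_ball[OF e(2) that]) (use assms(2) in auto)
  thus ?thesis
    using e(1) eventually_nhds_in_open[of "ball x e" x] by (auto elim!: eventually_mono)
qed

text \<open>Zero rows pad the \<open>m\<close> equations to a square matrix. Its row
  \<open>m\<close> is zero, so the transpose kills \<open>unit_vec N m\<close>, the determinant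
  vanishes and a nonzero kernel vector exists.\<close>

lemma underdetermined_system:
  fixes A :: "nat \<Rightarrow> nat \<Rightarrow> complex"
  assumes "m < N"
  obtains c where "\<exists>j<N. c j \<noteq> 0" "\<And>i. i < m \<Longrightarrow> (\<Sum>j<N. A i j * c j) = 0"
proof -
  define M where "M = Matrix.mat N N (\<lambda>(i, j). if i < m then A i j else 0)"
  have M: "M \<in> carrier_mat N N" by (simp add: M_def)
  have "unit_vec N m \<noteq> 0\<^sub>v N"
    using assms by (metis index_unit_vec(1) index_zero_vec(1) zero_neq_one)
  moreover have "M\<^sup>T *\<^sub>v unit_vec N m = 0\<^sub>v N"
    using assms by (intro eq_vecI) (auto simp: M_def)
  ultimately have "det M\<^sup>T = 0"
    by (subst det_0_iff_vec_prod_zero_field[of _ N]) (auto simp: M intro!: exI[of _ "unit_vec N m"])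
  hence "det M = 0"
    using det_transpose[OF M] by simp
  then obtain v where v: "v \<in> carrier_vec N" "v \<noteq> 0\<^sub>v N" "M *\<^sub>v v = 0\<^sub>v N"
    using det_0_iff_vec_prod_zero_field[OF M] by auto
  show ?thesis
  proof
    show "\<exists>j<N. v $ j \<noteq> 0"
      using v(1,2) by (metis carrier_vecD eq_vecI index_zero_vec)
    fix i assume i: "i < m"
    have "(M *\<^sub>v v) $ i = (\<Sum>j<N. A i j * v $ j)"
      using i assms v(1) by (simp add: M_def scalar_prod_def atLeast0LessThan)
    thus "(\<Sum>j<N. A i j * v $ j) = 0"
      using v(3) i assms by simp
  qed
qed

text \<open>Jets carry two indices, the order \<open>i\<close> of the derivative and the component
  \<open>r\<close>. Linear systems for them are flattened by \<open>t = n * i + r\<close>, the row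
  numbering of \<open>wronski_mat\<close>.\<close>

lemma index_pair_cases:
  fixes N n k i r :: nat
  assumes "\<And>t. t < n * k \<Longrightarrow> P (t div n) (t mod n)" "i < k" "r < n"
  shows "P i r"
proof -
  have "n * i + r < n * k"
  proof -
    have "n * i + r < n * Suc i" using assms by simp
    also have "\<dots> \<le> n * k" using assms by (intro mult_le_mono) auto
    finally show ?thesis .
  qed
  from assms(1)[OF this] show ?thesis using assms(3) by simp
qed

section \<open>Matrix differential operators in components\<close>

text \<open>
  A vector-valued function is given by its components \<open>f s\<close> and an operator by the entries \<open>C i r s\<close> of
  its coefficients. Only indices below \<open>n\<close> matter, and functions count as equal if they agree off a
  sparse set; accordingly \<open>nullf\<close>, \<open>indep\<close> and \<open>inspan\<close> refer to linear algebra over the complex numbers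
  modulo this equality.
\<close>

definition opr :: "nat \<Rightarrow> nat \<Rightarrow> (nat \<Rightarrow> nat \<Rightarrow> nat \<Rightarrow> complex \<Rightarrow> complex) \<Rightarrow>
    (nat \<Rightarrow> complex \<Rightarrow> complex) \<Rightarrow> nat \<Rightarrow> complex \<Rightarrow> complex" where
  "opr n k C f r x = (\<Sum>i\<le>k. \<Sum>s<n. C i r s x * (deriv ^^ i) (f s) x)"

definition nullf :: "nat \<Rightarrow> (nat \<Rightarrow> complex \<Rightarrow> complex) \<Rightarrow> bool" where
  "nullf n f \<longleftrightarrow> (\<forall>s<n. \<forall>\<^sub>\<approx>x. f s x = 0)"

definition lcomb :: "nat \<Rightarrow> (nat \<Rightarrow> complex) \<Rightarrow> (nat \<Rightarrow> nat \<Rightarrow> complex \<Rightarrow> complex) \<Rightarrow>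
    nat \<Rightarrow> complex \<Rightarrow> complex" where
  "lcomb N c F s x = (\<Sum>j<N. c j * F j s x)"

definition indep :: "nat \<Rightarrow> nat \<Rightarrow> (nat \<Rightarrow> nat \<Rightarrow> complex \<Rightarrow> complex) \<Rightarrow> bool" where
  "indep n N F \<longleftrightarrow> (\<forall>c. nullf n (lcomb N c F) \<longrightarrow> (\<forall>j<N. c j = 0))"

definition merov :: "nat \<Rightarrow> (nat \<Rightarrow> complex \<Rightarrow> complex) \<Rightarrow> bool" where
  "merov n f \<longleftrightarrow> (\<forall>s<n. f s meromorphic_on UNIV)"

definition meroc :: "nat \<Rightarrow> nat \<Rightarrow> (nat \<Rightarrow> nat \<Rightarrow> nat \<Rightarrow> complex \<Rightarrow> complex) \<Rightarrow> bool" where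
  "meroc n k C \<longleftrightarrow> (\<forall>i\<le>k. \<forall>r<n. \<forall>s<n. C i r s meromorphic_on UNIV)"

definition okernel :: "nat \<Rightarrow> nat \<Rightarrow> (nat \<Rightarrow> nat \<Rightarrow> nat \<Rightarrow> complex \<Rightarrow> complex) \<Rightarrow>
    (nat \<Rightarrow> complex \<Rightarrow> complex) set" where
  "okernel n k C = {f. merov n f \<and> nullf n (opr n k C f)}"

text \<open>Injectivity is the form in which invertibility is used on jets;
  \<open>nonsing_iff_det\<close> translates it to determinants.\<close>

definition nonsing :: "nat \<Rightarrow> (nat \<Rightarrow> nat \<Rightarrow> complex) \<Rightarrow> bool" where
  "nonsing n A \<longleftrightarrow> (\<forall>v. (\<forall>r<n. (\<Sum>s<n. A r s * v s) = 0) \<longrightarrow> (\<forall>s<n. v s = 0))"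

text \<open>At such a point the system can be solved for the derivatives of order
  \<open>k\<close>.\<close>

definition regular_at :: "nat \<Rightarrow> nat \<Rightarrow> (nat \<Rightarrow> nat \<Rightarrow> nat \<Rightarrow> complex \<Rightarrow> complex) \<Rightarrow> complex \<Rightarrow> bool" where
  "regular_at n k C x \<longleftrightarrow> (\<forall>i\<le>k. \<forall>r<n. \<forall>s<n. C i r s analytic_on {x}) \<and> nonsing n (\<lambda>r s. C k r s x)"

lemma opr_meromorphic:
  assumes "meroc n k C" "merov n f" "r < n"
  shows "opr n k C f r meromorphic_on UNIV"
  unfolding opr_def[abs_def]
  using assms by (intro meromorphic_intros) (auto simp: meroc_def merov_def)

lemma merov_opr: "meroc n k C \<Longrightarrow> merov n f \<Longrightarrow> merov n (opr n k C f)"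
  using opr_meromorphic by (auto simp: merov_def)

lemma merov_lcomb: "(\<And>j. j < N \<Longrightarrow> merov n (F j)) \<Longrightarrow> merov n (lcomb N c F)"
  unfolding lcomb_def[abs_def] merov_def by (auto intro!: meromorphic_intros)

lemma merov_analytic: "merov n f \<Longrightarrow> \<forall>\<^sub>\<approx>x. \<forall>s<n. f s analytic_on {x}"
  unfolding merov_def
  by (intro eventually_cosparse_all_less) (auto intro: meromorphic_on_imp_analytic_cosparse)

lemma meroc_analytic:
  assumes "meroc n k C"
  shows "\<forall>\<^sub>\<approx>x. \<forall>i\<le>k. \<forall>r<n. \<forall>s<n. C i r s analytic_on {x}"
  using assms unfolding meroc_def
  by (intro eventually_cosparse_all_less eventually_cosparse_all_le)
     (auto intro!: meromorphic_on_imp_analytic_cosparse eventually_cosparse_all_less eventually_cosparse_all_le)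

lemma opr_analytic:
  assumes "\<forall>i\<le>k. \<forall>r<n. \<forall>s<n. C i r s analytic_on {x}" "\<forall>s<n. f s analytic_on {x}" "r < n"
  shows "opr n k C f r analytic_on {x}"
  unfolding opr_def[abs_def] using assms by (intro analytic_intros) auto

lemma opr_cong_ev:
  assumes "\<And>s. s < n \<Longrightarrow> \<forall>\<^sub>\<approx>x. f s x = g s x"
  shows "\<forall>\<^sub>\<approx>x. \<forall>r. opr n k C f r x = opr n k C g r x"
proof -
  have "\<forall>\<^sub>\<approx>x. \<forall>i\<le>k. \<forall>s<n. (deriv ^^ i) (f s) x = (deriv ^^ i) (g s) x"
    using assms by (intro eventually_cosparse_all_less eventually_cosparse_all_le allI impI
      higher_deriv_cosparse_cong)
  thus ?thesis
    by eventually_elim (auto simp: opr_def intro!: sum.cong)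
qed

lemma higher_deriv_sum_at:
  assumes "finite A" "\<And>a. a \<in> A \<Longrightarrow> f a analytic_on {x}"
  shows "(deriv ^^ i) (\<lambda>w. \<Sum>a\<in>A. f a w) x = (\<Sum>a\<in>A. (deriv ^^ i) (f a) x)"
  using assms
proof (induction A rule: finite_induct)
  case (insert a A)
  have "(\<lambda>w. \<Sum>a\<in>A. f a w) analytic_on {x}"
    using insert by (intro analytic_intros) auto
  with insert show ?case
    by (simp add: higher_deriv_add_at)
qed auto

lemma higher_deriv_lcomb_at:
  assumes "\<And>j. j < N \<Longrightarrow> F j s analytic_on {x}"
  shows "(deriv ^^ i) (lcomb N c F s) x = (\<Sum>j<N. c j * (deriv ^^ i) (F j s) x)"
proof -
  have "(deriv ^^ i) (lcomb N c F s) x = (\<Sum>j<N. (deriv ^^ i) (\<lambda>w. c j * F j s w) x)"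
    unfolding lcomb_def[abs_def] using assms
    by (intro higher_deriv_sum_at) (auto intro!: analytic_intros)
  also have "\<dots> = (\<Sum>j<N. c j * (deriv ^^ i) (F j s) x)"
    using assms by (intro sum.cong higher_deriv_cmult') auto
  finally show ?thesis .
qed

lemma opr_lcomb_at:
  assumes "\<And>j s. j < N \<Longrightarrow> s < n \<Longrightarrow> F j s analytic_on {x}"
  shows "opr n k C (lcomb N c F) r x = (\<Sum>j<N. c j * opr n k C (F j) r x)"
proof -
  have "opr n k C (lcomb N c F) r x
     = (\<Sum>i\<le>k. \<Sum>s<n. C i r s x * (\<Sum>j<N. c j * (deriv ^^ i) (F j s) x))"
    unfolding opr_def using assms by (intro sum.cong refl) (subst higher_deriv_lcomb_at, auto)
  also have "\<dots> = (\<Sum>i\<le>k. \<Sum>s<n. \<Sum>j<N. c j * (C i r s x * (deriv ^^ i) (F j s) x))"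
    by (simp add: sum_distrib_left mult_ac)
  also have "\<dots> = (\<Sum>i\<le>k. \<Sum>j<N. \<Sum>s<n. c j * (C i r s x * (deriv ^^ i) (F j s) x))"
    by (intro sum.cong sum.swap refl)
  also have "\<dots> = (\<Sum>j<N. \<Sum>i\<le>k. \<Sum>s<n. c j * (C i r s x * (deriv ^^ i) (F j s) x))"
    by (rule sum.swap)
  finally show ?thesis
    by (simp add: opr_def sum_distrib_left)
qed

lemma opr_lcomb:
  assumes "\<And>j. j < N \<Longrightarrow> merov n (F j)"
  shows "\<forall>\<^sub>\<approx>x. \<forall>c r. opr n k C (lcomb N c F) r x = (\<Sum>j<N. c j * opr n k C (F j) r x)"
proof -
  have "\<forall>\<^sub>\<approx>x. \<forall>j<N. \<forall>s<n. F j s analytic_on {x}"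
    using assms by (intro eventually_cosparse_all_less) (auto intro: merov_analytic)
  thus ?thesis
    by eventually_elim (auto intro!: opr_lcomb_at)
qed

lemma okernel_lcomb:
  assumes "\<And>j. j < N \<Longrightarrow> F j \<in> okernel n k C"
  shows "lcomb N c F \<in> okernel n k C"
proof -
  have m: "\<And>j. j < N \<Longrightarrow> merov n (F j)" using assms by (auto simp: okernel_def)
  have "\<forall>\<^sub>\<approx>x. \<forall>j<N. \<forall>r<n. opr n k C (F j) r x = 0"
    using assms by (intro eventually_cosparse_all_less) (auto simp: okernel_def nullf_def intro!: eventually_cosparse_all_less)
  moreover have "\<forall>\<^sub>\<approx>x. \<forall>c r. opr n k C (lcomb N c F) r x = (\<Sum>j<N. c j * opr n k C (F j) r x)"
    by (rule opr_lcomb) (rule m)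
  ultimately have "\<forall>\<^sub>\<approx>x. \<forall>r<n. opr n k C (lcomb N c F) r x = 0"
    by eventually_elim auto
  hence "nullf n (opr n k C (lcomb N c F))"
    unfolding nullf_def by (auto elim!: eventually_mono)
  thus ?thesis using merov_lcomb[of N n F c, OF m] by (auto simp: okernel_def)
qed

lemma nullf_cong:
  assumes "nullf n f" "\<And>s. s < n \<Longrightarrow> \<forall>\<^sub>\<approx>x. f s x = g s x"
  shows "nullf n g"
  unfolding nullf_def
proof (intro allI impI)
  fix s assume "s < n"
  with assms have "\<forall>\<^sub>\<approx>x. f s x = 0" "\<forall>\<^sub>\<approx>x. f s x = g s x" by (auto simp: nullf_def)
  thus "\<forall>\<^sub>\<approx>x. g s x = 0" by eventually_elim auto
qed

text \<open>If \<open>f\<close> vanishes to order \<open>k + m\<close>, all terms of the Leibniz expansion of a derivative of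
  order at most \<open>m\<close> vanish, except the one in which every derivative hits \<open>f\<close>.\<close>

lemma higher_deriv_opr_vanishing:
  assumes "\<forall>i\<le>k. \<forall>r<n. \<forall>s<n. C i r s analytic_on {x}" "\<forall>s<n. f s analytic_on {x}" "r < n"
    and zero: "\<And>i s. i < k + m \<Longrightarrow> s < n \<Longrightarrow> (deriv ^^ i) (f s) x = 0" and "j \<le> m"
  shows "(deriv ^^ j) (opr n k C f r) x =
    (if j < m then 0 else \<Sum>s<n. C k r s x * (deriv ^^ (k + m)) (f s) x)"
proof -
  have "(deriv ^^ j) (opr n k C f r) x =
      (\<Sum>i\<le>k. (deriv ^^ j) (\<lambda>w. \<Sum>s<n. C i r s w * (deriv ^^ i) (f s) w) x)"
    unfolding opr_def[abs_def] using assms by (intro higher_deriv_sum_at) (auto intro!: analytic_intros)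
  also have "\<dots> = (\<Sum>i\<le>k. \<Sum>s<n. (deriv ^^ j) (\<lambda>w. C i r s w * (deriv ^^ i) (f s) w) x)"
    using assms by (intro sum.cong higher_deriv_sum_at) (auto intro!: analytic_intros)
  also have "\<dots> = (\<Sum>i\<le>k. \<Sum>s<n. \<Sum>l = 0..j. of_nat (j choose l) * (deriv ^^ l) (C i r s) x *
      (deriv ^^ (j - l)) ((deriv ^^ i) (f s)) x)"
    using assms by (intro sum.cong refl higher_deriv_mult_at) (auto intro!: analytic_intros)
  also have "\<dots> = (\<Sum>i\<le>k. \<Sum>s<n. \<Sum>l = 0..j. if i = k \<and> l = 0 \<and> j = m then
      C k r s x * (deriv ^^ (k + m)) (f s) x else 0)"
  proof (intro sum.cong refl)
    fix i s l assume *: "i \<in> {..k}" "s \<in> {..<n}" "l \<in> {0..j}"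
    have "(deriv ^^ (j - l)) ((deriv ^^ i) (f s)) x = (deriv ^^ (j - l + i)) (f s) x"
      by (simp add: funpow_add)
    moreover have "j - l + i < k + m \<or> (i = k \<and> l = 0 \<and> j = m)"
      using * \<open>j \<le> m\<close> by auto
    ultimately show "of_nat (j choose l) * (deriv ^^ l) (C i r s) x *
        (deriv ^^ (j - l)) ((deriv ^^ i) (f s)) x = (if i = k \<and> l = 0 \<and> j = m then
        C k r s x * (deriv ^^ (k + m)) (f s) x else 0)"
      using * zero[of "j - l + i" s] by (auto simp: add.commute)
  qed
  also have "\<dots> = (\<Sum>i\<le>k. if i = k then (\<Sum>s<n. \<Sum>l = 0..j. if l = 0 then if j = m then
      C k r s x * (deriv ^^ (k + m)) (f s) x else 0 else 0) else 0)"
    by (intro sum.cong refl) (auto intro!: sum.cong)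
  also have "\<dots> = (if j < m then 0 else \<Sum>s<n. C k r s x * (deriv ^^ (k + m)) (f s) x)"
    using \<open>j \<le> m\<close> by (simp add: sum.delta)
  finally show ?thesis .
qed

text \<open>The jets at \<open>x\<close> vanish by induction on their order: once all orders below
  \<open>k + m\<close> vanish, the \<open>m\<close>-th derivative of the equation reduces to the
  leading coefficient applied to the jet of order \<open>k + m\<close>, and nonsingularity kills it.
  The identity theorem then spreads the vanishing from a neighbourhood of \<open>x\<close> to the
  plane.\<close>

lemma okernel_unique:
  assumes "regular_at n k C x" "f \<in> okernel n k C" "\<forall>s<n. f s analytic_on {x}"
    and zero: "\<And>i s. i < k \<Longrightarrow> s < n \<Longrightarrow> (deriv ^^ i) (f s) x = 0"
  shows "nullf n f"
proof -
  have C: "\<forall>i\<le>k. \<forall>r<n. \<forall>s<n. C i r s analytic_on {x}"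
    using assms by (auto simp: regular_at_def)
  have opr0: "\<forall>\<^sub>F y in nhds x. opr n k C f r y = 0" if "r < n" for r
  proof -
    have "opr n k C f r analytic_on {x}"
      using opr_analytic[OF C assms(3) that] .
    hence "isCont (opr n k C f r) x"
      using analytic_at_imp_isCont by blast
    moreover have *: "\<forall>\<^sub>\<approx>x. opr n k C f r x = 0"
      using assms(2) that by (auto simp: okernel_def nullf_def)
    ultimately have "opr n k C f r x = 0"
      using continuous_eq_at[of x "opr n k C f r" "\<lambda>_. 0"] by simp
    moreover have "\<forall>\<^sub>F y in at x. opr n k C f r y = 0"
      using * eventually_cosparse_imp_eventually_at by blast
    ultimately show ?thesis by (simp add: eventually_nhds_conv_at)
  qed
  have "\<forall>s<n. (deriv ^^ i) (f s) x = 0" for i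
  proof (induction i rule: less_induct)
    case (less i)
    show ?case
    proof (cases "i < k")
      case False
      define m where "m = i - k"
      have i: "i = k + m" using False by (simp add: m_def)
      have "(\<Sum>s<n. C k r s x * (deriv ^^ (k + m)) (f s) x) = 0" if r: "r < n" for r
      proof -
        have "(deriv ^^ m) (opr n k C f r) x = (\<Sum>s<n. C k r s x * (deriv ^^ (k + m)) (f s) x)"
          by (subst higher_deriv_opr_vanishing[OF C assms(3) r, of m m]) (use less i in auto)
        moreover have "(deriv ^^ m) (opr n k C f r) x = (deriv ^^ m) (\<lambda>_. 0) x"
          by (rule higher_deriv_cong_ev[OF opr0[OF r] refl])
        ultimately show ?thesis by simp
      qed
      moreover have "nonsing n (\<lambda>r s. C k r s x)"
        using assms(1) by (simp add: regular_at_def)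
      ultimately show ?thesis
        unfolding i nonsing_def by (elim allE[where x = "\<lambda>s. (deriv ^^ (k + m)) (f s) x"]) simp
    qed (use zero in auto)
  qed
  hence "\<forall>\<^sub>F y in nhds x. f s y = 0" if "s < n" for s
    using assms(3) that by (intro analytic_zero_jets_imp_zero_near) auto
  moreover have "f s meromorphic_on UNIV" if "s < n" for s
    using assms(2) that by (auto simp: okernel_def merov_def)
  ultimately show ?thesis
    unfolding nullf_def using meromorphic_zero_near_imp_zero by blast
qed

text \<open>The exceptional set does not depend on \<open>c\<close>: a generic point can be fixed
  before the coefficients are chosen by solving a linear system at that point.\<close>

lemma okernel_generic_jets:
  assumes "\<forall>\<^sub>\<approx>x. regular_at n k C x" "\<And>j. j < N \<Longrightarrow> F j \<in> okernel n k C"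
  shows "\<forall>\<^sub>\<approx>x. \<forall>c. (\<forall>i<k. \<forall>s<n. (\<Sum>j<N. (deriv ^^ i) (F j s) x * c j) = 0) \<longrightarrow> nullf n (lcomb N c F)"
proof -
  have "\<forall>\<^sub>\<approx>x. \<forall>j<N. \<forall>s<n. F j s analytic_on {x}"
    using assms(2) by (intro eventually_cosparse_all_less) (auto intro: merov_analytic simp: okernel_def)
  with assms(1) show ?thesis
  proof eventually_elim
    case (elim x)
    show ?case
    proof (intro allI impI)
      fix c assume c: "\<forall>i<k. \<forall>s<n. (\<Sum>j<N. (deriv ^^ i) (F j s) x * c j) = 0"
      show "nullf n (lcomb N c F)"
      proof (rule okernel_unique[OF elim(1)])
        show "lcomb N c F \<in> okernel n k C"
          using assms(2) by (rule okernel_lcomb)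
        show "\<forall>s<n. lcomb N c F s analytic_on {x}"
          unfolding lcomb_def[abs_def] using elim(2) by (auto intro!: analytic_intros)
      qed (subst higher_deriv_lcomb_at, use elim(2) c in \<open>auto simp: mult.commute\<close>)
    qed
  qed
qed

text \<open>More than \<open>n * k\<close> coefficients can be chosen nontrivially so that the
  \<open>n * k\<close> jet entries of the combination vanish at a generic point; the combination is
  then zero.\<close>

lemma indep_le:
  assumes "\<forall>\<^sub>\<approx>x. regular_at n k C x" "\<And>j. j < N \<Longrightarrow> F j \<in> okernel n k C" "indep n N F"
  shows "N \<le> n * k"
proof (rule ccontr)
  assume "\<not> N \<le> n * k"
  have "\<exists>x. \<forall>c. (\<forall>i<k. \<forall>s<n. (\<Sum>j<N. (deriv ^^ i) (F j s) x * c j) = 0) \<longrightarrow> nullf n (lcomb N c F)"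
    by (rule cosparse_frequently, rule okernel_generic_jets[OF assms(1,2)])
  then obtain x where
    x: "\<And>c. (\<forall>i<k. \<forall>s<n. (\<Sum>j<N. (deriv ^^ i) (F j s) x * c j) = 0) \<Longrightarrow> nullf n (lcomb N c F)"
    by blast
  obtain c where c: "\<exists>j<N. c j \<noteq> 0"
     "\<And>t. t < n * k \<Longrightarrow> (\<Sum>j<N. (deriv ^^ (t div n)) (F j (t mod n)) x * c j) = 0"
    using underdetermined_system[of "n * k" N "\<lambda>t j. (deriv ^^ (t div n)) (F j (t mod n)) x"] \<open>\<not> N \<le> n * k\<close> by auto
  have "nullf n (lcomb N c F)"
    using index_pair_cases[of n k "\<lambda>i s. (\<Sum>j<N. (deriv ^^ i) (F j s) x * c j) = 0"] c(2)
    by (intro x) blast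
  thus False using assms(3) c(1) by (auto simp: indep_def)
qed

definition inspan :: "nat \<Rightarrow> nat \<Rightarrow> (nat \<Rightarrow> nat \<Rightarrow> complex \<Rightarrow> complex) \<Rightarrow> (nat \<Rightarrow> complex \<Rightarrow> complex) \<Rightarrow> bool" where
  "inspan n N F g \<longleftrightarrow> (\<exists>c. \<forall>s<n. \<forall>\<^sub>\<approx>x. g s x = lcomb N c F s x)"

lemma not_indep_Suc_imp_inspan:
  assumes "indep n N F" "\<not> indep n (Suc N) (F(N := g))"
  shows "inspan n N F g"
proof -
  obtain c where c: "nullf n (lcomb (Suc N) c (F(N := g)))" "\<exists>j<Suc N. c j \<noteq> 0"
    using assms(2) by (auto simp: indep_def)
  have eq: "lcomb (Suc N) c (F(N := g)) = (\<lambda>s x. lcomb N c F s x + c N * g s x)"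
    by (auto simp: lcomb_def fun_eq_iff intro!: sum.cong)
  have "c N \<noteq> 0"
  proof
    assume "c N = 0"
    hence "nullf n (lcomb N c F)" using c(1) unfolding eq by (simp add: nullf_def)
    hence "\<forall>j<N. c j = 0" using assms(1) by (auto simp: indep_def)
    with c(2) \<open>c N = 0\<close> show False by (auto simp: less_Suc_eq)
  qed
  have "\<forall>\<^sub>\<approx>x. g s x = lcomb N (\<lambda>j. - c j / c N) F s x" if "s < n" for s
  proof -
    have "\<forall>\<^sub>\<approx>x. lcomb N c F s x + c N * g s x = 0"
      using c(1) that unfolding eq by (auto simp: nullf_def)
    thus ?thesis
    proof eventually_elim
      case (elim x)
      hence "g s x = - lcomb N c F s x / c N"
        using \<open>c N \<noteq> 0\<close> by (simp add: field_simps add_eq_0_iff)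
      thus ?case by (simp add: lcomb_def sum_negf sum_divide_distrib)
    qed
  qed
  thus ?thesis by (auto simp: inspan_def)
qed

text \<open>A family of \<open>n * k\<close> independent solutions has the largest possible size, so
  adjoining any further solution makes it dependent.\<close>

lemma okernel_inspan:
  assumes "\<forall>\<^sub>\<approx>x. regular_at n k C x" "\<And>j. j < n * k \<Longrightarrow> F j \<in> okernel n k C" "indep n (n * k) F"
    and "g \<in> okernel n k C"
  shows "inspan n (n * k) F g"
proof (rule not_indep_Suc_imp_inspan[OF assms(3)], rule notI)
  assume "indep n (Suc (n * k)) (F(n * k := g))"
  hence "Suc (n * k) \<le> n * k"
    using assms by (intro indep_le[OF assms(1)]) auto
  thus False by simp
qed

section \<open>Exponential polynomials\<close>

definition qe :: "complex \<Rightarrow> complex poly \<Rightarrow> complex \<Rightarrow> complex" where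
  "qe \<alpha> p x = exp (\<alpha> * x) * poly p x"

text \<open>The derivative conjugated by the exponential, \<partial> + \<alpha>, acting on the
  polynomial factor.\<close>

definition dexp :: "complex \<Rightarrow> complex poly \<Rightarrow> complex poly" where
  "dexp \<alpha> p = smult \<alpha> p + pderiv p"

lemma qe_has_derivative: "(qe \<alpha> p has_field_derivative qe \<alpha> (dexp \<alpha> p) x) (at x)"
  unfolding qe_def[abs_def] dexp_def
  by (auto intro!: derivative_eq_intros simp: algebra_simps)

lemma qe_analytic [analytic_intros]: "qe \<alpha> p analytic_on S"
proof -
  have "qe \<alpha> p holomorphic_on UNIV"
    unfolding holomorphic_on_def using qe_has_derivative
    by (auto simp: field_differentiable_def)
  hence "qe \<alpha> p analytic_on UNIV" by (simp add: analytic_on_open)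
  thus ?thesis using analytic_on_subset by blast
qed

lemma qe_meromorphic [meromorphic_intros]: "qe \<alpha> p meromorphic_on S"
  by (intro analytic_on_imp_meromorphic_on qe_analytic)

lemma higher_deriv_qe: "(deriv ^^ i) (qe \<alpha> p) = qe \<alpha> ((dexp \<alpha> ^^ i) p)"
proof (induction i)
  case (Suc i)
  have "deriv (qe \<alpha> q) = qe \<alpha> (dexp \<alpha> q)" for q
    by (intro ext DERIV_imp_deriv qe_has_derivative)
  with Suc show ?case by simp
qed auto

lemma dexp_add: "dexp \<alpha> (p + q) = dexp \<alpha> p + dexp \<alpha> q"
  by (simp add: dexp_def smult_add_right pderiv_add)

lemma dexp_smult: "dexp \<alpha> (smult c p) = smult c (dexp \<alpha> p)"
  by (simp add: dexp_def smult_add_right pderiv_smult mult.commute)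

lemma funpow_dexp_add: "(dexp \<alpha> ^^ i) (p + q) = (dexp \<alpha> ^^ i) p + (dexp \<alpha> ^^ i) q"
  by (induction i) (auto simp: dexp_add)

lemma funpow_dexp_smult: "(dexp \<alpha> ^^ i) (smult c p) = smult c ((dexp \<alpha> ^^ i) p)"
  by (induction i) (auto simp: dexp_smult)

lemma funpow_dexp_dexp:
  "(dexp \<alpha> ^^ i) (dexp \<alpha> p) = smult \<alpha> ((dexp \<alpha> ^^ i) p) + (dexp \<alpha> ^^ i) (pderiv p)"
  by (simp only: dexp_def funpow_dexp_add funpow_dexp_smult)

lemma funpow_dexp_0 [simp]: "(dexp \<alpha> ^^ i) 0 = 0"
  using funpow_dexp_smult[of i \<alpha> 0 0] by simp

text \<open>For \<alpha> nonzero the term \<open>smult \<alpha> p\<close> keeps the degree while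
  \<open>pderiv p\<close> lowers it, so they cannot cancel.\<close>

lemma dexp_eq_0: "\<alpha> \<noteq> 0 \<Longrightarrow> dexp \<alpha> p = 0 \<Longrightarrow> p = 0"
proof (rule ccontr)
  assume *: "\<alpha> \<noteq> 0" "dexp \<alpha> p = 0" "p \<noteq> 0"
  hence eq: "smult \<alpha> p = - pderiv p" by (simp add: dexp_def add_eq_0_iff2)
  have "degree (smult \<alpha> p) = degree p" using * by simp
  with eq have "degree (pderiv p) = degree p" by simp
  hence "degree p = 0" by (simp add: degree_pderiv)
  hence "pderiv p = 0" by (simp add: pderiv_eq_0_iff)
  with eq * show False by simp
qed

lemma funpow_dexp_eq_0: "\<alpha> \<noteq> 0 \<Longrightarrow> (dexp \<alpha> ^^ i) p = 0 \<Longrightarrow> p = 0"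
  by (induction i) (auto dest: dexp_eq_0)

lemma funpow_pderiv_eq_0: "degree p < m \<Longrightarrow> (pderiv ^^ m) (p :: complex poly) = 0"
proof (induction m arbitrary: p)
  case (Suc m)
  show ?case
  proof (cases "degree p = 0")
    case True
    hence "pderiv p = 0" by (simp add: pderiv_eq_0_iff)
    moreover have "(pderiv ^^ m) (0 :: complex poly) = 0" by (induction m) auto
    ultimately show ?thesis by (simp add: funpow_Suc_right del: funpow.simps)
  next
    case False
    hence "degree (pderiv p) < m" using Suc.prems by (simp add: degree_pderiv)
    from Suc.IH[OF this] show ?thesis by (simp add: funpow_Suc_right del: funpow.simps)
  qed
qed auto

lemma dexp_zero: "dexp 0 = pderiv"
  by (auto simp: dexp_def)

text \<open>Multiplying by the inverse of the exponential with exponent \<beta> turns the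
  \<beta>-term into a polynomial, and differentiating more often than its degree removes it. On each
  other term this applies a power of \<partial> + (\<alpha> - \<beta>), which is injective on
  polynomials, so the induction hypothesis for the smaller set recovers those terms; the
  \<beta>-term is then all that remains.\<close>

lemma exp_poly_zero:
  assumes "finite S" "\<And>x. (\<Sum>\<alpha>\<in>S. qe \<alpha> (p \<alpha>) x) = 0" "\<alpha> \<in> S"
  shows "p \<alpha> = 0"
  using assms
proof (induction S arbitrary: p \<alpha> rule: finite_induct)
  case (insert \<beta> S)
  define m where "m = Suc (degree (p \<beta>))"
  have shift: "exp (- (\<beta> * x)) * qe \<alpha> q x = qe (\<alpha> - \<beta>) q x"
    "exp (\<beta> * x) * qe (\<alpha> - \<beta>) q x = qe \<alpha> q x" for \<alpha> q x
    by (simp_all add: qe_def mult_exp_exp[symmetric] left_diff_distrib exp_diff exp_minus field_simps)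
  have zero: "(\<lambda>x. \<Sum>\<alpha>\<in>insert \<beta> S. qe (\<alpha> - \<beta>) (p \<alpha>) x) = (\<lambda>x. 0)"
  proof
    fix x
    have "(\<Sum>\<alpha>\<in>insert \<beta> S. qe (\<alpha> - \<beta>) (p \<alpha>) x) = exp (- (\<beta> * x)) * (\<Sum>\<alpha>\<in>insert \<beta> S. qe \<alpha> (p \<alpha>) x)"
      by (simp only: sum_distrib_left shift)
    thus "(\<Sum>\<alpha>\<in>insert \<beta> S. qe (\<alpha> - \<beta>) (p \<alpha>) x) = 0"
      using insert.prems(1) by simp
  qed
  have *: "(\<Sum>\<alpha>\<in>S. qe \<alpha> ((dexp (\<alpha> - \<beta>) ^^ m) (p \<alpha>)) x) = 0" for x
  proof -
    have "0 = (deriv ^^ m) (\<lambda>x. \<Sum>\<alpha>\<in>insert \<beta> S. qe (\<alpha> - \<beta>) (p \<alpha>) x) x"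
      unfolding zero by simp
    also have "\<dots> = (\<Sum>\<alpha>\<in>insert \<beta> S. (deriv ^^ m) (qe (\<alpha> - \<beta>) (p \<alpha>)) x)"
      using insert.hyps by (intro higher_deriv_sum_at qe_analytic) auto
    also have "\<dots> = (\<Sum>\<alpha>\<in>S. qe (\<alpha> - \<beta>) ((dexp (\<alpha> - \<beta>) ^^ m) (p \<alpha>)) x)"
      using insert.hyps funpow_pderiv_eq_0[of "p \<beta>" m]
      by (simp add: higher_deriv_qe dexp_zero m_def qe_def del: funpow.simps)
    finally have "exp (\<beta> * x) * (\<Sum>\<alpha>\<in>S. qe (\<alpha> - \<beta>) ((dexp (\<alpha> - \<beta>) ^^ m) (p \<alpha>)) x) = 0"
      by simp
    thus ?thesis by (simp only: sum_distrib_left shift)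
  qed
  have S0: "p \<alpha> = 0" if "\<alpha> \<in> S" for \<alpha>
  proof -
    have "(dexp (\<alpha> - \<beta>) ^^ m) (p \<alpha>) = 0"
      by (rule insert.IH[OF * that])
    moreover have "\<alpha> - \<beta> \<noteq> 0" using that insert.hyps by auto
    ultimately show ?thesis using funpow_dexp_eq_0 by blast
  qed
  have "poly (p \<beta>) x = 0" for x
    using insert.prems(1)[of x] insert.hyps S0 by (simp add: qe_def)
  hence "p \<beta> = 0" using poly_all_0_iff_0 by blast
  with S0 insert.prems(2) show ?case by auto
qed auto

text \<open>Exponents in a family may repeat, whereas \<open>exp_poly_zero\<close> speaks about
  distinct ones; terms with a common exponent are merged.\<close>

lemma sum_qe_group:
  fixes N :: nat
  shows "(\<Sum>j<N. c j * qe (\<alpha> j) (w j) x) =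
     (\<Sum>\<beta>\<in>\<alpha> ` {..<N}. qe \<beta> (\<Sum>j | j < N \<and> \<alpha> j = \<beta>. smult (c j) (w j)) x)"
proof -
  have "(\<Sum>j<N. c j * qe (\<alpha> j) (w j) x) =
      (\<Sum>\<beta>\<in>\<alpha> ` {..<N}. \<Sum>j | j \<in> {..<N} \<and> \<alpha> j = \<beta>. c j * qe (\<alpha> j) (w j) x)"
    by (rule sum.image_gen) auto
  also have "\<dots> = (\<Sum>\<beta>\<in>\<alpha> ` {..<N}. qe \<beta> (\<Sum>j | j < N \<and> \<alpha> j = \<beta>. smult (c j) (w j)) x)"
    by (intro sum.cong refl) (auto simp: qe_def poly_sum sum_distrib_left mult_ac intro!: sum.cong)
  finally show ?thesis .
qed

lemma analytic_cosparse_zero: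
  assumes "f analytic_on UNIV" "\<forall>\<^sub>\<approx>x. f x = 0"
  shows "f x = (0 :: complex)"
proof -
  have "isCont f x"
    using analytic_at_imp_isCont analytic_on_subset[OF assms(1)] by blast
  thus ?thesis using continuous_eq_at[of x f "\<lambda>_. 0"] assms(2) by simp
qed

lemma smult_sum_right: "smult c (sum f S) = (\<Sum>i\<in>S. smult c (f i))"
  by (induction S rule: infinite_finite_induct) (auto simp: smult_add_right)

section \<open>The scalar operators d(\<partial>) and the explicit solutions of d(\<partial>) f =
  0\<close>

text \<open>This is d(\<partial> + \<alpha>) p, the polynomial factor of d(\<partial>) applied to
  \<open>qe \<alpha> p\<close>.\<close>

definition opapp :: "complex poly \<Rightarrow> complex \<Rightarrow> complex poly \<Rightarrow> complex poly" where
  "opapp d \<alpha> p = (\<Sum>i\<le>degree d. smult (coeff d i) ((dexp \<alpha> ^^ i) p))"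

lemma opapp_le: "degree d \<le> B \<Longrightarrow> opapp d \<alpha> p = (\<Sum>i\<le>B. smult (coeff d i) ((dexp \<alpha> ^^ i) p))"
  unfolding opapp_def by (intro sum.mono_neutral_left) (auto simp: coeff_eq_0)

text \<open>Conjugation by the exponential turns the factor \<partial> - \<alpha> into plain
  \<partial>. A root of multiplicity \<open>m\<close> therefore kills all polynomial factors of
  degree below \<open>m\<close>.\<close>

lemma opapp_linear_factor: "opapp ([:-\<alpha>, 1:] * d) \<alpha> p = opapp d \<alpha> (pderiv p)"
proof -
  define B where "B = degree d"
  have coeff: "coeff ([:-\<alpha>, 1:] * d) i = (case i of 0 \<Rightarrow> 0 | Suc i \<Rightarrow> coeff d i) - \<alpha> * coeff d i" for i
    by (simp add: coeff_pCons split: nat.splits)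
  have "degree ([:-\<alpha>, 1:] * d) \<le> Suc B"
    using degree_mult_le[of "[:-\<alpha>, 1:]" d] by (simp add: B_def)
  hence "opapp ([:-\<alpha>, 1:] * d) \<alpha> p =
      (\<Sum>i\<le>Suc B. smult (coeff ([:-\<alpha>, 1:] * d) i) ((dexp \<alpha> ^^ i) p))"
    by (rule opapp_le)
  also have "\<dots> = (\<Sum>i\<le>Suc B. smult (case i of 0 \<Rightarrow> 0 | Suc i \<Rightarrow> coeff d i) ((dexp \<alpha> ^^ i) p)) -
      (\<Sum>i\<le>Suc B. smult \<alpha> (smult (coeff d i) ((dexp \<alpha> ^^ i) p)))"
    by (simp only: coeff smult_diff_left sum_subtractf smult_smult)
  also have "(\<Sum>i\<le>Suc B. smult \<alpha> (smult (coeff d i) ((dexp \<alpha> ^^ i) p))) =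
      smult \<alpha> (\<Sum>i\<le>Suc B. smult (coeff d i) ((dexp \<alpha> ^^ i) p))"
    by (simp only: smult_sum_right)
  also have "\<dots> = smult \<alpha> (opapp d \<alpha> p)"
    by (subst opapp_le[of d "Suc B"]) (auto simp: B_def)
  also have "(\<Sum>i\<le>Suc B. smult (case i of 0 \<Rightarrow> 0 | Suc i \<Rightarrow> coeff d i) ((dexp \<alpha> ^^ i) p)) =
      (\<Sum>i\<le>B. smult (coeff d i) ((dexp \<alpha> ^^ i) (dexp \<alpha> p)))"
    by (subst sum.atMost_Suc_shift) (simp add: funpow_swap1)
  also have "\<dots> = (\<Sum>i\<le>B. smult \<alpha> (smult (coeff d i) ((dexp \<alpha> ^^ i) p)) +
       smult (coeff d i) ((dexp \<alpha> ^^ i) (pderiv p)))"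
    by (intro sum.cong refl)
       (simp add: funpow_dexp_dexp smult_add_right mult.commute)
  also have "\<dots> = smult \<alpha> (opapp d \<alpha> p) + opapp d \<alpha> (pderiv p)"
    by (simp add: sum.distrib smult_sum_right opapp_def B_def)
  finally show ?thesis by simp
qed

lemma opapp_eq_0:
  assumes "[:-\<alpha>, 1:] ^ m dvd d" "degree p < m"
  shows "opapp d \<alpha> p = 0"
proof -
  from assms(1) obtain e where d: "d = [:-\<alpha>, 1:] ^ m * e" by (auto simp: dvd_def)
  have "opapp ([:-\<alpha>, 1:] ^ m * e) \<alpha> p = opapp e \<alpha> ((pderiv ^^ m) p)" for m p
  proof (induction m arbitrary: p)
    case (Suc m)
    have "opapp ([:-\<alpha>, 1:] ^ Suc m * e) \<alpha> p = opapp ([:-\<alpha>, 1:] * ([:-\<alpha>, 1:] ^ m * e)) \<alpha> p"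
      by (simp only: power_Suc mult.assoc)
    also have "\<dots> = opapp e \<alpha> ((pderiv ^^ m) (pderiv p))"
      by (simp only: opapp_linear_factor Suc.IH)
    finally show ?case by (simp add: funpow_Suc_right del: funpow.simps)
  qed auto
  thus ?thesis using funpow_pderiv_eq_0[OF assms(2)] by (simp add: d opapp_def)
qed

definition dconst :: "complex poly \<Rightarrow> nat \<Rightarrow> nat \<Rightarrow> nat \<Rightarrow> complex \<Rightarrow> complex" where
  "dconst d i r s x = (if r = s then coeff d i else 0)"

lemma opr_dconst: "r < n \<Longrightarrow> opr n k (dconst d) f r x = (\<Sum>i\<le>k. coeff d i * (deriv ^^ i) (f r) x)"
  unfolding opr_def dconst_def by (simp add: if_distrib[of "\<lambda>c. c * _"] cong: if_cong)

lemma opr_dconst_qe: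
  assumes "r < n" "f r = qe \<alpha> w"
  shows "opr n (degree d) (dconst d) f r x = qe \<alpha> (opapp d \<alpha> w) x"
  unfolding opr_dconst[OF assms(1)] assms(2)
  by (simp add: higher_deriv_qe opapp_def qe_def poly_sum sum_distrib_left mult_ac)

lemma opr_dconst_eq_0:
  assumes "r < n" "f r = qe \<alpha> w" "[:-\<alpha>, 1:] ^ m dvd d" "degree w < m"
  shows "opr n (degree d) (dconst d) f r x = 0"
  unfolding opr_dconst_qe[where f = f, OF assms(1,2)] opapp_eq_0[OF assms(3,4)] by (simp add: qe_def)

lemma regular_dconst:
  assumes "d \<noteq> 0"
  shows "regular_at n (degree d) (dconst d) x"
  unfolding regular_at_def nonsing_def dconst_def[abs_def]
  using assms by (auto intro!: analytic_intros simp: if_distrib[of "\<lambda>c. c * _"] cong: if_cong)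

text \<open>The pairs (\<alpha>, t) with t below the multiplicity of \<alpha> index the classical
  fundamental system of functions \<open>x ^ t * exp (\<alpha> * x)\<close>; over the complex
  numbers the multiplicities add up to the degree.\<close>

lemma card_roots_order:
  fixes d :: "complex poly"
  assumes "d \<noteq> 0"
  shows "card (SIGMA \<alpha>:{z. poly d z = 0}. {..<order \<alpha> d}) = degree d"
proof -
  have "degree d = degree (smult (lead_coeff d) (\<Prod>z|poly d z = 0. [:-z, 1:] ^ order z d))"
    by (simp only: complex_poly_decompose)
  also have "\<dots> = degree (\<Prod>z|poly d z = 0. [:-z, 1:] ^ order z d)"
    using assms by simp
  also have "\<dots> = (\<Sum>z|poly d z = 0. order z d)"
    by (subst degree_prod_eq_sum_degree) (auto simp: degree_power_eq)
  finally show ?thesis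
    using poly_roots_finite[OF assms] by simp
qed

lemma dconst_kernel_basis:
  assumes "d \<noteq> 0"
  obtains \<alpha> :: "nat \<Rightarrow> complex" and w :: "nat \<Rightarrow> nat \<Rightarrow> complex poly" where
    "\<And>j. j < n * degree d \<Longrightarrow> (\<lambda>s. qe (\<alpha> j) (w j s)) \<in> okernel n (degree d) (dconst d)"
    "indep n (n * degree d) (\<lambda>j s. qe (\<alpha> j) (w j s))"
proof -
  \<comment> \<open>The index \<open>((\<alpha>, t), s)\<close> stands for
    \<open>x ^ t * exp (\<alpha> * x)\<close> placed in component \<open>s\<close>, all other
    components being zero.\<close>
  define J where "J = (SIGMA \<alpha>:{z. poly d z = 0}. {..<order \<alpha> d}) \<times> {..<n}"
  have "finite J" using poly_roots_finite[OF assms] by (auto simp: J_def)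
  moreover have "card J = n * degree d"
    using assms by (simp add: J_def card_cartesian_product card_roots_order)
  ultimately obtain h where h: "bij_betw h {..<n * degree d} J"
    using ex_bij_betw_nat_finite[of J] by (auto simp: atLeast0LessThan)
  define \<alpha> where "\<alpha> j = fst (fst (h j))" for j
  define w where "w j s = (if s = snd (h j) then monom 1 (snd (fst (h j))) else 0 :: complex poly)" for j s
  have hJ: "h j \<in> J" if "j < n * degree d" for j using h that by (auto simp: bij_betw_def)
  show ?thesis
  proof
    fix j assume j: "j < n * degree d"
    have "[:-\<alpha> j, 1:] ^ order (\<alpha> j) d dvd d"
      using assms by (simp add: order_divides)
    moreover have "degree (w j r) < order (\<alpha> j) d" for r
      using hJ[OF j] degree_monom_le[of "1::complex"] by (auto simp: J_def \<alpha>_def w_def degree_monom_eq)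
    ultimately have "opr n (degree d) (dconst d) (\<lambda>s. qe (\<alpha> j) (w j s)) r x = 0" if "r < n" for r x
      using that by (intro opr_dconst_eq_0) auto
    thus "(\<lambda>s. qe (\<alpha> j) (w j s)) \<in> okernel n (degree d) (dconst d)"
      by (auto simp: okernel_def merov_def nullf_def intro!: qe_meromorphic)
  next
    show "indep n (n * degree d) (\<lambda>j s. qe (\<alpha> j) (w j s))"
      unfolding indep_def
    proof (intro allI impI)
      fix c j0 assume null: "nullf n (lcomb (n * degree d) c (\<lambda>j s. qe (\<alpha> j) (w j s)))"
        and j0: "j0 < n * degree d"
      \<comment> \<open>Exponent, power and component together identify the index \<open>j0\<close>,
        so the coefficient of degree \<open>t\<close> in component \<open>s\<close> of the group
        with exponent \<open>\<alpha> j0\<close> isolates \<open>c j0\<close>.\<close>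
      define s t where "s = snd (h j0)" and "t = snd (fst (h j0))"
      have s: "s < n" using hJ[OF j0] by (auto simp: J_def s_def)
      have "lcomb (n * degree d) c (\<lambda>j s. qe (\<alpha> j) (w j s)) s analytic_on UNIV"
        unfolding lcomb_def[abs_def] by (intro analytic_intros)
      hence "lcomb (n * degree d) c (\<lambda>j s. qe (\<alpha> j) (w j s)) s x = 0" for x
        using null s by (intro analytic_cosparse_zero) (auto simp: nullf_def)
      hence "(\<Sum>\<beta>\<in>\<alpha> ` {..<n * degree d}. qe \<beta>
          (\<Sum>j | j < n * degree d \<and> \<alpha> j = \<beta>. smult (c j) (w j s)) x) = 0" for x
        by (simp add: lcomb_def sum_qe_group)
      hence "(\<Sum>j | j < n * degree d \<and> \<alpha> j = \<alpha> j0. smult (c j) (w j s)) = 0"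
        using j0 by (intro exp_poly_zero[where S = "\<alpha> ` {..<n * degree d}"]) auto
      hence "0 = coeff (\<Sum>j | j < n * degree d \<and> \<alpha> j = \<alpha> j0. smult (c j) (w j s)) t"
        by simp
      also have "\<dots> = (\<Sum>j | j < n * degree d \<and> \<alpha> j = \<alpha> j0. if j = j0 then c j0 else 0)"
        unfolding coeff_sum
      proof (intro sum.cong refl)
        fix j assume "j \<in> {j. j < n * degree d \<and> \<alpha> j = \<alpha> j0}"
        hence j: "j < n * degree d" "\<alpha> j = \<alpha> j0" by auto
        have "snd (h j) = s \<and> snd (fst (h j)) = t \<longleftrightarrow> h j = h j0"
          using j(2) by (auto simp: \<alpha>_def s_def t_def prod_eq_iff)
        also have "\<dots> \<longleftrightarrow> j = j0"
          using h j(1) j0 by (auto simp: bij_betw_def inj_on_def)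
        finally show "coeff (smult (c j) (w j s)) t = (if j = j0 then c j0 else 0)"
          by (auto simp: w_def coeff_monom)
      qed
      also have "\<dots> = c j0"
        using j0 by simp
      finally show "c j0 = 0" by simp
    qed
  qed
qed

section \<open>Operators with constant coefficients\<close>

abbreviation sqmat :: "nat \<Rightarrow> (nat \<Rightarrow> nat \<Rightarrow> 'a) \<Rightarrow> 'a mat" where
  "sqmat n A \<equiv> Matrix.mat n n (\<lambda>(r, s). A r s)"

lemma sqmat_mult_vec:
  fixes A :: "nat \<Rightarrow> nat \<Rightarrow> 'a :: semiring_0"
  shows "v \<in> carrier_vec n \<Longrightarrow> r < n \<Longrightarrow> (sqmat n A *\<^sub>v v) $ r = (\<Sum>s<n. A r s * v $ s)"
  by (simp add: scalar_prod_def atLeast0LessThan)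

lemma sqmat_mult_index:
  fixes A :: "nat \<Rightarrow> nat \<Rightarrow> 'a :: semiring_0"
  shows "r < n \<Longrightarrow> s < n \<Longrightarrow> (sqmat n A * sqmat n B) $$ (r, s) = (\<Sum>t<n. A r t * B t s)"
  by (simp add: scalar_prod_def atLeast0LessThan)

lemma nonsing_iff_det: "nonsing n A \<longleftrightarrow> det (sqmat n A) \<noteq> 0"
proof -
  have eq: "(\<forall>r<n. (\<Sum>s<n. A r s * v s) = 0) \<longleftrightarrow> sqmat n A *\<^sub>v Matrix.vec n v = 0\<^sub>v n" for v
    using sqmat_mult_vec[of "Matrix.vec n v" n _ A] by (auto simp: vec_eq_iff cong: sum.cong_simp)
  have "det (sqmat n A) = 0 \<longleftrightarrow> (\<exists>v. v \<in> carrier_vec n \<and> v \<noteq> 0\<^sub>v n \<and> sqmat n A *\<^sub>v v = 0\<^sub>v n)"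
    by (rule det_0_iff_vec_prod_zero_field) simp
  also have "\<dots> \<longleftrightarrow> (\<exists>v. Matrix.vec n v \<noteq> 0\<^sub>v n \<and> sqmat n A *\<^sub>v Matrix.vec n v = 0\<^sub>v n)"
  proof safe
    fix v assume "v \<in> carrier_vec n" "v \<noteq> 0\<^sub>v n" "sqmat n A *\<^sub>v v = 0\<^sub>v n"
    moreover have "v = Matrix.vec n (\<lambda>i. v $ i)" using \<open>v \<in> carrier_vec n\<close> by auto
    ultimately show "\<exists>v. Matrix.vec n v \<noteq> 0\<^sub>v n \<and> sqmat n A *\<^sub>v Matrix.vec n v = 0\<^sub>v n" by metis
  next
    fix v assume "Matrix.vec n v \<noteq> 0\<^sub>v n" "sqmat n A *\<^sub>v Matrix.vec n v = 0\<^sub>v n"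
    thus "\<exists>v. v \<in> carrier_vec n \<and> v \<noteq> 0\<^sub>v n \<and> sqmat n A *\<^sub>v v = 0\<^sub>v n"
      by (intro exI[of _ "Matrix.vec n v"]) auto
  qed
  also have "\<dots> \<longleftrightarrow> \<not> nonsing n A"
    unfolding nonsing_def eq by (auto simp: vec_eq_iff)
  finally show ?thesis by simp
qed

lemma nonsing_transpose: "nonsing n A \<longleftrightarrow> nonsing n (\<lambda>r s. A s r)"
proof -
  have "(sqmat n A)\<^sup>T = sqmat n (\<lambda>r s. A s r)" by (rule eq_matI) auto
  hence "det (sqmat n (\<lambda>r s. A s r)) = det (sqmat n A)"
    using det_transpose[of "sqmat n A" n] by simp
  thus ?thesis by (simp add: nonsing_iff_det)
qed

lemma coeff_mult_degree_bounds:
  fixes p q :: "'a :: comm_semiring_0 poly"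
  assumes "degree p \<le> a" "degree q \<le> b"
  shows "coeff (p * q) (a + b) = coeff p a * coeff q b"
proof -
  have "coeff (p * q) (a + b) = (\<Sum>i\<le>a + b. if i = a then coeff p a * coeff q b else 0)"
    unfolding coeff_mult
  proof (intro sum.cong refl)
    fix i assume "i \<in> {..a + b}"
    show "coeff p i * coeff q (a + b - i) = (if i = a then coeff p a * coeff q b else 0)"
      using assms by (cases i a rule: linorder_cases) (auto simp: coeff_eq_0)
  qed
  thus ?thesis by simp
qed

text \<open>With \<open>g k\<close> the \<open>k\<close>-th derivative of a function at a point,
  this says that composing scalar operators with constant coefficients multiplies their symbols. The
  triangle of index pairs contains the rectangle, and the degree bounds annihilate the rest.\<close>

lemma sum_coeff_mult:
  fixes p q :: "complex poly"
  assumes "degree p \<le> a" "degree q \<le> b"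
  shows "(\<Sum>k\<le>a + b. coeff (p * q) k * g k) = (\<Sum>i\<le>a. \<Sum>j\<le>b. coeff p i * coeff q j * g (i + j))"
proof -
  have "(\<Sum>k\<le>a + b. coeff (p * q) k * g k) =
      (\<Sum>k\<le>a + b. \<Sum>i\<le>k. coeff p i * coeff q (k - i) * g (i + (k - i)))"
    unfolding coeff_mult by (simp add: sum_distrib_right)
  also have "\<dots> = (\<Sum>(i, j)\<in>{(i, j). i + j \<le> a + b}. coeff p i * coeff q j * g (i + j))"
    by (rule sum.triangle_reindex_eq[symmetric])
  also have "\<dots> = (\<Sum>(i, j)\<in>{..a} \<times> {..b}. coeff p i * coeff q j * g (i + j))"
  proof (rule sum.mono_neutral_right)
    have "{(i, j). i + j \<le> a + b} \<subseteq> {..a + b} \<times> {..a + b}" by auto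
    thus "finite {(i, j). i + j \<le> a + b}" by (rule finite_subset) auto
    show "\<forall>x\<in>{(i, j). i + j \<le> a + b} - {..a} \<times> {..b}.
        (case x of (i, j) \<Rightarrow> coeff p i * coeff q j * g (i + j)) = 0"
      using assms by (auto dest!: le_degree)
  qed auto
  finally show ?thesis by (simp add: sum.cartesian_product)
qed

abbreviation constc :: "(nat \<Rightarrow> nat \<Rightarrow> nat \<Rightarrow> complex) \<Rightarrow> nat \<Rightarrow> nat \<Rightarrow> nat \<Rightarrow> complex \<Rightarrow> complex" where
  "constc L \<equiv> (\<lambda>i r s x. L i r s)"

lemma regular_constc: "nonsing n (L l) \<Longrightarrow> regular_at n l (constc L) x"
  by (auto simp: regular_at_def)

text \<open>If \<open>det L(z)\<close> vanished identically, every \<open>z\<close> would contribute a solution \<open>e\<^sup>z\<^sup>x v\<close> to the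
  finite-dimensional kernel of \<open>L(\<partial>)\<close>.\<close>

lemma symbol_det_nonzero:
  assumes "nonsing n (L l)"
  shows "det (sqmat n (\<lambda>r s. \<Sum>i\<le>l. monom (L i r s) i)) \<noteq> (0 :: complex poly)"
proof
  assume det0: "det (sqmat n (\<lambda>r s. \<Sum>i\<le>l. monom (L i r s) i)) = 0"
  have "\<not> nonsing n (\<lambda>r s. \<Sum>i\<le>l. L i r s * z ^ i)" for z
  proof -
    interpret comm_ring_hom "\<lambda>p :: complex poly. poly p z" by unfold_locales auto
    have "map_mat (\<lambda>p. poly p z) (sqmat n (\<lambda>r s. \<Sum>i\<le>l. monom (L i r s) i)) =
        sqmat n (\<lambda>r s. \<Sum>i\<le>l. L i r s * z ^ i)"
      by (rule eq_matI) (auto simp: poly_sum poly_monom)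
    hence "det (sqmat n (\<lambda>r s. \<Sum>i\<le>l. L i r s * z ^ i)) = poly 0 z"
      using hom_det[of "sqmat n (\<lambda>r s. \<Sum>i\<le>l. monom (L i r s) i)"] unfolding det0 by (simp only:)
    thus ?thesis by (simp add: nonsing_iff_det)
  qed
  hence "\<forall>z. \<exists>v. (\<forall>r<n. (\<Sum>s<n. (\<Sum>i\<le>l. L i r s * z ^ i) * v s) = 0) \<and> (\<exists>s<n. v s \<noteq> 0)"
    unfolding nonsing_def by simp
  from choice[OF this] obtain v where
    "\<forall>z. (\<forall>r<n. (\<Sum>s<n. (\<Sum>i\<le>l. L i r s * z ^ i) * v z s) = 0) \<and> (\<exists>s<n. v z s \<noteq> 0)" ..
  hence v: "\<And>z r. r < n \<Longrightarrow> (\<Sum>s<n. (\<Sum>i\<le>l. L i r s * z ^ i) * v z s) = 0"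
    "\<And>z. \<exists>s<n. v z s \<noteq> 0" by simp_all
  define F where "F j s = qe (of_nat j) [:v (of_nat j) s:]" for j s
  \<comment> \<open>The exponents 0, ..., \<open>n * l\<close> already give one solution more than
    \<open>indep_le\<close> allows.\<close>
  define N where "N = Suc (n * l)"
  have dexp_const: "(dexp z ^^ i) [:c:] = [:c * z ^ i:]" for z c i
    by (induction i) (auto simp: dexp_def pderiv_pCons)
  have "F j \<in> okernel n l (constc L)" for j
  proof -
    define z where "z = (of_nat j :: complex)"
    have "opr n l (constc L) (F j) r x = 0" if "r < n" for r x
    proof -
      have "opr n l (constc L) (F j) r x = (\<Sum>i\<le>l. \<Sum>s<n. exp (z * x) * (L i r s * z ^ i * v z s))"
        by (simp add: opr_def F_def higher_deriv_qe dexp_const qe_def z_def mult_ac)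
      also have "\<dots> = (\<Sum>s<n. \<Sum>i\<le>l. exp (z * x) * (L i r s * z ^ i * v z s))"
        by (rule sum.swap)
      also have "\<dots> = exp (z * x) * (\<Sum>s<n. (\<Sum>i\<le>l. L i r s * z ^ i) * v z s)"
        by (simp add: sum_distrib_left sum_distrib_right)
      finally show ?thesis using v(1)[OF that] by simp
    qed
    thus ?thesis
      by (auto simp: okernel_def merov_def nullf_def F_def intro!: qe_meromorphic)
  qed
  moreover have "indep n N F"
    unfolding indep_def
  proof (intro allI impI)
    fix c j0 assume null: "nullf n (lcomb N c F)" and j0: "j0 < N"
    obtain s where s: "s < n" "v (of_nat j0) s \<noteq> 0" using v(2) by blast
    have "lcomb N c F s analytic_on UNIV"
      unfolding lcomb_def[abs_def] F_def by (intro analytic_intros)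
    hence *: "lcomb N c F s x = 0" for x
      using null s by (intro analytic_cosparse_zero) (auto simp: nullf_def)
    have "(\<Sum>\<beta>\<in>of_nat ` {..<N}. qe \<beta>
        (\<Sum>j | j < N \<and> of_nat j = \<beta>. smult (c j) [:v (of_nat j) s:]) x) = 0" for x
      using *[of x] unfolding lcomb_def F_def by (subst (asm) sum_qe_group)
    hence "(\<Sum>j | j < N \<and> (of_nat j :: complex) = of_nat j0. smult (c j) [:v (of_nat j) s:]) = 0"
      using j0 by (intro exp_poly_zero[where S = "of_nat ` {..<N}"]) auto
    moreover have "{j. j < N \<and> (of_nat j :: complex) = of_nat j0} = {j0}" using j0 by auto
    ultimately show "c j0 = 0" using s by simp
  qed
  ultimately have "N \<le> n * l"
    using regular_constc[where L = L and l = l, OF assms] by (intro indep_le[of n l "constc L" N F]) auto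
  thus False by (simp add: N_def)
qed

text \<open>\<open>M\<close> is the adjugate of the symbol of \<open>L\<close> and \<open>m\<close>
  the largest degree of its entries. Comparing coefficients of degree \<open>m + l\<close> in
  adjugate times symbol shows that the top coefficients \<open>M m\<close> and \<open>L l\<close>
  multiply to a scalar matrix. This scalar is nonzero, as otherwise the invertible
  \<open>L l\<close> would force \<open>M m\<close> to vanish against the choice of
  \<open>m\<close>. Hence the degree of \<open>d\<close> is exactly \<open>m + l\<close>, and the
  leading coefficient of \<open>M\<close> is invertible too.\<close>

lemma const_opr_annihilator:
  assumes "nonsing n (L l)" "n > 0"
  obtains d m M where "d \<noteq> 0" "degree d = m + l" "nonsing n (M m)"
    "\<And>f x r. r < n \<Longrightarrow> (\<forall>s<n. f s analytic_on {x}) \<Longrightarrow>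
      opr n m (constc M) (opr n l (constc L) f) r x = opr n (degree d) (dconst d) f r x"
proof -
  define \<Lambda> where "\<Lambda> r s = (\<Sum>i\<le>l. monom (L i r s) i)" for r s
  define d where "d = det (sqmat n \<Lambda>)"
  define A where "A r s = adj_mat (sqmat n \<Lambda>) $$ (r, s)" for r s
  define m where "m = Max ((\<lambda>(r, s). degree (A r s)) ` ({..<n} \<times> {..<n}))"
  define M where "M i r s = coeff (A r s) i" for i r s
  have d0: "d \<noteq> 0" unfolding d_def \<Lambda>_def by (rule symbol_det_nonzero[where L=L and l=l, OF assms(1)])
  have coeff\<Lambda>: "coeff (\<Lambda> r s) i = (if i \<le> l then L i r s else 0)" for i r s
    by (simp add: \<Lambda>_def coeff_sum coeff_monom)
  have deg\<Lambda>: "degree (\<Lambda> r s) \<le> l" for r s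
    by (rule degree_le) (simp add: coeff\<Lambda>)
  have degA: "degree (A r s) \<le> m" if "r < n" "s < n" for r s
    unfolding m_def using that by (intro Max_ge) force+
  have A: "(\<Sum>t<n. A r t * \<Lambda> t s) = (if r = s then d else 0)" if "r < n" "s < n" for r s
  proof -
    have "adj_mat (sqmat n \<Lambda>) = sqmat n A"
      using adj_mat(1)[of "sqmat n \<Lambda>" n] by (intro eq_matI) (auto simp: A_def)
    hence "sqmat n A * sqmat n \<Lambda> = d \<cdot>\<^sub>m 1\<^sub>m n"
      using adj_mat(3)[of "sqmat n \<Lambda>" n] by (simp add: d_def)
    hence "(sqmat n A * sqmat n \<Lambda>) $$ (r, s) = (d \<cdot>\<^sub>m 1\<^sub>m n) $$ (r, s)" by simp
    thus ?thesis using that by (subst (asm) sqmat_mult_index) auto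
  qed
  have top: "(\<Sum>t<n. M m r t * L l t s) = (if r = s then coeff d (m + l) else 0)"
    if "r < n" "s < n" for r s
  proof -
    have "(\<Sum>t<n. M m r t * L l t s) = (\<Sum>t<n. coeff (A r t * \<Lambda> t s) (m + l))"
      using that degA deg\<Lambda> by (intro sum.cong refl) (simp add: coeff_mult_degree_bounds M_def coeff\<Lambda>)
    also have "\<dots> = coeff (if r = s then d else 0) (m + l)"
      using A[OF that] by (simp flip: coeff_sum)
    finally show ?thesis by simp
  qed
  have deg_le: "degree d \<le> m + l"
  proof -
    have "degree (\<Sum>t<n. A 0 t * \<Lambda> t 0) \<le> m + l"
      using degA deg\<Lambda> assms(2)
      by (intro degree_sum_le) (auto intro!: order_trans[OF degree_mult_le] add_mono)
    thus ?thesis using A[of 0 0] assms(2) by simp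
  qed
  have "coeff d (m + l) \<noteq> 0"
  proof
    assume 0: "coeff d (m + l) = 0"
    have M0: "M m r t = 0" if "r < n" "t < n" for r t
    proof -
      have "nonsing n (\<lambda>s t. L l t s)" using assms(1) nonsing_transpose by blast
      moreover have "(\<Sum>t<n. L l t s * M m r t) = 0" if "s < n" for s
        using top[OF \<open>r < n\<close> that] 0 by (simp add: mult.commute)
      ultimately show ?thesis
        using \<open>t < n\<close> unfolding nonsing_def by (elim allE[where x = "M m r"]) simp
    qed
    have "m \<in> (\<lambda>(r, s). degree (A r s)) ` ({..<n} \<times> {..<n})"
      unfolding m_def using assms(2) by (intro Max_in) auto
    then obtain r t where rt: "r < n" "t < n" "m = degree (A r t)" by auto
    \<comment> \<open>An entry attaining the degree \<open>m\<close> would have leading coefficient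
      zero. Only the zero polynomial, whose degree is 0 by convention, does; so
      \<open>m = 0\<close>, and then the whole adjugate is zero.\<close>
    hence "A r t = 0" using M0[of r t] by (simp add: M_def)
    hence "m = 0" using rt by simp
    have "A r t = 0" if "r < n" "t < n" for r t
    proof -
      have "degree (A r t) = m" using degA[OF that] \<open>m = 0\<close> by simp
      hence "lead_coeff (A r t) = 0" using M0[OF that] by (simp add: M_def)
      thus ?thesis by simp
    qed
    hence "d = 0" using A[of 0 0] assms(2) by simp
    with d0 show False by simp
  qed
  hence deg: "degree d = m + l" using deg_le le_degree by (metis antisym)
  show ?thesis
  proof
    show "d \<noteq> 0" "degree d = m + l" by fact+
    have "sqmat n (M m) * sqmat n (L l) = coeff d (m + l) \<cdot>\<^sub>m 1\<^sub>m n"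
    proof (rule eq_matI)
      fix r s assume "r < dim_row (coeff d (m + l) \<cdot>\<^sub>m 1\<^sub>m n)" "s < dim_col (coeff d (m + l) \<cdot>\<^sub>m 1\<^sub>m n)"
      hence rs: "r < n" "s < n" by auto
      show "(sqmat n (M m) * sqmat n (L l)) $$ (r, s) = (coeff d (m + l) \<cdot>\<^sub>m 1\<^sub>m n) $$ (r, s)"
        using top[OF rs] sqmat_mult_index[OF rs, of "M m" "L l"] rs by simp
    qed auto
    hence "det (sqmat n (M m)) * det (sqmat n (L l)) = coeff d (m + l) ^ n"
      using det_mult[of "sqmat n (M m)" n "sqmat n (L l)"] by simp
    thus "nonsing n (M m)"
      using \<open>coeff d (m + l) \<noteq> 0\<close> by (auto simp: nonsing_iff_det)
  next
    fix f :: "nat \<Rightarrow> complex \<Rightarrow> complex" and x r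
    assume r: "r < n" and f: "\<forall>s<n. f s analytic_on {x}"
    have higher: "(deriv ^^ i) (opr n l (constc L) f t) x =
        (\<Sum>j\<le>l. \<Sum>s<n. L j t s * (deriv ^^ (i + j)) (f s) x)" for i t
    proof -
      have "(deriv ^^ i) (opr n l (constc L) f t) x =
          (\<Sum>j\<le>l. (deriv ^^ i) (\<lambda>w. \<Sum>s<n. L j t s * (deriv ^^ j) (f s) w) x)"
        unfolding opr_def[abs_def] using f by (intro higher_deriv_sum_at) (auto intro!: analytic_intros)
      also have "\<dots> = (\<Sum>j\<le>l. \<Sum>s<n. (deriv ^^ i) (\<lambda>w. L j t s * (deriv ^^ j) (f s) w) x)"
        using f by (intro sum.cong higher_deriv_sum_at) (auto intro!: analytic_intros)
      also have "\<dots> = (\<Sum>j\<le>l. \<Sum>s<n. L j t s * (deriv ^^ i) ((deriv ^^ j) (f s)) x)"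
        using f by (intro sum.cong refl higher_deriv_cmult') (auto intro!: analytic_intros)
      finally show ?thesis by (simp add: funpow_add)
    qed
    have "opr n m (constc M) (opr n l (constc L) f) r x =
        (\<Sum>i\<le>m. \<Sum>t<n. \<Sum>j\<le>l. \<Sum>s<n. M i r t * L j t s * (deriv ^^ (i + j)) (f s) x)"
      unfolding opr_def[of n m] higher by (simp add: sum_distrib_left mult.assoc)
    also have "\<dots> = (\<Sum>t<n. \<Sum>s<n. \<Sum>i\<le>m. \<Sum>j\<le>l. M i r t * L j t s * (deriv ^^ (i + j)) (f s) x)"
      by (simp add: sum.swap[of _ "{..<n}" "{..l}"] sum.swap[of _ "{..<n}" "{..m}"])
    also have "\<dots> = (\<Sum>s<n. \<Sum>t<n. \<Sum>i\<le>m. \<Sum>j\<le>l. M i r t * L j t s * (deriv ^^ (i + j)) (f s) x)"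
      by (rule sum.swap)
    also have "\<dots> = (\<Sum>s<n. \<Sum>t<n. \<Sum>k\<le>m + l. coeff (A r t * \<Lambda> t s) k * (deriv ^^ k) (f s) x)"
    proof (rule sum.cong[OF refl], rule sum.cong[OF refl])
      fix s t assume "s \<in> {..<n}" "t \<in> {..<n}"
      hence "degree (A r t) \<le> m" using degA r by auto
      thus "(\<Sum>i\<le>m. \<Sum>j\<le>l. M i r t * L j t s * (deriv ^^ (i + j)) (f s) x) =
          (\<Sum>k\<le>m + l. coeff (A r t * \<Lambda> t s) k * (deriv ^^ k) (f s) x)"
        using sum_coeff_mult[of "A r t" m "\<Lambda> t s" l "\<lambda>k. (deriv ^^ k) (f s) x"] deg\<Lambda>
        by (simp add: M_def coeff\<Lambda>)
    qed
    also have "\<dots> = (\<Sum>s<n. \<Sum>k\<le>m + l. coeff (\<Sum>t<n. A r t * \<Lambda> t s) k * (deriv ^^ k) (f s) x)"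
      by (simp add: coeff_sum sum_distrib_right sum.swap[of _ "{..<n}" "{..m + l}"])
    also have "\<dots> = (\<Sum>s<n. \<Sum>k\<le>m + l. dconst d k r s x * (deriv ^^ k) (f s) x)"
      using A r by (intro sum.cong refl) (auto simp: dconst_def)
    also have "\<dots> = opr n (degree d) (dconst d) f r x"
      unfolding opr_def deg by (rule sum.swap)
    finally show "opr n m (constc M) (opr n l (constc L) f) r x = opr n (degree d) (dconst d) f r x" .
  qed
qed

text \<open>The test function is \<open>(x - x0) ^ (p + q)\<close> in component 0, with
  \<open>x0\<close> regular for both factors. If \<open>l\<close> were smaller than
  \<open>p + q\<close>, applying \<open>L\<close> would give zero at \<open>x0\<close>, while
  applying \<open>P\<close> and then \<open>Q\<close> leaves the two leading coefficients at
  \<open>x0\<close> acting on a nonzero jet.\<close>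

lemma order_factors_le:
  assumes "\<forall>\<^sub>\<approx>x. regular_at n q Q x" "\<forall>\<^sub>\<approx>x. regular_at n p P x" "n > 0"
    and factor: "\<And>f r. merov n f \<Longrightarrow> r < n \<Longrightarrow> \<forall>\<^sub>\<approx>x. opr n l (constc L) f r x = opr n q Q (opr n p P f) r x"
  shows "p + q \<le> l"
proof (rule ccontr)
  assume l: "\<not> p + q \<le> l"
  from assms(1,2) have "\<forall>\<^sub>\<approx>x. regular_at n q Q x \<and> regular_at n p P x"
    by eventually_elim auto
  then obtain x0 where "regular_at n q Q x0" "regular_at n p P x0"
    using cosparse_frequently by blast
  hence Q: "\<forall>i\<le>q. \<forall>r<n. \<forall>s<n. Q i r s analytic_on {x0}" "nonsing n (\<lambda>r s. Q q r s x0)"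
    and P: "\<forall>i\<le>p. \<forall>r<n. \<forall>s<n. P i r s analytic_on {x0}" "nonsing n (\<lambda>r s. P p r s x0)"
    by (auto simp: regular_at_def)
  define f where "f s = (if s = 0 then (\<lambda>x. (x - x0) ^ (p + q)) else (\<lambda>_. 0))" for s :: nat
  have f: "f s analytic_on S" for s S
    unfolding f_def by (auto intro!: analytic_intros)
  have fz: "(deriv ^^ i) (f s) x0 = 0" if "i < p + q" for i s
    using that by (simp add: f_def higher_deriv_power)
  define g where "g = opr n p P f"
  have g: "\<forall>s<n. g s analytic_on {x0}"
    unfolding g_def using opr_analytic[OF P(1)] f by blast
  have gz: "(deriv ^^ i) (g r) x0 = 0" if "i < q" "r < n" for i r
    unfolding g_def using higher_deriv_opr_vanishing[OF P(1), of f r q i] that f fz by simp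
  have gq: "(deriv ^^ q) (g r) x0 = (\<Sum>s<n. P p r s x0 * (deriv ^^ (p + q)) (f s) x0)" if "r < n" for r
    unfolding g_def using higher_deriv_opr_vanishing[OF P(1), of f r q q] that f fz by simp
  have zero: "(\<Sum>s<n. Q q r s x0 * (deriv ^^ q) (g s) x0) = 0" if r: "r < n" for r
  proof -
    have "merov n f" using f by (auto simp: merov_def intro!: analytic_on_imp_meromorphic_on)
    from factor[OF this r] have ev: "\<forall>\<^sub>\<approx>x. opr n l (constc L) f r x = opr n q Q g r x"
      by (simp add: g_def)
    have "opr n l (constc L) f r analytic_on {x0}"
      using f r by (intro opr_analytic) auto
    moreover have "opr n q Q g r analytic_on {x0}"
      using g r Q by (intro opr_analytic) auto
    ultimately have "opr n l (constc L) f r x0 = opr n q Q g r x0"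
      by (intro continuous_eq_at[OF _ _ ev]) (auto intro: analytic_at_imp_isCont)
    moreover have "opr n l (constc L) f r x0 = 0"
      unfolding opr_def using l fz by (intro sum.neutral ballI) auto
    moreover have "opr n q Q g r x0 = (\<Sum>s<n. Q q r s x0 * (deriv ^^ q) (g s) x0)"
      using higher_deriv_opr_vanishing[OF Q(1) g r, of 0 0] gz by simp
    ultimately show ?thesis by simp
  qed
  have "(deriv ^^ q) (g r) x0 = 0" if "r < n" for r
    using Q(2) zero that unfolding nonsing_def
    by (elim allE[where x = "\<lambda>s. (deriv ^^ q) (g s) x0"]) simp
  hence "(deriv ^^ (p + q)) (f s) x0 = 0" if "s < n" for s
    using P(2) gq that unfolding nonsing_def
    by (elim allE[where x = "\<lambda>s. (deriv ^^ (p + q)) (f s) x0"]) simp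
  from this[OF assms(3)] show False
    by (simp add: f_def higher_deriv_power pochhammer_fact[symmetric])
qed

section \<open>Rational functions\<close>

lemma poly_nonzero_cosparse: "q \<noteq> 0 \<Longrightarrow> \<forall>\<^sub>\<approx>x. poly q (x :: complex) \<noteq> 0"
  by (simp add: eventually_cosparse finite_imp_sparse poly_roots_finite)

lemma rational_funI: "q \<noteq> 0 \<Longrightarrow> \<forall>\<^sub>\<approx>x. f x = poly p x / poly q x \<Longrightarrow> rational_fun f"
  by (auto simp: rational_fun_def)

lemma rational_fun_poly: "rational_fun (poly p)"
  by (rule rational_funI[of 1 _ p]) auto

lemma rational_fun_const: "rational_fun (\<lambda>_. c)"
  by (rule rational_funI[of 1 _ "[:c:]"]) auto

lemma rational_fun_cong:
  assumes "rational_fun f" "\<forall>\<^sub>\<approx>x. f x = g x"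
  shows "rational_fun g"
proof -
  obtain p q where q: "q \<noteq> 0" and "\<forall>\<^sub>\<approx>x. f x = poly p x / poly q x"
    using assms(1) by (auto simp: rational_fun_def)
  from this(2) assms(2) have "\<forall>\<^sub>\<approx>x. g x = poly p x / poly q x" by eventually_elim auto
  with q show ?thesis by (rule rational_funI)
qed

lemma rational_fun_add:
  assumes "rational_fun f" "rational_fun g"
  shows "rational_fun (\<lambda>x. f x + g x)"
proof -
  obtain p q p' q' where "q \<noteq> 0" "q' \<noteq> 0"
    and "\<forall>\<^sub>\<approx>x. f x = poly p x / poly q x" "\<forall>\<^sub>\<approx>x. g x = poly p' x / poly q' x"
    using assms by (auto simp: rational_fun_def)
  from this(3,4) poly_nonzero_cosparse[OF this(1)] poly_nonzero_cosparse[OF this(2)]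
  have "\<forall>\<^sub>\<approx>x. f x + g x = poly (p * q' + p' * q) x / poly (q * q') x"
    by eventually_elim (simp add: field_simps)
  thus ?thesis using \<open>q \<noteq> 0\<close> \<open>q' \<noteq> 0\<close> by (intro rational_funI[of "q * q'"]) (auto simp del: poly_mult poly_add)
qed

lemma rational_fun_mult:
  assumes "rational_fun f" "rational_fun g"
  shows "rational_fun (\<lambda>x. f x * g x)"
proof -
  obtain p q p' q' where "q \<noteq> 0" "q' \<noteq> 0"
    and "\<forall>\<^sub>\<approx>x. f x = poly p x / poly q x" "\<forall>\<^sub>\<approx>x. g x = poly p' x / poly q' x"
    using assms by (auto simp: rational_fun_def)
  from this(3,4) have "\<forall>\<^sub>\<approx>x. f x * g x = poly (p * p') x / poly (q * q') x"
    by eventually_elim simp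
  thus ?thesis using \<open>q \<noteq> 0\<close> \<open>q' \<noteq> 0\<close> by (intro rational_funI[of "q * q'"]) (auto simp del: poly_mult poly_add)
qed

lemma rational_fun_sum: "(\<And>i. i \<in> A \<Longrightarrow> rational_fun (f i)) \<Longrightarrow> rational_fun (\<lambda>x. \<Sum>i\<in>A. f i x)"
  by (induction A rule: infinite_finite_induct) (auto intro: rational_fun_add rational_fun_const)

lemma rational_fun_prod: "(\<And>i. i \<in> A \<Longrightarrow> rational_fun (f i)) \<Longrightarrow> rational_fun (\<lambda>x. \<Prod>i\<in>A. f i x)"
  by (induction A rule: infinite_finite_induct) (auto intro: rational_fun_mult rational_fun_const)

lemma rational_fun_diff:
  "rational_fun f \<Longrightarrow> rational_fun g \<Longrightarrow> rational_fun (\<lambda>x. f x - g x)"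
  using rational_fun_add[of f "\<lambda>x. - 1 * g x"] rational_fun_mult[of "\<lambda>_. - 1" g] rational_fun_const
  by simp

lemma rational_fun_inverse:
  assumes "rational_fun f"
  shows "rational_fun (\<lambda>x. inverse (f x))"
proof -
  obtain p q where q: "q \<noteq> 0" and f: "\<forall>\<^sub>\<approx>x. f x = poly p x / poly q x"
    using assms by (auto simp: rational_fun_def)
  show ?thesis
  proof (cases "p = 0")
    \<comment> \<open>The inverse of the zero function is zero by the convention
      \<open>inverse 0 = 0\<close>.\<close>
    case True
    from f have "\<forall>\<^sub>\<approx>x. inverse (f x) = poly 0 x / poly 1 x" by eventually_elim (simp add: True)
    thus ?thesis by (intro rational_funI[of 1 _ 0]) auto
  next
    case False
    from f have "\<forall>\<^sub>\<approx>x. inverse (f x) = poly q x / poly p x" by eventually_elim simp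
    with False show ?thesis by (rule rational_funI)
  qed
qed

lemma rational_fun_meromorphic: "rational_fun f \<Longrightarrow> f meromorphic_on UNIV"
proof -
  assume "rational_fun f"
  then obtain p q where *: "\<forall>\<^sub>\<approx>x. f x = poly p x / poly q x"
    by (auto simp: rational_fun_def)
  have "qe 0 r = poly r" for r by (auto simp: qe_def)
  hence "poly r meromorphic_on UNIV" for r :: "complex poly"
    using qe_meromorphic by metis
  hence "(\<lambda>x. poly p x / poly q x) meromorphic_on UNIV"
    by (intro meromorphic_intros)
  thus ?thesis using meromorphic_on_cong'[OF * refl] by simp
qed

lemma rational_fun_deriv:
  assumes "rational_fun f"
  shows "rational_fun (deriv f)"
proof -
  obtain p q where q: "q \<noteq> 0" and f: "\<forall>\<^sub>\<approx>x. f x = poly p x / poly q x"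
    using assms by (auto simp: rational_fun_def)
  have "\<forall>\<^sub>\<approx>x. deriv f x = deriv (\<lambda>x. poly p x / poly q x) x"
    using higher_deriv_cosparse_cong[OF f, of 1] by simp
  with poly_nonzero_cosparse[OF q]
  have "\<forall>\<^sub>\<approx>x. deriv f x = poly (pderiv p * q - p * pderiv q) x / poly (q * q) x"
  proof eventually_elim
    case (elim x)
    have "((\<lambda>x. poly p x / poly q x) has_field_derivative
        (poly (pderiv p) x * poly q x - poly p x * poly (pderiv q) x) / (poly q x * poly q x)) (at x)"
      using elim(1) by (auto intro!: derivative_eq_intros)
    thus ?case using elim(2) by (simp add: DERIV_imp_deriv)
  qed
  thus ?thesis using q by (intro rational_funI[of "q * q"]) (auto simp del: poly_mult poly_diff)
qed

text \<open>After clearing denominators, a rational operator maps exponential polynomials to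
  exponential polynomials, to which \<open>exp_poly_zero\<close> applies.\<close>

lemma rational_fun_common_denominator:
  assumes "finite I" "\<And>i. i \<in> I \<Longrightarrow> rational_fun (f i)"
  shows "\<exists>D a. D \<noteq> 0 \<and> (\<forall>i\<in>I. \<forall>\<^sub>\<approx>x. poly D x * f i x = poly (a i) x)"
  using assms
proof (induction I rule: finite_induct)
  case (insert i I)
  then obtain D a where D: "D \<noteq> 0" "\<And>j. j \<in> I \<Longrightarrow> \<forall>\<^sub>\<approx>x. poly D x * f j x = poly (a j) x"
    by auto
  obtain p q where q: "q \<noteq> 0" and f: "\<forall>\<^sub>\<approx>x. f i x = poly p x / poly q x"
    using insert.prems[of i] by (auto simp: rational_fun_def)
  have "\<forall>\<^sub>\<approx>x. poly (D * q) x * f j x = poly (if j = i then D * p else a j * q) x"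
    if "j \<in> insert i I" for j
  proof (cases "j = i")
    case True
    from f poly_nonzero_cosparse[OF q] show ?thesis
      by eventually_elim (simp add: True)
  next
    case False
    with that have "\<forall>\<^sub>\<approx>x. poly D x * f j x = poly (a j) x" using D by auto
    thus ?thesis by eventually_elim (simp add: False mult_ac)
  qed
  thus ?case using D q by (intro exI[of _ "D * q"] exI[of _ "\<lambda>j. if j = i then D * p else a j * q"]) auto
qed (intro exI[of _ 1], auto)

lemma okernel_cong:
  assumes "f \<in> okernel n k C" "merov n g" "\<And>s. s < n \<Longrightarrow> \<forall>\<^sub>\<approx>x. f s x = g s x"
  shows "g \<in> okernel n k C"
proof -
  have "\<forall>\<^sub>\<approx>x. \<forall>r. opr n k C f r x = opr n k C g r x"
    using assms(3) by (rule opr_cong_ev)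
  hence "nullf n (opr n k C g)"
    using assms(1) by (intro nullf_cong[of n "opr n k C f" "opr n k C g"])
      (auto simp: okernel_def elim: eventually_mono)
  thus ?thesis using assms(2) by (simp add: okernel_def)
qed

text \<open>Exponentials with distinct exponents are linearly independent over the rational functions,
  so the kernel of a rational operator contains the components of its exponential polynomials.\<close>

lemma okernel_exponential_components:
  assumes rat: "\<And>i r s. i \<le> k \<Longrightarrow> r < n \<Longrightarrow> s < n \<Longrightarrow> rational_fun (C i r s)"
    and "finite S" "\<beta> \<in> S" and ker: "(\<lambda>s x. \<Sum>\<beta>\<in>S. qe \<beta> (u \<beta> s) x) \<in> okernel n k C"
  shows "(\<lambda>s. qe \<beta> (u \<beta> s)) \<in> okernel n k C"
proof -
  have "\<exists>D a. D \<noteq> 0 \<and> (\<forall>i\<in>{..k} \<times> {..<n} \<times> {..<n}. \<forall>\<^sub>\<approx>x.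
      poly D x * (case i of (i, r, s) \<Rightarrow> C i r s) x = poly (a i) x)"
    using rat by (intro rational_fun_common_denominator) auto
  then obtain D a where "D \<noteq> 0" and a: "\<forall>i\<in>{..k} \<times> {..<n} \<times> {..<n}. \<forall>\<^sub>\<approx>x.
      poly D x * (case i of (i, r, s) \<Rightarrow> C i r s) x = poly (a i) x" by blast
  have D: "D \<noteq> 0"
    "\<And>i r s. i \<le> k \<Longrightarrow> r < n \<Longrightarrow> s < n \<Longrightarrow> \<forall>\<^sub>\<approx>x. poly D x * C i r s x = poly (a (i, r, s)) x"
    using \<open>D \<noteq> 0\<close> bspec[OF a, of "(_, _, _)"] by simp_all
  \<comment> \<open>The operator multiplied by \<open>D\<close> preserves each exponent \<beta>;
    \<open>\<tau> \<beta> r\<close> is the polynomial factor of component \<open>r\<close> of the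
    image. Exponents do not mix, so the equation splits into one equation for each \<beta>.\<close>
  define \<tau> where "\<tau> \<beta> r = (\<Sum>i\<le>k. \<Sum>s<n. a (i, r, s) * (dexp \<beta> ^^ i) (u \<beta> s))" for \<beta> r
  have "\<forall>\<^sub>\<approx>x. \<forall>i\<le>k. \<forall>r<n. \<forall>s<n. poly D x * C i r s x = poly (a (i, r, s)) x"
    using D(2) by (intro eventually_cosparse_all_le eventually_cosparse_all_less allI impI)
  hence \<tau>: "\<forall>\<^sub>\<approx>x. \<forall>r<n. \<forall>\<beta>. poly D x * opr n k C (\<lambda>s. qe \<beta> (u \<beta> s)) r x = qe \<beta> (\<tau> \<beta> r) x"
  proof eventually_elim
    case (elim x)
    show ?case
    proof (intro allI impI)
      fix r \<beta> assume r: "r < n"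
      have "poly D x * opr n k C (\<lambda>s. qe \<beta> (u \<beta> s)) r x =
          (\<Sum>i\<le>k. \<Sum>s<n. (poly D x * C i r s x) * qe \<beta> ((dexp \<beta> ^^ i) (u \<beta> s)) x)"
        by (simp add: opr_def higher_deriv_qe sum_distrib_left mult.assoc)
      also have "\<dots> = (\<Sum>i\<le>k. \<Sum>s<n. poly (a (i, r, s)) x * qe \<beta> ((dexp \<beta> ^^ i) (u \<beta> s)) x)"
        using elim r by (intro sum.cong refl) auto
      also have "\<dots> = qe \<beta> (\<tau> \<beta> r) x"
        by (simp add: qe_def \<tau>_def poly_sum sum_distrib_left mult_ac)
      finally show "poly D x * opr n k C (\<lambda>s. qe \<beta> (u \<beta> s)) r x = qe \<beta> (\<tau> \<beta> r) x" .
    qed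
  qed
  have opr_sum: "opr n k C (\<lambda>s x. \<Sum>\<beta>\<in>S. qe \<beta> (u \<beta> s) x) r x =
      (\<Sum>\<beta>\<in>S. opr n k C (\<lambda>s. qe \<beta> (u \<beta> s)) r x)" for r x
  proof -
    have "opr n k C (\<lambda>s x. \<Sum>\<beta>\<in>S. qe \<beta> (u \<beta> s) x) r x =
        (\<Sum>i\<le>k. \<Sum>s<n. \<Sum>\<beta>\<in>S. C i r s x * (deriv ^^ i) (qe \<beta> (u \<beta> s)) x)"
      unfolding opr_def using \<open>finite S\<close>
      by (intro sum.cong refl) (subst higher_deriv_sum_at, auto simp: sum_distrib_left intro!: qe_analytic)
    thus ?thesis
      by (simp add: opr_def sum.swap[of _ "{..<n}" S] sum.swap[of _ "{..k}" S])
  qed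
  have \<tau>0: "\<tau> \<beta> r = 0" if r: "r < n" for r
  proof (rule exp_poly_zero[OF \<open>finite S\<close> _ \<open>\<beta> \<in> S\<close>])
    fix x
    show "(\<Sum>\<beta>\<in>S. qe \<beta> (\<tau> \<beta> r) x) = 0"
    proof (rule analytic_cosparse_zero[where f = "\<lambda>x. \<Sum>\<beta>\<in>S. qe \<beta> (\<tau> \<beta> r) x"])
      show "(\<lambda>x. \<Sum>\<beta>\<in>S. qe \<beta> (\<tau> \<beta> r) x) analytic_on UNIV" by (intro analytic_intros)
      have "\<forall>\<^sub>\<approx>x. opr n k C (\<lambda>s x. \<Sum>\<beta>\<in>S. qe \<beta> (u \<beta> s) x) r x = 0"
        using ker r by (auto simp: okernel_def nullf_def)
      with \<tau> show "\<forall>\<^sub>\<approx>x. (\<Sum>\<beta>\<in>S. qe \<beta> (\<tau> \<beta> r) x) = 0"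
      proof eventually_elim
        case (elim x)
        hence "(\<Sum>\<beta>\<in>S. qe \<beta> (\<tau> \<beta> r) x) = (\<Sum>\<beta>\<in>S. poly D x * opr n k C (\<lambda>s. qe \<beta> (u \<beta> s)) r x)"
          using r by (intro sum.cong) auto
        also have "\<dots> = poly D x * opr n k C (\<lambda>s x. \<Sum>\<beta>\<in>S. qe \<beta> (u \<beta> s) x) r x"
          by (simp only: sum_distrib_left opr_sum)
        finally show ?case using elim by simp
      qed
    qed
  qed
  from \<tau> poly_nonzero_cosparse[OF D(1)]
  have "\<forall>\<^sub>\<approx>x. \<forall>r<n. opr n k C (\<lambda>s. qe \<beta> (u \<beta> s)) r x = 0"
  proof eventually_elim
    case (elim x)
    show ?case
    proof (intro allI impI)
      fix r assume r: "r < n"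
      hence "poly D x * opr n k C (\<lambda>s. qe \<beta> (u \<beta> s)) r x = qe \<beta> (\<tau> \<beta> r) x"
        using elim(1) by blast
      thus "opr n k C (\<lambda>s. qe \<beta> (u \<beta> s)) r x = 0"
        using elim(2) \<tau>0[OF r] by (simp add: qe_def)
    qed
  qed
  thus ?thesis
    by (auto simp: okernel_def merov_def nullf_def intro: qe_meromorphic elim!: eventually_mono)
qed

section \<open>The kernel of a right factor\<close>

text \<open>\<open>V\<close> may be any set of functions with a uniform bound on its independent
  families. It is applied to solutions with a single exponent, which do not form a subspace.\<close>

lemma maximal_indep:
  assumes "\<And>N F. (\<And>j. j < N \<Longrightarrow> F j \<in> V) \<Longrightarrow> indep n N F \<Longrightarrow> N \<le> B"
  obtains N F where "\<And>j. j < N \<Longrightarrow> F j \<in> V" "indep n N F" "\<And>v. v \<in> V \<Longrightarrow> inspan n N F v"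
proof -
  define P where "P N \<longleftrightarrow> (\<exists>F. (\<forall>j<N. F j \<in> V) \<and> indep n N F)" for N
  have "P 0" by (auto simp: P_def indep_def)
  moreover have bound: "\<And>N. P N \<Longrightarrow> N \<le> B" using assms by (auto simp: P_def)
  ultimately obtain N0 where "P N0" and max: "\<And>N. P N \<Longrightarrow> N \<le> N0"
    using GreatestI_nat Greatest_le_nat by metis
  then obtain F where F: "\<forall>j<N0. F j \<in> V" "indep n N0 F" by (auto simp: P_def)
  show ?thesis
  proof (rule that[of N0 F])
    fix v assume v: "v \<in> V"
    show "inspan n N0 F v"
    proof (rule not_indep_Suc_imp_inspan[OF F(2)], rule notI)
      assume "indep n (Suc N0) (F(N0 := v))"
      hence "P (Suc N0)"
        unfolding P_def using F(1) v by (intro exI[of _ "F(N0 := v)"]) auto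
      from max[OF this] show False by simp
    qed
  qed (use F in auto)
qed

lemma indep_coeff_unique:
  assumes "indep n N F" "\<And>s. s < n \<Longrightarrow> \<forall>\<^sub>\<approx>x. lcomb N c F s x = lcomb N c' F s x" "j < N"
  shows "c j = c' j"
proof -
  have "nullf n (lcomb N (\<lambda>j. c j - c' j) F)"
    unfolding nullf_def
  proof (intro allI impI)
    fix s assume "s < n"
    from assms(2)[OF this] show "\<forall>\<^sub>\<approx>x. lcomb N (\<lambda>j. c j - c' j) F s x = 0"
      by eventually_elim (simp add: lcomb_def left_diff_distrib sum_subtractf)
  qed
  thus ?thesis using assms(1,3) by (auto simp: indep_def)
qed

lemma inspan_sum:
  assumes "finite S" "\<And>\<beta>. \<beta> \<in> S \<Longrightarrow> inspan n N F (g \<beta>)"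
  shows "inspan n N F (\<lambda>s x. \<Sum>\<beta>\<in>S. g \<beta> s x)"
proof -
  have "\<forall>\<beta>\<in>S. \<exists>c. \<forall>s<n. \<forall>\<^sub>\<approx>x. g \<beta> s x = lcomb N c F s x"
    using assms(2) by (simp add: inspan_def)
  from bchoice[OF this] obtain c where
    c: "\<forall>\<beta>\<in>S. \<forall>s<n. \<forall>\<^sub>\<approx>x. g \<beta> s x = lcomb N (c \<beta>) F s x" ..
  have "\<forall>\<^sub>\<approx>x. (\<Sum>\<beta>\<in>S. g \<beta> s x) = lcomb N (\<lambda>j. \<Sum>\<beta>\<in>S. c \<beta> j) F s x" if "s < n" for s
  proof -
    have "\<forall>\<^sub>\<approx>x. \<forall>\<beta>\<in>S. g \<beta> s x = lcomb N (c \<beta>) F s x"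
      using c that assms(1) by (intro eventually_ball_finite) auto
    thus ?thesis
    proof eventually_elim
      case (elim x)
      hence "(\<Sum>\<beta>\<in>S. g \<beta> s x) = (\<Sum>\<beta>\<in>S. \<Sum>j<N. c \<beta> j * F j s x)"
        by (intro sum.cong) (auto simp: lcomb_def)
      also have "\<dots> = (\<Sum>j<N. \<Sum>\<beta>\<in>S. c \<beta> j * F j s x)" by (rule sum.swap)
      finally show ?case by (simp add: lcomb_def sum_distrib_right)
    qed
  qed
  thus ?thesis unfolding inspan_def by blast
qed

lemma inspan_cong:
  assumes "inspan n N F f" "\<And>s. s < n \<Longrightarrow> \<forall>\<^sub>\<approx>x. f s x = g s x"
  shows "inspan n N F g"
proof -
  obtain c where c: "\<And>s. s < n \<Longrightarrow> \<forall>\<^sub>\<approx>x. f s x = lcomb N c F s x"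
    using assms(1) by (auto simp: inspan_def)
  have "\<forall>\<^sub>\<approx>x. g s x = lcomb N c F s x" if "s < n" for s
    using c[OF that] assms(2)[OF that] by eventually_elim auto
  thus ?thesis by (auto simp: inspan_def)
qed

lemma opr_zero [simp]: "opr n k C (\<lambda>s x. 0) r x = 0"
proof -
  have "(deriv ^^ i) (\<lambda>x. 0) = (\<lambda>x. 0 :: complex)" for i
    by (induction i) auto
  thus ?thesis by (simp add: opr_def)
qed

lemma opr_nullf:
  assumes "nullf n f"
  shows "nullf n (opr n k C f)"
proof -
  have "\<forall>\<^sub>\<approx>x. \<forall>r. opr n k C f r x = opr n k C (\<lambda>s x. 0) r x"
    using assms by (intro opr_cong_ev) (auto simp: nullf_def)
  thus ?thesis by (auto simp: nullf_def elim: eventually_mono)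
qed

text \<open>The lower bound for the dimension of the kernel of \<open>P\<close> is a count of linear conditions.
  If \<open>M L = d(\<partial>) I\<close>, the space \<open>E\<close> of solutions of \<open>d(\<partial>) f = 0\<close> has dimension \<open>n\<close> times the
  order of \<open>M Q P\<close>. A solution \<open>f \<in> E\<close> satisfies \<open>P f = 0\<close> as soon as the jets of \<open>Q P f\<close> and of
  \<open>P f\<close>, of lengths given by the orders of \<open>M\<close> and \<open>Q\<close>, vanish at a generic point. Were the
  exponential polynomials \<open>b\<^sub>i\<close> spanning the kernel of \<open>P\<close> too few, one could moreover choose
  \<open>f \<noteq> 0\<close> with coordinates orthogonal to those of all \<open>b\<^sub>i\<close>, although \<open>f\<close> is in their span.\<close>

lemma right_factor_kernel_basis:
  assumes "n > 0" "nonsing n (L l)"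
    and Q: "meroc n q Q" "\<forall>\<^sub>\<approx>x. regular_at n q Q x"
    and P: "\<And>i r s. i \<le> p \<Longrightarrow> r < n \<Longrightarrow> s < n \<Longrightarrow> rational_fun (P i r s)" "\<forall>\<^sub>\<approx>x. regular_at n p P x"
    and factor: "\<And>f r. merov n f \<Longrightarrow> r < n \<Longrightarrow> \<forall>\<^sub>\<approx>x. opr n l (constc L) f r x = opr n q Q (opr n p P f) r x"
  obtains \<alpha> :: "nat \<Rightarrow> complex" and w :: "nat \<Rightarrow> nat \<Rightarrow> complex poly" where
    "\<And>j. j < n * p \<Longrightarrow> (\<lambda>s. qe (\<alpha> j) (w j s)) \<in> okernel n p P"
    "indep n (n * p) (\<lambda>j s. qe (\<alpha> j) (w j s))"
proof -
  obtain d m M where d: "d \<noteq> 0" "degree d = m + l" "nonsing n (M m)"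
    and annih: "\<And>f x r. r < n \<Longrightarrow> (\<forall>s<n. f s analytic_on {x}) \<Longrightarrow>
      opr n m (constc M) (opr n l (constc L) f) r x = opr n (degree d) (dconst d) f r x"
    using const_opr_annihilator[where L = L and l = l, OF assms(2,1)] by blast
  define N where "N = degree d"
  obtain \<alpha> w where E_ker: "\<And>j. j < n * N \<Longrightarrow> (\<lambda>s. qe (\<alpha> j) (w j s)) \<in> okernel n N (dconst d)"
    and E_indep: "indep n (n * N) (\<lambda>j s. qe (\<alpha> j) (w j s))"
    using dconst_kernel_basis[OF d(1), of n] unfolding N_def by blast
  define E where "E j s = qe (\<alpha> j) (w j s)" for j s
  have E_ker: "E j \<in> okernel n N (dconst d)" if "j < n * N" for j
    using E_ker[OF that] by (simp add: E_def[abs_def])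
  have E_indep: "indep n (n * N) E" using E_indep by (simp add: E_def[abs_def])
  have Pm: "meroc n p P" using P(1) by (auto simp: meroc_def intro: rational_fun_meromorphic)
  have E_mero: "merov n (E j)" for j by (auto simp: merov_def E_def intro: qe_meromorphic)
  have Mm: "meroc n m (constc M)" "meroc n l (constc L)" by (auto simp: meroc_def)
  have MQP: "\<forall>\<^sub>\<approx>x. \<forall>r<n. opr n m (constc M) (opr n q Q (opr n p P f)) r x = opr n N (dconst d) f r x"
    if f: "merov n f" for f
  proof -
    have "\<forall>\<^sub>\<approx>x. \<forall>r. opr n m (constc M) (opr n l (constc L) f) r x =
        opr n m (constc M) (opr n q Q (opr n p P f)) r x"
      using factor[OF f] by (intro opr_cong_ev)
    with merov_analytic[OF f] show ?thesis
      by eventually_elim (auto simp: N_def annih[symmetric])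
  qed
  have ker_subset: "f \<in> okernel n N (dconst d)" if "f \<in> okernel n p P" for f
  proof -
    have f: "merov n f" "nullf n (opr n p P f)" using that by (auto simp: okernel_def)
    have "nullf n (opr n m (constc M) (opr n q Q (opr n p P f)))"
      using f(2) by (rule opr_nullf[OF opr_nullf])
    hence "nullf n (opr n N (dconst d) f)"
      by (rule nullf_cong) (use MQP[OF f(1)] in \<open>auto elim: eventually_mono\<close>)
    thus ?thesis using f(1) by (simp add: okernel_def)
  qed
  have E_span: "inspan n (n * N) E f" if "f \<in> okernel n p P" for f
    using regular_dconst[OF d(1)] E_ker E_indep ker_subset[OF that]
    unfolding N_def by (intro okernel_inspan[of n "degree d" "dconst d"]) auto
  \<comment> \<open>A maximal independent family is taken among single-exponent solutions, so that
    it has the required shape by construction; it spans the full kernel because each solution is the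
    sum of its exponential components, which again lie in \<open>V\<close>.\<close>
  define V where "V = {f \<in> okernel n p P. \<exists>\<beta> u. f = (\<lambda>s. qe \<beta> (u s))}"
  have V_bound: "K \<le> n * p" if "\<And>j. j < K \<Longrightarrow> F j \<in> V" "indep n K F" for K F
    using P(2) that by (intro indep_le[of n p P K F]) (auto simp: V_def)
  then obtain S b where b: "\<And>j. j < S \<Longrightarrow> b j \<in> V" "indep n S b" "\<And>v. v \<in> V \<Longrightarrow> inspan n S b v"
    using maximal_indep[of V n "n * p"] by blast
  have b_span: "inspan n S b f" if f: "f \<in> okernel n p P" for f
  proof -
    obtain c where c: "\<And>s. s < n \<Longrightarrow> \<forall>\<^sub>\<approx>x. f s x = lcomb (n * N) c E s x"
      using E_span[OF f] by (auto simp: inspan_def)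
    define u where "u \<beta> s = (\<Sum>j | j < n * N \<and> \<alpha> j = \<beta>. smult (c j) (w j s))" for \<beta> s
    have eq: "lcomb (n * N) c E = (\<lambda>s x. \<Sum>\<beta>\<in>\<alpha> ` {..<n * N}. qe \<beta> (u \<beta> s) x)"
      by (simp add: fun_eq_iff lcomb_def E_def sum_qe_group u_def)
    have "lcomb (n * N) c E \<in> okernel n p P"
      using f by (rule okernel_cong) (auto intro: merov_lcomb E_mero c)
    hence "(\<lambda>s. qe \<beta> (u \<beta> s)) \<in> okernel n p P" if "\<beta> \<in> \<alpha> ` {..<n * N}" for \<beta>
      unfolding eq using that P(1) by (intro okernel_exponential_components[of p n P "\<alpha> ` {..<n * N}"]) auto
    hence "inspan n S b (\<lambda>s. qe \<beta> (u \<beta> s))" if "\<beta> \<in> \<alpha> ` {..<n * N}" for \<beta>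
      using that by (intro b(3)) (auto simp: V_def)
    hence "inspan n S b (lcomb (n * N) c E)"
      unfolding eq by (intro inspan_sum) auto
    thus ?thesis
      by (rule inspan_cong) (use c in \<open>simp add: eq_commute\<close>)
  qed
  have "S \<ge> n * p"
  proof (rule ccontr)
    assume "\<not> n * p \<le> S"
    have "\<forall>i<S. \<exists>B. \<forall>s<n. \<forall>\<^sub>\<approx>x. b i s x = lcomb (n * N) B E s x"
      using E_span b(1) by (auto simp: V_def inspan_def)
    hence "\<forall>i\<in>{..<S}. \<exists>B. \<forall>s<n. \<forall>\<^sub>\<approx>x. b i s x = lcomb (n * N) B E s x"
      by simp
    from bchoice[OF this] obtain B where
      B: "\<And>i s. i < S \<Longrightarrow> s < n \<Longrightarrow> \<forall>\<^sub>\<approx>x. b i s x = lcomb (n * N) (B i) E s x" by auto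
    define G where "G j = opr n p P (E j)" for j
    define H where "H j = opr n q Q (G j)" for j
    have G: "merov n (G j)" for j unfolding G_def by (intro merov_opr Pm E_mero)
    have H: "merov n (H j)" for j unfolding H_def by (intro merov_opr Q(1) G)
    have H_ker: "H j \<in> okernel n m (constc M)" if "j < n * N" for j
    proof -
      have "nullf n (opr n N (dconst d) (E j))" using E_ker[OF that] by (simp add: okernel_def)
      hence "nullf n (opr n m (constc M) (H j))"
        by (rule nullf_cong) (use MQP[OF E_mero[of j]] in \<open>auto simp: H_def G_def elim!: eventually_mono\<close>)
      thus ?thesis using H by (simp add: okernel_def)
    qed
    have M_reg: "\<forall>\<^sub>\<approx>x. regular_at n m (constc M) x"
      using regular_constc[where L = M and l = m, OF d(3)] by simp
    have "\<forall>\<^sub>\<approx>x. \<forall>c. (\<forall>i<m. \<forall>s<n. (\<Sum>j<n * N. (deriv ^^ i) (H j s) x * c j) = 0) \<longrightarrow>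
        nullf n (lcomb (n * N) c H)"
      using M_reg H_ker by (rule okernel_generic_jets)
    moreover have "\<forall>\<^sub>\<approx>x. \<forall>j<n * N. \<forall>s<n. G j s analytic_on {x}"
      using G by (intro eventually_cosparse_all_less allI impI merov_analytic)
    ultimately have "\<forall>\<^sub>\<approx>x. (\<forall>c. (\<forall>i<m. \<forall>s<n. (\<Sum>j<n * N. (deriv ^^ i) (H j s) x * c j) = 0) \<longrightarrow>
        nullf n (lcomb (n * N) c H)) \<and> regular_at n q Q x \<and> (\<forall>j<n * N. \<forall>s<n. G j s analytic_on {x})"
      using Q(2) by eventually_elim blast
    from cosparse_frequently[OF this] obtain x where
      x: "\<And>c. \<forall>i<m. \<forall>s<n. (\<Sum>j<n * N. (deriv ^^ i) (H j s) x * c j) = 0 \<Longrightarrow> nullf n (lcomb (n * N) c H)"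
        "regular_at n q Q x" "\<And>j s. j < n * N \<Longrightarrow> s < n \<Longrightarrow> G j s analytic_on {x}"
      by blast
    \<comment> \<open>Three blocks of equations for \<open>c\<close>: \<open>n * m\<close> jet
      entries of the images under \<open>Q P\<close>, \<open>n * q\<close> jet entries of the images
      under \<open>P\<close>, and orthogonality to the \<open>S\<close> coordinate vectors
      \<open>B i\<close>. The conjugation makes this pairing definite.\<close>
    define A where "A i j = (if i < n * m then (deriv ^^ (i div n)) (H j (i mod n)) x
      else if i < n * m + n * q then (deriv ^^ ((i - n * m) div n)) (G j ((i - n * m) mod n)) x
      else cnj (B (i - n * m - n * q) j))" for i j
    \<comment> \<open>The number of equations is below \<open>n * (m + q + p)\<close>, which is at
      most \<open>n * N\<close> because \<open>N = m + l\<close>; a nontrivial \<open>c\<close>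
      therefore exists.\<close>
    have "p + q \<le> l" by (rule order_factors_le[OF Q(2) P(2) assms(1) factor])
    hence "n * (m + p + q) \<le> n * N" unfolding N_def d(2) by (intro mult_le_mono) auto
    hence less: "n * m + n * q + S < n * N" using \<open>\<not> n * p \<le> S\<close> by (simp add: algebra_simps)
    obtain c where c: "\<exists>j<n * N. c j \<noteq> 0"
      "\<And>i. i < n * m + n * q + S \<Longrightarrow> (\<Sum>j<n * N. A i j * c j) = 0"
      using underdetermined_system[OF less, of A] by blast
    have cH: "(\<Sum>j<n * N. (deriv ^^ (t div n)) (H j (t mod n)) x * c j) = 0" if "t < n * m" for t
      using c(2)[of t] that by (simp add: A_def)
    have cG: "(\<Sum>j<n * N. (deriv ^^ (t div n)) (G j (t mod n)) x * c j) = 0" if "t < n * q" for t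
      using c(2)[of "n * m + t"] that by (simp add: A_def)
    have cB: "(\<Sum>j<n * N. cnj (B i j) * c j) = 0" if "i < S" for i
      using c(2)[of "n * m + n * q + i"] that by (simp add: A_def)
    have "nullf n (lcomb (n * N) c H)"
      using index_pair_cases[of n m "\<lambda>i s. (\<Sum>j<n * N. (deriv ^^ i) (H j s) x * c j) = 0", OF cH]
      by (intro x(1)) blast
    moreover have "\<forall>\<^sub>\<approx>x. \<forall>c r. opr n q Q (lcomb (n * N) c G) r x = (\<Sum>j<n * N. c j * opr n q Q (G j) r x)"
      by (intro opr_lcomb G)
    ultimately have "nullf n (opr n q Q (lcomb (n * N) c G))"
      by (elim nullf_cong) (auto simp: lcomb_def H_def elim: eventually_mono)
    hence "lcomb (n * N) c G \<in> okernel n q Q"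
      using merov_lcomb[of "n * N" n G c] G by (auto simp: okernel_def)
    hence "nullf n (lcomb (n * N) c G)"
    proof (rule okernel_unique[OF x(2)])
      show "\<forall>s<n. lcomb (n * N) c G s analytic_on {x}"
        unfolding lcomb_def[abs_def] using x(3) by (auto intro!: analytic_intros)
      fix i s assume "i < q" "s < n"
      hence "(\<Sum>j<n * N. (deriv ^^ i) (G j s) x * c j) = 0"
        using index_pair_cases[of n q "\<lambda>i s. (\<Sum>j<n * N. (deriv ^^ i) (G j s) x * c j) = 0", OF cG] by blast
      thus "(deriv ^^ i) (lcomb (n * N) c G s) x = 0"
        using x(3) \<open>s < n\<close> by (subst higher_deriv_lcomb_at) (auto simp: mult.commute)
    qed
    moreover have "\<forall>\<^sub>\<approx>x. \<forall>c r. opr n p P (lcomb (n * N) c E) r x = (\<Sum>j<n * N. c j * opr n p P (E j) r x)"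
      by (intro opr_lcomb E_mero)
    ultimately have "nullf n (opr n p P (lcomb (n * N) c E))"
      by (elim nullf_cong) (auto simp: lcomb_def G_def elim: eventually_mono)
    hence "lcomb (n * N) c E \<in> okernel n p P"
      using merov_lcomb[of "n * N" n E c] E_mero by (auto simp: okernel_def)
    from b_span[OF this] obtain t where
      t: "\<And>s. s < n \<Longrightarrow> \<forall>\<^sub>\<approx>x. lcomb (n * N) c E s x = lcomb S t b s x"
      by (auto simp: inspan_def)
    have c_eq: "c j = (\<Sum>i<S. t i * B i j)" if "j < n * N" for j
    proof (rule indep_coeff_unique[OF E_indep _ that])
      fix s assume s: "s < n"
      have "\<forall>\<^sub>\<approx>x. \<forall>i<S. b i s x = lcomb (n * N) (B i) E s x"
        using B s by (intro eventually_cosparse_all_less) auto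
      with t[OF s] show "\<forall>\<^sub>\<approx>x. lcomb (n * N) c E s x = lcomb (n * N) (\<lambda>j. \<Sum>i<S. t i * B i j) E s x"
      proof eventually_elim
        case (elim x)
        hence "lcomb (n * N) c E s x = (\<Sum>i<S. \<Sum>j<n * N. t i * B i j * E j s x)"
          by (simp add: lcomb_def sum_distrib_left mult.assoc)
        also have "\<dots> = (\<Sum>j<n * N. \<Sum>i<S. t i * B i j * E j s x)" by (rule sum.swap)
        finally show ?case by (simp add: lcomb_def sum_distrib_right)
      qed
    qed
    \<comment> \<open>The vector \<open>c\<close> is a combination of the \<open>B i\<close> and
      orthogonal to each of them, so its Hermitian norm is zero.\<close>
    have "(\<Sum>j<n * N. cnj (c j) * c j) = (\<Sum>j<n * N. \<Sum>i<S. cnj (t i) * (cnj (B i j) * c j))"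
    proof (rule sum.cong[OF refl])
      fix j assume "j \<in> {..<n * N}"
      hence "cnj (c j) = (\<Sum>i<S. cnj (t i) * cnj (B i j))" using c_eq[of j] by simp
      thus "cnj (c j) * c j = (\<Sum>i<S. cnj (t i) * (cnj (B i j) * c j))"
        by (simp add: sum_distrib_right mult.assoc)
    qed
    also have "\<dots> = (\<Sum>i<S. \<Sum>j<n * N. cnj (t i) * (cnj (B i j) * c j))" by (rule sum.swap)
    also have "\<dots> = 0" using cB by (simp flip: sum_distrib_left)
    finally have "(\<Sum>j<n * N. of_real ((cmod (c j))\<^sup>2)) = (0 :: complex)"
      unfolding complex_norm_square by (simp add: mult.commute)
    hence "(\<Sum>j<n * N. (cmod (c j))\<^sup>2) = 0"
      by (simp only: of_real_sum[symmetric] of_real_eq_0_iff)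
    hence "\<forall>j<n * N. c j = 0"
      by (subst (asm) sum_nonneg_eq_0_iff) auto
    with c(1) show False by blast
  qed
  with V_bound[of S b] b(1,2) have S: "S = n * p" by simp
  have "\<forall>j\<in>{..<S}. \<exists>\<theta>. b j = (\<lambda>s. qe (fst \<theta>) (snd \<theta> s))"
    using b(1) by (force simp: V_def)
  from bchoice[OF this] obtain \<theta> where
    eq: "\<And>j. j < S \<Longrightarrow> b j = (\<lambda>s. qe (fst (\<theta> j)) (snd (\<theta> j) s))" by auto
  show ?thesis
  proof (rule that[of "\<lambda>j. fst (\<theta> j)" "\<lambda>j. snd (\<theta> j)"])
    show "(\<lambda>s. qe (fst (\<theta> j)) (snd (\<theta> j) s)) \<in> okernel n p P" if "j < n * p" for j
      using b(1)[of j] eq[of j] that S by (simp add: V_def)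
    have "lcomb (n * p) c (\<lambda>j s. qe (fst (\<theta> j)) (snd (\<theta> j) s)) = lcomb (n * p) c b" for c
      using eq S by (auto simp: lcomb_def fun_eq_iff intro!: sum.cong)
    thus "indep n (n * p) (\<lambda>j s. qe (fst (\<theta> j)) (snd (\<theta> j) s))"
      using b(2) S by (simp add: indep_def)
  qed
qed

section \<open>Division of differential operators\<close>

text \<open>Leibniz rule: these are the coefficients of \<partial> composed with an operator of
  order \<open>k\<close>. The guard at \<open>i = k + 1\<close> is essential, since coefficients
  beyond the order are arbitrary.\<close>

definition dcoeff :: "nat \<Rightarrow> (nat \<Rightarrow> nat \<Rightarrow> nat \<Rightarrow> complex \<Rightarrow> complex) \<Rightarrow> nat \<Rightarrow> nat \<Rightarrow> nat \<Rightarrow> complex \<Rightarrow> complex" where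
  "dcoeff k C i r s x = (if i \<le> k then deriv (C i r s) x else 0) + (case i of 0 \<Rightarrow> 0 | Suc j \<Rightarrow> C j r s x)"

lemma dcoeff_top: "dcoeff k C (Suc k) r s x = C k r s x"
  by (simp add: dcoeff_def)

lemma deriv_opr:
  assumes "meroc n k C" "merov n f" "r < n"
  shows "\<forall>\<^sub>\<approx>x. deriv (opr n k C f r) x = opr n (Suc k) (dcoeff k C) f r x"
  using meroc_analytic[OF assms(1)] merov_analytic[OF assms(2)]
proof eventually_elim
  case (elim x)
  have C: "(C i r s has_field_derivative deriv (C i r s) x) (at x)" if "i \<le> k" "s < n" for i s
    unfolding DERIV_deriv_iff_field_differentiable using elim that assms(3)
    by (intro analytic_on_imp_differentiable_at[of _ "{x}"]) auto
  have f: "((deriv ^^ i) (f s) has_field_derivative (deriv ^^ Suc i) (f s) x) (at x)" if "s < n" for i s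
    unfolding funpow.simps o_apply DERIV_deriv_iff_field_differentiable using elim that
    by (intro analytic_on_imp_differentiable_at[of _ "{x}"] analytic_higher_deriv) auto
  have "(opr n k C f r has_field_derivative
      (\<Sum>i\<le>k. \<Sum>s<n. deriv (C i r s) x * (deriv ^^ i) (f s) x + C i r s x * (deriv ^^ Suc i) (f s) x)) (at x)"
    unfolding opr_def[abs_def]
  proof (intro DERIV_sum)
    fix i s assume "i \<in> {..k}" "s \<in> {..<n}"
    thus "((\<lambda>x. C i r s x * (deriv ^^ i) (f s) x) has_field_derivative
        deriv (C i r s) x * (deriv ^^ i) (f s) x + C i r s x * (deriv ^^ Suc i) (f s) x) (at x)"
      using DERIV_mult[OF C[of i s] f[of s i]] by (simp add: add.commute mult.commute)
  qed
  hence "deriv (opr n k C f r) x =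
      (\<Sum>i\<le>k. \<Sum>s<n. deriv (C i r s) x * (deriv ^^ i) (f s) x + C i r s x * (deriv ^^ Suc i) (f s) x)"
    by (rule DERIV_imp_deriv)
  also have "\<dots> = (\<Sum>i\<le>k. \<Sum>s<n. deriv (C i r s) x * (deriv ^^ i) (f s) x) +
      (\<Sum>i\<le>k. \<Sum>s<n. C i r s x * (deriv ^^ Suc i) (f s) x)"
    by (simp only: sum.distrib)
  also have "(\<Sum>i\<le>k. \<Sum>s<n. deriv (C i r s) x * (deriv ^^ i) (f s) x) =
      (\<Sum>i\<le>Suc k. \<Sum>s<n. (if i \<le> k then deriv (C i r s) x else 0) * (deriv ^^ i) (f s) x)"
    by simp
  also have "(\<Sum>i\<le>k. \<Sum>s<n. C i r s x * (deriv ^^ Suc i) (f s) x) =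
      (\<Sum>i\<le>Suc k. \<Sum>s<n. (case i of 0 \<Rightarrow> 0 | Suc j \<Rightarrow> C j r s x) * (deriv ^^ i) (f s) x)"
    by (subst sum.atMost_Suc_shift) simp
  finally show ?case
    by (simp only: opr_def[of n "Suc k"] dcoeff_def distrib_right sum.distrib)
qed

text \<open>Coefficients of the \<open>j\<close>-th power of \<partial> composed with the operator,
  of order \<open>k + j\<close>. The leading coefficient stays \<open>C k\<close>, which is what the
  division cancels against.\<close>

primrec ncoeff :: "nat \<Rightarrow> (nat \<Rightarrow> nat \<Rightarrow> nat \<Rightarrow> complex \<Rightarrow> complex) \<Rightarrow> nat \<Rightarrow>
    nat \<Rightarrow> nat \<Rightarrow> nat \<Rightarrow> complex \<Rightarrow> complex" where
  "ncoeff k C 0 = C"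
| "ncoeff k C (Suc j) = dcoeff (k + j) (ncoeff k C j)"

lemma ncoeff_top: "ncoeff k C j (k + j) r s x = C k r s x"
  by (induction j) (auto simp: dcoeff_top)

definition ratc :: "nat \<Rightarrow> nat \<Rightarrow> (nat \<Rightarrow> nat \<Rightarrow> nat \<Rightarrow> complex \<Rightarrow> complex) \<Rightarrow> bool" where
  "ratc n k C \<longleftrightarrow> (\<forall>i\<le>k. \<forall>r<n. \<forall>s<n. rational_fun (C i r s))"

lemma ratc_meroc: "ratc n k C \<Longrightarrow> meroc n k C"
  by (auto simp: ratc_def meroc_def intro: rational_fun_meromorphic)

lemma ratc_dcoeff:
  assumes "ratc n k C"
  shows "ratc n (Suc k) (dcoeff k C)"
  unfolding ratc_def
proof (intro allI impI)
  fix i r s assume *: "i \<le> Suc k" "r < n" "s < n"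
  have "rational_fun (\<lambda>x. if i \<le> k then deriv (C i r s) x else 0)"
    using assms * by (cases "i \<le> k") (auto simp: ratc_def intro: rational_fun_deriv rational_fun_const)
  moreover have "rational_fun (\<lambda>x. case i of 0 \<Rightarrow> 0 | Suc j \<Rightarrow> C j r s x)"
    using assms * by (cases i) (auto simp: ratc_def intro: rational_fun_const)
  ultimately show "rational_fun (dcoeff k C i r s)"
    unfolding dcoeff_def[abs_def] by (rule rational_fun_add)
qed

lemma ratc_ncoeff: "ratc n k C \<Longrightarrow> ratc n (k + j) (ncoeff k C j)"
  by (induction j) (auto intro: ratc_dcoeff)

lemma higher_deriv_opr:
  assumes "ratc n k C" "merov n f" "r < n"
  shows "\<forall>\<^sub>\<approx>x. (deriv ^^ j) (opr n k C f r) x = opr n (k + j) (ncoeff k C j) f r x"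
proof (induction j)
  case (Suc j)
  have "\<forall>\<^sub>\<approx>x. (deriv ^^ Suc j) (opr n k C f r) x = deriv (opr n (k + j) (ncoeff k C j) f r) x"
    using higher_deriv_cosparse_cong[OF Suc, of 1] by simp
  moreover have "\<forall>\<^sub>\<approx>x. deriv (opr n (k + j) (ncoeff k C j) f r) x =
      opr n (Suc (k + j)) (dcoeff (k + j) (ncoeff k C j)) f r x"
    using assms by (intro deriv_opr ratc_meroc ratc_ncoeff)
  ultimately show ?case by eventually_elim simp
qed auto

text \<open>Euclidean division with the divisor on the right. The leading term of \<open>A\<close>
  is removed by subtracting \<open>T\<close> times the \<open>t\<close>-th derivative of the
  divisor, where \<open>T\<close> is the leading coefficient of \<open>A\<close> times the inverse
  \<open>V\<close> of that of \<open>B\<close>. The leading coefficient of the quotient is recorded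
  so that its invertibility can be checked later.\<close>

lemma opr_division:
  assumes B: "ratc n k B" and V: "\<And>r s. r < n \<Longrightarrow> s < n \<Longrightarrow> rational_fun (V r s)"
    and inv: "\<forall>\<^sub>\<approx>x. \<forall>r<n. \<forall>s<n. (\<Sum>u<n. V r u x * B k u s x) = (if r = s then 1 else 0)"
    and A: "ratc n (k + t) A"
  shows "\<exists>Q R. ratc n t Q \<and>
    (\<forall>r<n. \<forall>s<n. \<forall>x. Q t r s x = (\<Sum>u<n. A (k + t) r u x * V u s x)) \<and>
    (\<forall>f. merov n f \<longrightarrow> (\<forall>r<n. \<forall>\<^sub>\<approx>x. opr n (k + t) A f r x = opr n t Q (opr n k B f) r x +
       (\<Sum>i<k. \<Sum>s<n. R i r s x * (deriv ^^ i) (f s) x)))"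
  using A
proof (induction t arbitrary: A)
  \<comment> \<open>A single elimination, for every \<open>t\<close>. It leaves orders below
    \<open>k + t\<close>: for \<open>t = 0\<close> this is the final remainder, and for a successor
    it is a dividend of the next lower order.\<close>
  have step: "ratc n (k + t) (\<lambda>i r s x. A i r s x - (\<Sum>u<n. (\<Sum>v<n. A (k + t) r v x * V v u x) * ncoeff k B t i u s x)) \<and>
      (\<forall>f. merov n f \<longrightarrow> (\<forall>r<n. \<forall>\<^sub>\<approx>x. opr n (k + t) A f r x =
        (\<Sum>u<n. (\<Sum>v<n. A (k + t) r v x * V v u x) * (deriv ^^ t) (opr n k B f u) x) +
        (\<Sum>i<k + t. \<Sum>s<n. (A i r s x - (\<Sum>u<n. (\<Sum>v<n. A (k + t) r v x * V v u x) * ncoeff k B t i u s x)) *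
          (deriv ^^ i) (f s) x)))"
    if A: "ratc n (k + t) A" for A t
  proof
    define T where "T r u x = (\<Sum>v<n. A (k + t) r v x * V v u x)" for r u x
    define A' where "A' i r s x = A i r s x - (\<Sum>u<n. T r u x * ncoeff k B t i u s x)" for i r s x
    have "rational_fun (T r u)" if "r < n" "u < n" for r u
      unfolding T_def[abs_def] using A V that
      by (intro rational_fun_sum rational_fun_mult) (auto simp: ratc_def)
    hence "ratc n (k + t) A'"
      using A ratc_ncoeff[OF B, of t] unfolding ratc_def A'_def[abs_def]
      by (auto intro!: rational_fun_diff rational_fun_sum rational_fun_mult)
    thus "ratc n (k + t) (\<lambda>i r s x. A i r s x - (\<Sum>u<n. (\<Sum>v<n. A (k + t) r v x * V v u x) * ncoeff k B t i u s x))"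
      by (simp add: A'_def[abs_def] T_def)
    have A'_top: "\<forall>\<^sub>\<approx>x. \<forall>r<n. \<forall>s<n. A' (k + t) r s x = 0"
      using inv
    proof eventually_elim
      case (elim x)
      show ?case
      proof (intro allI impI)
        fix r s assume rs: "r < n" "s < n"
        have "(\<Sum>u<n. T r u x * B k u s x) = (\<Sum>u<n. \<Sum>v<n. A (k + t) r v x * (V v u x * B k u s x))"
          by (simp add: T_def sum_distrib_right mult.assoc)
        also have "\<dots> = (\<Sum>v<n. \<Sum>u<n. A (k + t) r v x * (V v u x * B k u s x))" by (rule sum.swap)
        also have "\<dots> = (\<Sum>v<n. A (k + t) r v x * (if v = s then 1 else 0))"
          using elim rs by (simp flip: sum_distrib_left)
        also have "\<dots> = A (k + t) r s x"
          using rs by (simp add: if_distrib[of "\<lambda>c. _ * c"] cong: if_cong)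
        finally show "A' (k + t) r s x = 0" by (simp add: A'_def ncoeff_top)
      qed
    qed
    show "\<forall>f. merov n f \<longrightarrow> (\<forall>r<n. \<forall>\<^sub>\<approx>x. opr n (k + t) A f r x =
        (\<Sum>u<n. (\<Sum>v<n. A (k + t) r v x * V v u x) * (deriv ^^ t) (opr n k B f u) x) +
        (\<Sum>i<k + t. \<Sum>s<n. (A i r s x - (\<Sum>u<n. (\<Sum>v<n. A (k + t) r v x * V v u x) * ncoeff k B t i u s x)) *
          (deriv ^^ i) (f s) x))"
      unfolding T_def[symmetric] A'_def[symmetric]
    proof (intro allI impI)
      fix f r assume f: "merov n f" and r: "r < n"
      have "\<forall>\<^sub>\<approx>x. \<forall>u<n. (deriv ^^ t) (opr n k B f u) x = opr n (k + t) (ncoeff k B t) f u x"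
        using f by (intro eventually_cosparse_all_less allI impI higher_deriv_opr B)
      with A'_top show "\<forall>\<^sub>\<approx>x. opr n (k + t) A f r x =
        (\<Sum>u<n. T r u x * (deriv ^^ t) (opr n k B f u) x) +
        (\<Sum>i<k + t. \<Sum>s<n. A' i r s x * (deriv ^^ i) (f s) x)"
      proof eventually_elim
        case (elim x)
        have "(\<Sum>u<n. T r u x * (deriv ^^ t) (opr n k B f u) x) =
            (\<Sum>u<n. \<Sum>i\<le>k + t. \<Sum>s<n. T r u x * ncoeff k B t i u s x * (deriv ^^ i) (f s) x)"
          using elim(2) by (simp add: opr_def sum_distrib_left mult.assoc)
        also have "\<dots> = (\<Sum>i\<le>k + t. \<Sum>s<n. \<Sum>u<n. T r u x * ncoeff k B t i u s x * (deriv ^^ i) (f s) x)"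
          by (subst sum.swap) (intro sum.cong refl sum.swap)
        also have "\<dots> = (\<Sum>i\<le>k + t. \<Sum>s<n. (A i r s x - A' i r s x) * (deriv ^^ i) (f s) x)"
          by (simp add: A'_def sum_distrib_right)
        also have "\<dots> = opr n (k + t) A f r x - (\<Sum>i\<le>k + t. \<Sum>s<n. A' i r s x * (deriv ^^ i) (f s) x)"
          by (simp add: opr_def left_diff_distrib sum_subtractf)
        also have "(\<Sum>i\<le>k + t. \<Sum>s<n. A' i r s x * (deriv ^^ i) (f s) x) =
            (\<Sum>i<k + t. \<Sum>s<n. A' i r s x * (deriv ^^ i) (f s) x)"
          using elim(1) r by (simp add: lessThan_Suc_atMost[symmetric])
        finally show ?case by simp
      qed
    qed
  qed
  {
    case 0
    show ?case
      using step[of 0 A] 0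
      by - (rule exI[of _ "\<lambda>i r s x. \<Sum>v<n. A k r v x * V v s x"],
          rule exI[of _ "\<lambda>i r s x. A i r s x - (\<Sum>u<n. (\<Sum>v<n. A k r v x * V v u x) * B i u s x)"],
          auto simp: ratc_def opr_def intro!: rational_fun_sum rational_fun_mult V)
  next
    case (Suc t)
    define T where "T r u x = (\<Sum>v<n. A (k + Suc t) r v x * V v u x)" for r u x
    define A' where "A' i r s x = A i r s x - (\<Sum>u<n. T r u x * ncoeff k B (Suc t) i u s x)" for i r s x
    have T: "rational_fun (T r u)" if "r < n" "u < n" for r u
      unfolding T_def[abs_def] using Suc.prems V that
      by (intro rational_fun_sum rational_fun_mult) (auto simp: ratc_def)
    have A': "ratc n (k + t) A'"
      using step[OF Suc.prems] by (auto simp: ratc_def T_def A'_def[abs_def])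
    have eq: "\<forall>\<^sub>\<approx>x. opr n (k + Suc t) A f r x =
        (\<Sum>u<n. T r u x * (deriv ^^ Suc t) (opr n k B f u) x) + opr n (k + t) A' f r x"
      if "merov n f" "r < n" for f r
      using step[OF Suc.prems] that
      by (simp add: T_def A'_def[abs_def] opr_def lessThan_Suc_atMost del: funpow.simps ncoeff.simps)
    obtain Q R where QR: "ratc n t Q" "\<And>f r. merov n f \<Longrightarrow> r < n \<Longrightarrow> \<forall>\<^sub>\<approx>x. opr n (k + t) A' f r x =
        opr n t Q (opr n k B f) r x + (\<Sum>i<k. \<Sum>s<n. R i r s x * (deriv ^^ i) (f s) x)"
      using Suc.IH[OF A'] by blast
    define Q' where "Q' = Q(Suc t := T)"
    have "\<forall>\<^sub>\<approx>x. opr n (k + Suc t) A f r x = opr n (Suc t) Q' (opr n k B f) r x +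
        (\<Sum>i<k. \<Sum>s<n. R i r s x * (deriv ^^ i) (f s) x)" if "merov n f" "r < n" for f r
      using eq[OF that] QR(2)[OF that]
    proof eventually_elim
      case (elim x)
      have "opr n (Suc t) Q' (opr n k B f) r x =
          opr n t Q (opr n k B f) r x + (\<Sum>u<n. T r u x * (deriv ^^ Suc t) (opr n k B f u) x)"
        by (simp add: opr_def Q'_def)
      with elim show ?case by simp
    qed
    moreover have "ratc n (Suc t) Q'"
      using QR(1) T by (auto simp: ratc_def Q'_def le_Suc_eq)
    moreover have "Q' (Suc t) = T" by (simp add: Q'_def)
    ultimately show ?case
      by - (rule exI[of _ Q'], rule exI[of _ R], auto simp: T_def)
  }
qed

section \<open>Inverting matrices of rational functions\<close>

lemma rational_fun_det:
  assumes "\<And>x. M x \<in> carrier_mat N N" "\<And>r s. r < N \<Longrightarrow> s < N \<Longrightarrow> rational_fun (\<lambda>x. M x $$ (r, s))"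
  shows "rational_fun (\<lambda>x. det (M x))"
  unfolding det_def'[OF assms(1)]
  by (intro rational_fun_sum rational_fun_mult rational_fun_const rational_fun_prod assms(2))
     (auto simp: permutes_in_image)

text \<open>The adjugate and the determinant are polynomial in the entries, so the inverse given by
  Cramer's rule is rational again.\<close>

lemma rational_inverse:
  assumes A: "\<And>r s. r < N \<Longrightarrow> s < N \<Longrightarrow> rational_fun (A r s)"
    and nonsing: "\<forall>\<^sub>\<approx>x. nonsing N (\<lambda>r s. A r s x)"
  obtains Y where "\<And>r s. r < N \<Longrightarrow> s < N \<Longrightarrow> rational_fun (Y r s)"
    "\<forall>\<^sub>\<approx>x. \<forall>r<N. \<forall>s<N. (\<Sum>t<N. A r t x * Y t s x) = (if r = s then 1 else 0)"
    "\<forall>\<^sub>\<approx>x. \<forall>r<N. \<forall>s<N. (\<Sum>t<N. Y r t x * A t s x) = (if r = s then 1 else 0)"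
proof -
  define M where "M x = sqmat N (\<lambda>r s. A r s x)" for x
  have M: "M x \<in> carrier_mat N N" for x by (simp add: M_def)
  define Y where "Y r s x = adj_mat (M x) $$ (r, s) * inverse (det (M x))" for r s x
  have adj: "adj_mat (M x) = sqmat N (\<lambda>r s. adj_mat (M x) $$ (r, s))" for x
    using adj_mat(1)[OF M[of x]] by (intro eq_matI) auto
  have mult: "(\<Sum>t<N. A r t x * adj_mat (M x) $$ (t, s)) = (if r = s then det (M x) else 0)"
    "(\<Sum>t<N. adj_mat (M x) $$ (r, t) * A t s x) = (if r = s then det (M x) else 0)"
    if "r < N" "s < N" for r s x
  proof -
    have "(M x * adj_mat (M x)) $$ (r, s) = (if r = s then det (M x) else 0)"
      "(adj_mat (M x) * M x) $$ (r, s) = (if r = s then det (M x) else 0)"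
      using that adj_mat(2,3)[OF M[of x]] by simp_all
    thus "(\<Sum>t<N. A r t x * adj_mat (M x) $$ (t, s)) = (if r = s then det (M x) else 0)"
      "(\<Sum>t<N. adj_mat (M x) $$ (r, t) * A t s x) = (if r = s then det (M x) else 0)"
      using sqmat_mult_index[OF that, of "\<lambda>r s. A r s x" "\<lambda>r s. adj_mat (M x) $$ (r, s)"]
        sqmat_mult_index[OF that, of "\<lambda>r s. adj_mat (M x) $$ (r, s)" "\<lambda>r s. A r s x"]
      unfolding adj[symmetric] M_def[symmetric] by simp_all
  qed
  show ?thesis
  proof (rule that[of Y])
    fix r s assume rs: "r < N" "s < N"
    have MA: "rational_fun (\<lambda>x. M x $$ (r, s))" if "r < N" "s < N" for r s
      using A that by (simp add: M_def)
    have adj_entry: "adj_mat (M x) $$ (r, s) = (- 1) ^ (s + r) * det (mat_delete (M x) s r)" for x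
      using rs by (simp add: adj_mat_def cofactor_def M_def)
    have "rational_fun (\<lambda>x. det (M x))" using M MA by (intro rational_fun_det)
    moreover have "rational_fun (\<lambda>x. det (mat_delete (M x) s r))"
    proof (rule rational_fun_det[of _ "N - 1"])
      show "mat_delete (M x) s r \<in> carrier_mat (N - 1) (N - 1)" for x
        using mat_delete_carrier[OF M] by simp
      show "rational_fun (\<lambda>x. mat_delete (M x) s r $$ (i, j))" if "i < N - 1" "j < N - 1" for i j
        using that A by (simp add: mat_delete_def M_def)
    qed
    ultimately show "rational_fun (Y r s)"
      unfolding Y_def[abs_def] adj_entry
      by (intro rational_fun_mult rational_fun_inverse rational_fun_const)
  next
    have nz: "\<forall>\<^sub>\<approx>x. det (M x) \<noteq> 0" using nonsing by (simp add: nonsing_iff_det M_def)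
    thus "\<forall>\<^sub>\<approx>x. \<forall>r<N. \<forall>s<N. (\<Sum>t<N. A r t x * Y t s x) = (if r = s then 1 else 0)"
    proof eventually_elim
      case (elim x)
      have "(\<Sum>t<N. A r t x * Y t s x) = (\<Sum>t<N. A r t x * adj_mat (M x) $$ (t, s)) * inverse (det (M x))" for r s
        by (simp add: Y_def sum_distrib_right mult.assoc)
      thus ?case using elim by (auto simp: mult)
    qed
    from nz show "\<forall>\<^sub>\<approx>x. \<forall>r<N. \<forall>s<N. (\<Sum>t<N. Y r t x * A t s x) = (if r = s then 1 else 0)"
    proof eventually_elim
      case (elim x)
      have "(\<Sum>t<N. Y r t x * A t s x) = (\<Sum>t<N. adj_mat (M x) $$ (r, t) * A t s x) * inverse (det (M x))" for r s
        by (simp add: Y_def sum_distrib_left mult_ac)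
      thus ?case using elim by (auto simp: mult)
    qed
  qed
qed

section \<open>Operators determined by their kernel\<close>

lemma sum_index_pair:
  fixes g :: "nat \<Rightarrow> nat \<Rightarrow> complex"
  shows "(\<Sum>i<k. \<Sum>s<n. g i s) = (\<Sum>t<n * k. g (t div n) (t mod n))"
proof -
  have "(\<Sum>s<n. g i s) = (\<Sum>t = i * n..<i * n + n. g (t div n) (t mod n))" for i
    using sum.shift_bounds_nat_ivl[of "\<lambda>t. g (t div n) (t mod n)" 0 "i * n" n]
    by (simp add: atLeast0LessThan add.commute)
  thus ?thesis
    using sum.nat_group[of "\<lambda>t. g (t div n) (t mod n)" n k] by (simp add: mult.commute)
qed

text \<open>A kernel vector of this matrix at a generic point is a combination of the solutions
  whose jet of length \<open>k\<close> vanishes there, hence a zero combination.\<close>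

lemma wronskian_nonsing:
  assumes "\<forall>\<^sub>\<approx>x. regular_at n k C x" "\<And>j. j < n * k \<Longrightarrow> F j \<in> okernel n k C" "indep n (n * k) F"
  shows "\<forall>\<^sub>\<approx>x. nonsing (n * k) (\<lambda>t j. (deriv ^^ (t div n)) (F j (t mod n)) x)"
proof -
  have "\<forall>\<^sub>\<approx>x. \<forall>c. (\<forall>i<k. \<forall>s<n. (\<Sum>j<n * k. (deriv ^^ i) (F j s) x * c j) = 0) \<longrightarrow>
      nullf n (lcomb (n * k) c F)"
    using assms(1,2) by (rule okernel_generic_jets)
  thus ?thesis
  proof eventually_elim
    case (elim x)
    show ?case
      unfolding nonsing_def
    proof (intro allI impI)
      fix c j assume c: "\<forall>t<n * k. (\<Sum>j<n * k. (deriv ^^ (t div n)) (F j (t mod n)) x * c j) = 0" and j: "j < n * k"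
      have "\<forall>i<k. \<forall>s<n. (\<Sum>j<n * k. (deriv ^^ i) (F j s) x * c j) = 0"
        using index_pair_cases[of n k "\<lambda>i s. (\<Sum>j<n * k. (deriv ^^ i) (F j s) x * c j) = 0"] c by blast
      hence "nullf n (lcomb (n * k) c F)" using elim by blast
      thus "c j = 0" using assms(3) j by (auto simp: indep_def)
    qed
  qed
qed

text \<open>The lower coefficients of \<open>P\<close> solve a linear system with the Wronski matrix
  of the kernel. Dividing the \<open>j\<close>-th equation by its exponential makes the matrix and
  the right-hand side polynomial without affecting nonsingularity, so the solution is
  rational.\<close>

lemma rational_coefficients_of_kernel:
  assumes reg: "\<forall>\<^sub>\<approx>x. regular_at n k P x"
    and monic: "\<forall>\<^sub>\<approx>x. \<forall>r<n. \<forall>s<n. P k r s x = (if r = s then 1 else 0)"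
    and ker: "\<And>j. j < n * k \<Longrightarrow> (\<lambda>s. qe (\<alpha> j) (w j s)) \<in> okernel n k P"
    and ind: "indep n (n * k) (\<lambda>j s. qe (\<alpha> j) (w j s))"
  shows "ratc n k P"
proof -
  define R where "R t j x = poly ((dexp (\<alpha> j) ^^ (t div n)) (w j (t mod n))) x" for t j x
  have "\<forall>\<^sub>\<approx>x. nonsing (n * k) (\<lambda>t j. (deriv ^^ (t div n)) (qe (\<alpha> j) (w j (t mod n))) x)"
    by (rule wronskian_nonsing[OF reg ker ind])
  hence "\<forall>\<^sub>\<approx>x. nonsing (n * k) (\<lambda>t j. R t j x)"
  proof eventually_elim
    case (elim x)
    show ?case unfolding nonsing_def
    proof (intro allI impI)
      fix v j assume v: "\<forall>t<n * k. (\<Sum>j<n * k. R t j x * v j) = 0" and j: "j < n * k"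
      have "(\<Sum>j<n * k. (deriv ^^ (t div n)) (qe (\<alpha> j) (w j (t mod n))) x * (v j * exp (- (\<alpha> j * x)))) =
          (\<Sum>j<n * k. R t j x * v j)" for t
        by (intro sum.cong refl) (simp add: higher_deriv_qe qe_def R_def exp_minus)
      with v elim have "\<forall>j<n * k. v j * exp (- (\<alpha> j * x)) = 0"
        unfolding nonsing_def by (elim allE[where x = "\<lambda>j. v j * exp (- (\<alpha> j * x))"]) simp
      thus "v j = 0" using j by simp
    qed
  qed
  moreover have "rational_fun (R t j)" for t j
    unfolding R_def[abs_def] by (rule rational_fun_poly)
  ultimately obtain Y where Y: "\<And>r s. r < n * k \<Longrightarrow> s < n * k \<Longrightarrow> rational_fun (Y r s)"
    "\<forall>\<^sub>\<approx>x. \<forall>r<n * k. \<forall>s<n * k. (\<Sum>t<n * k. R r t x * Y t s x) = (if r = s then 1 else 0)"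
    using rational_inverse[of "n * k" R] by blast
  \<comment> \<open>The term of order \<open>k\<close>, moved to the other side; its coefficient is
    the identity because \<open>P\<close> is monic.\<close>
  define v where "v r j x = - poly ((dexp (\<alpha> j) ^^ k) (w j r)) x" for r j x
  have sys: "\<forall>\<^sub>\<approx>x. \<forall>r<n. \<forall>j<n * k. (\<Sum>t<n * k. P (t div n) r (t mod n) x * R t j x) = v r j x"
  proof -
    have "\<forall>\<^sub>\<approx>x. \<forall>j<n * k. \<forall>r<n. opr n k P (\<lambda>s. qe (\<alpha> j) (w j s)) r x = 0"
      using ker by (intro eventually_cosparse_all_less) (auto simp: okernel_def nullf_def intro!: eventually_cosparse_all_less)
    with monic show ?thesis
    proof eventually_elim
      case (elim x)
      show ?case
      proof (intro allI impI)
        fix r j assume r: "r < n" and j: "j < n * k"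
        define S where "S = (\<Sum>t<n * k. P (t div n) r (t mod n) x * R t j x)"
        have "0 = opr n k P (\<lambda>s. qe (\<alpha> j) (w j s)) r x" using elim(2) r j by simp
        also have "\<dots> = (\<Sum>i<k. \<Sum>s<n. P i r s x * qe (\<alpha> j) ((dexp (\<alpha> j) ^^ i) (w j s)) x) +
            (\<Sum>s<n. P k r s x * qe (\<alpha> j) ((dexp (\<alpha> j) ^^ k) (w j s)) x)"
          by (simp add: opr_def higher_deriv_qe lessThan_Suc_atMost[symmetric])
        also have "(\<Sum>s<n. P k r s x * qe (\<alpha> j) ((dexp (\<alpha> j) ^^ k) (w j s)) x) =
            (\<Sum>s<n. if r = s then - (exp (\<alpha> j * x) * v r j x) else 0)"
          using elim(1) r by (intro sum.cong refl) (auto simp: qe_def v_def)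
        also have "\<dots> = - (exp (\<alpha> j * x) * v r j x)" using r by simp
        also have "(\<Sum>i<k. \<Sum>s<n. P i r s x * qe (\<alpha> j) ((dexp (\<alpha> j) ^^ i) (w j s)) x) = exp (\<alpha> j * x) * S"
          unfolding sum_index_pair S_def by (simp add: qe_def R_def sum_distrib_left mult_ac)
        finally have "exp (\<alpha> j * x) * (S - v r j x) = 0" by (simp add: right_diff_distrib)
        thus "(\<Sum>t<n * k. P (t div n) r (t mod n) x * R t j x) = v r j x" by (simp add: S_def)
      qed
    qed
  qed
  have "rational_fun (P i r s)" if "i < k" "r < n" "s < n" for i r s
  proof -
    have "rational_fun (P (t div n) r (t mod n))" if t: "t < n * k" for t
    proof (rule rational_fun_cong)
      show "rational_fun (\<lambda>x. \<Sum>j<n * k. v r j x * Y j t x)"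
        using Y(1) t by (intro rational_fun_sum rational_fun_mult)
          (auto simp: v_def[abs_def] simp flip: poly_minus intro: rational_fun_poly)
      from sys Y(2) show "\<forall>\<^sub>\<approx>x. (\<Sum>j<n * k. v r j x * Y j t x) = P (t div n) r (t mod n) x"
      proof eventually_elim
        case (elim x)
        have "(\<Sum>j<n * k. v r j x * Y j t x) =
            (\<Sum>j<n * k. \<Sum>u<n * k. P (u div n) r (u mod n) x * (R u j x * Y j t x))"
          using elim(1) \<open>r < n\<close> by (intro sum.cong refl) (simp add: sum_distrib_right mult.assoc flip: elim(1)[rule_format])
        also have "\<dots> = (\<Sum>u<n * k. \<Sum>j<n * k. P (u div n) r (u mod n) x * (R u j x * Y j t x))"
          by (rule sum.swap)
        also have "\<dots> = (\<Sum>u<n * k. P (u div n) r (u mod n) x * (if u = t then 1 else 0))"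
          using elim(2) t by (simp flip: sum_distrib_left)
        also have "\<dots> = P (t div n) r (t mod n) x"
          using t by (simp add: if_distrib[of "\<lambda>c. _ * c"] cong: if_cong)
        finally show ?case .
      qed
    qed
    thus ?thesis using index_pair_cases[of n k "\<lambda>i s. rational_fun (P i r s)" i s] that by blast
  qed
  moreover have "rational_fun (P k r s)" if "r < n" "s < n" for r s
  proof (rule rational_fun_cong)
    show "rational_fun (\<lambda>x. if r = s then 1 else 0)" by (rule rational_fun_const)
    from monic show "\<forall>\<^sub>\<approx>x. (if r = s then 1 else 0) = P k r s x"
      by eventually_elim (use that in auto)
  qed
  ultimately show ?thesis by (auto simp: ratc_def le_less)
qed

text \<open>Each row of coefficients of the remainder is killed by the transposed Wronski matrix of
  \<open>F\<close>, and is thus zero wherever that matrix is nonsingular. The quotient has leading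
  coefficient \<open>lead_coeff d\<close> times the inverse of \<open>B k\<close>.\<close>

lemma opr_eq_of_kernel:
  assumes B: "ratc n k B" "\<forall>\<^sub>\<approx>x. regular_at n k B x"
    and ker: "\<And>j. j < n * k \<Longrightarrow> F j \<in> okernel n k B" "indep n (n * k) F"
    and d: "d \<noteq> 0" "degree d = k + t" "\<And>j. j < n * k \<Longrightarrow> F j \<in> okernel n (degree d) (dconst d)"
  obtains Q where "ratc n t Q" "\<forall>\<^sub>\<approx>x. nonsing n (\<lambda>r s. Q t r s x)"
    "\<And>f r. merov n f \<Longrightarrow> r < n \<Longrightarrow> \<forall>\<^sub>\<approx>x. opr n (degree d) (dconst d) f r x = opr n t Q (opr n k B f) r x"
proof -
  have "\<forall>\<^sub>\<approx>x. nonsing n (\<lambda>r s. B k r s x)"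
    using B(2) by eventually_elim (auto simp: regular_at_def)
  then obtain V where V: "\<And>r s. r < n \<Longrightarrow> s < n \<Longrightarrow> rational_fun (V r s)"
    "\<forall>\<^sub>\<approx>x. \<forall>r<n. \<forall>s<n. (\<Sum>u<n. B k r u x * V u s x) = (if r = s then 1 else 0)"
    "\<forall>\<^sub>\<approx>x. \<forall>r<n. \<forall>s<n. (\<Sum>u<n. V r u x * B k u s x) = (if r = s then 1 else 0)"
    using rational_inverse[of n "B k"] B(1) by (auto simp: ratc_def)
  have "ratc n (k + t) (dconst d)"
    by (auto simp: ratc_def dconst_def[abs_def] intro: rational_fun_const)
  from opr_division[OF B(1) V(1) V(3) this] obtain Q R where Q: "ratc n t Q"
    "\<And>r s x. r < n \<Longrightarrow> s < n \<Longrightarrow> Q t r s x = (\<Sum>u<n. dconst d (k + t) r u x * V u s x)"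
    and division: "\<And>f r. merov n f \<Longrightarrow> r < n \<Longrightarrow> \<forall>\<^sub>\<approx>x. opr n (degree d) (dconst d) f r x =
      opr n t Q (opr n k B f) r x + (\<Sum>i<k. \<Sum>s<n. R i r s x * (deriv ^^ i) (f s) x)"
    unfolding d(2) by blast
  have "\<forall>\<^sub>\<approx>x. \<forall>j<n * k. \<forall>r<n. (\<Sum>i<k. \<Sum>s<n. R i r s x * (deriv ^^ i) (F j s) x) = 0"
  proof (intro eventually_cosparse_all_less allI impI)
    fix j r assume j: "j < n * k" and r: "r < n"
    have F: "merov n (F j)" "nullf n (opr n k B (F j))" "nullf n (opr n (degree d) (dconst d) (F j))"
      using ker(1)[OF j] d(3)[OF j] by (auto simp: okernel_def)
    have "\<forall>\<^sub>\<approx>x. opr n t Q (opr n k B (F j)) r x = 0"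
      using opr_nullf[OF F(2), of t Q] r by (auto simp: nullf_def)
    moreover have "\<forall>\<^sub>\<approx>x. opr n (degree d) (dconst d) (F j) r x = 0"
      using F(3) r by (auto simp: nullf_def)
    ultimately show "\<forall>\<^sub>\<approx>x. (\<Sum>i<k. \<Sum>s<n. R i r s x * (deriv ^^ i) (F j s) x) = 0"
      using division[OF F(1) r] by eventually_elim simp
  qed
  moreover have "\<forall>\<^sub>\<approx>x. nonsing (n * k) (\<lambda>t j. (deriv ^^ (t div n)) (F j (t mod n)) x)"
    using B(2) ker by (rule wronskian_nonsing)
  ultimately have R0: "\<forall>\<^sub>\<approx>x. \<forall>i<k. \<forall>r<n. \<forall>s<n. R i r s x = 0"
  proof eventually_elim
    case (elim x)
    have "\<forall>r<n. \<forall>t<n * k. R (t div n) r (t mod n) x = 0"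
    proof (intro allI impI)
      fix r t assume r: "r < n" and t: "t < n * k"
      have "nonsing (n * k) (\<lambda>j t. (deriv ^^ (t div n)) (F j (t mod n)) x)"
        using elim(2) by (subst nonsing_transpose)
      moreover have "\<forall>j<n * k. (\<Sum>t<n * k. (deriv ^^ (t div n)) (F j (t mod n)) x * R (t div n) r (t mod n) x) = 0"
        using elim(1) r by (simp add: sum_index_pair mult.commute)
      ultimately show "R (t div n) r (t mod n) x = 0"
        using t unfolding nonsing_def by (elim allE[where x = "\<lambda>t. R (t div n) r (t mod n) x"]) simp
    qed
    thus ?case
      using index_pair_cases[of n k "\<lambda>i s. R i r s x = 0" for r] by blast
  qed
  show ?thesis
  proof (rule that[OF Q(1)])
    from V(3) show "\<forall>\<^sub>\<approx>x. nonsing n (\<lambda>r s. Q t r s x)"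
    proof eventually_elim
      case (elim x)
      have Qt: "Q t r s x = lead_coeff d * V r s x" if "r < n" "s < n" for r s
        using that by (simp add: Q(2) dconst_def d(2) if_distrib[of "\<lambda>c. c * _"] cong: if_cong)
      have "sqmat n (\<lambda>r s. V r s x) * sqmat n (\<lambda>r s. B k r s x) = 1\<^sub>m n"
      proof (rule eq_matI)
        fix r s assume "r < dim_row (1\<^sub>m n :: complex mat)" "s < dim_col (1\<^sub>m n :: complex mat)"
        hence rs: "r < n" "s < n" by auto
        show "(sqmat n (\<lambda>r s. V r s x) * sqmat n (\<lambda>r s. B k r s x)) $$ (r, s) = 1\<^sub>m n $$ (r, s)"
          using elim rs sqmat_mult_index[OF rs, of "\<lambda>r s. V r s x" "\<lambda>r s. B k r s x"] by simp
      qed auto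
      hence "det (sqmat n (\<lambda>r s. V r s x)) * det (sqmat n (\<lambda>r s. B k r s x)) = 1"
        using det_mult[of "sqmat n (\<lambda>r s. V r s x)" n "sqmat n (\<lambda>r s. B k r s x)"] by simp
      hence V: "nonsing n (\<lambda>r s. V r s x)" by (auto simp: nonsing_iff_det)
      show ?case unfolding nonsing_def
      proof (intro allI impI)
        fix v s assume v: "\<forall>r<n. (\<Sum>s<n. Q t r s x * v s) = 0" and s: "s < n"
        have "(\<Sum>s<n. V r s x * v s) = 0" if r: "r < n" for r
        proof -
          have "lead_coeff d * (\<Sum>s<n. V r s x * v s) = (\<Sum>s<n. Q t r s x * v s)"
            unfolding sum_distrib_left using r by (intro sum.cong refl) (simp add: Qt mult.assoc)
          thus ?thesis using v r d(1) by simp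
        qed
        thus "v s = 0" using V s unfolding nonsing_def by blast
      qed
    qed
    fix f r assume f: "merov n f" and r: "r < n"
    from division[OF this] R0
    show "\<forall>\<^sub>\<approx>x. opr n (degree d) (dconst d) f r x = opr n t Q (opr n k B f) r x"
      by eventually_elim (use r in simp)
  qed
qed

section \<open>Vector-valued functions and their components\<close>

abbreviation comps :: "(complex \<Rightarrow> complex vec) \<Rightarrow> nat \<Rightarrow> complex \<Rightarrow> complex" where
  "comps f \<equiv> (\<lambda>s x. f x $ s)"

abbreviation entries :: "coeffs \<Rightarrow> nat \<Rightarrow> nat \<Rightarrow> nat \<Rightarrow> complex \<Rightarrow> complex" where
  "entries a \<equiv> (\<lambda>i r s x. a i x $$ (r, s))"

lemma opr_cong: "(\<And>s. s < n \<Longrightarrow> f s = g s) \<Longrightarrow> opr n k C f = opr n k C g"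
  unfolding opr_def by (intro ext sum.cong refl) auto

lemma indep_cong: "(\<And>j s. j < N \<Longrightarrow> s < n \<Longrightarrow> F j s = G j s) \<Longrightarrow> indep n N F \<longleftrightarrow> indep n N G"
proof -
  assume "\<And>j s. j < N \<Longrightarrow> s < n \<Longrightarrow> F j s = G j s"
  hence "nullf n (lcomb N c F) \<longleftrightarrow> nullf n (lcomb N c G)" for c
    by (simp add: nullf_def lcomb_def cong: sum.cong_simp)
  thus ?thesis by (simp add: indep_def)
qed

lemma okernel_cong': "(\<And>s. s < n \<Longrightarrow> f s = g s) \<Longrightarrow> f \<in> okernel n k C \<longleftrightarrow> g \<in> okernel n k C"
  using opr_cong[of n f g k C] by (simp add: okernel_def merov_def)

lemma dop_vec_eq:
  assumes "\<And>i. i \<le> k \<Longrightarrow> a i x \<in> carrier_mat n n"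
  shows "dop_vec n k a f x = Matrix.vec n (\<lambda>r. opr n k (entries a) (comps f) r x)"
proof (rule eq_vecI)
  fix r assume "r < dim_vec (Matrix.vec n (\<lambda>r. opr n k (entries a) (comps f) r x))"
  hence r: "r < n" by simp
  have "(a i x *\<^sub>v vec_deriv n i f x) $ r = (\<Sum>s<n. a i x $$ (r, s) * (deriv ^^ i) (comps f s) x)"
    if "i \<le> k" for i
    using assms[OF that] r by (simp add: vec_deriv_def scalar_prod_def atLeast0LessThan)
  thus "dop_vec n k a f x $ r = Matrix.vec n (\<lambda>r. opr n k (entries a) (comps f) r x) $ r"
    using r by (simp add: dop_vec_def opr_def)
qed (simp add: dop_vec_def)

lemma ae_vec_eq_iff:
  "(\<forall>\<^sub>\<approx>x. Matrix.vec n (\<lambda>r. F r x) = Matrix.vec n (\<lambda>r. G r (x :: complex))) \<longleftrightarrow> (\<forall>r<n. \<forall>\<^sub>\<approx>x. F r x = G r x)"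
proof -
  have "(Matrix.vec n (\<lambda>r. F r x) = Matrix.vec n (\<lambda>r. G r x)) \<longleftrightarrow> (\<forall>r<n. F r x = G r x)" for x
    by (auto simp: vec_eq_iff)
  thus ?thesis
    using eventually_ball_finite_distrib[of "{..<n}" "\<lambda>x r. F r x = G r x" "cosparse UNIV"]
    by (simp add: Ball_def)
qed

lemma ae_vec_zero_iff: "(\<forall>\<^sub>\<approx>x. Matrix.vec n (\<lambda>r. F r x) = 0\<^sub>v n) \<longleftrightarrow> nullf n F"
proof -
  have "0\<^sub>v n = Matrix.vec n (\<lambda>r. 0 :: complex)" by auto
  thus ?thesis unfolding nullf_def using ae_vec_eq_iff[of n F "\<lambda>_ _. 0"] by simp
qed

lemma meromorphic_vec_iff: "meromorphic_vec n f \<longleftrightarrow> (\<forall>x. f x \<in> carrier_vec n) \<and> merov n (comps f)"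
  by (simp add: meromorphic_vec_def merov_def)

lemma vker_iff:
  assumes "\<And>i x. i \<le> k \<Longrightarrow> a i x \<in> carrier_mat n n"
  shows "f \<in> vker n k a \<longleftrightarrow> (\<forall>x. f x \<in> carrier_vec n) \<and> comps f \<in> okernel n k (entries a)"
  using dop_vec_eq[of k a _ n f] assms
  by (auto simp: vker_def okernel_def meromorphic_vec_iff ae_vec_zero_iff)

lemma fun_lincomb_eq: "fun_lincomb n N c f x = Matrix.vec n (\<lambda>r. lcomb N c (\<lambda>j. comps (f j)) r x)"
  by (simp add: fun_lincomb_def lcomb_def)

lemma is_basis_iff:
  assumes "V \<subseteq> {g. \<forall>x. g x \<in> carrier_vec n}"
  shows "is_basis n V N f \<longleftrightarrow> (\<forall>j<N. f j \<in> V) \<and> indep n N (\<lambda>j. comps (f j)) \<and>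
    (\<forall>g\<in>V. inspan n N (\<lambda>j. comps (f j)) (comps g))"
proof -
  have "(\<forall>\<^sub>\<approx>x. g x = fun_lincomb n N c f x) \<longleftrightarrow>
      (\<forall>s<n. \<forall>\<^sub>\<approx>x. comps g s x = lcomb N c (\<lambda>j. comps (f j)) s x)" if "g \<in> V" for g c
  proof -
    have "g x = Matrix.vec n (\<lambda>r. comps g r x)" for x
      using assms that by fastforce
    hence "(\<forall>\<^sub>\<approx>x. g x = fun_lincomb n N c f x) \<longleftrightarrow>
        (\<forall>\<^sub>\<approx>x. Matrix.vec n (\<lambda>r. comps g r x) = fun_lincomb n N c f x)" by simp
    thus ?thesis unfolding fun_lincomb_eq ae_vec_eq_iff .
  qed
  thus ?thesis
    unfolding is_basis_def indep_def inspan_def fun_lincomb_eq ae_vec_zero_iff by auto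
qed

lemma wronski_mat_eq:
  assumes "n > 0"
  shows "wronski_mat n k f x = sqmat (n * k) (\<lambda>t j. (deriv ^^ (t div n)) (comps (f j) (t mod n)) x)"
  using assms by (auto simp: wronski_mat_def vec_deriv_def)

lemma quasi_exp_comps: "s < n \<Longrightarrow> comps (quasi_exp n \<alpha> p) s = qe \<alpha> (p $ s)"
  by (simp add: quasi_exp_def qe_def fun_eq_iff)

lemma ae_imp_not_ae_not: "\<forall>\<^sub>\<approx>x. P (x :: complex) \<Longrightarrow> \<not> (\<forall>\<^sub>\<approx>x. \<not> P x)"
  using eventually_conj[of P "cosparse UNIV" "\<lambda>x. \<not> P x"] by auto

text \<open>Independence of \<open>n * k\<close> solutions suffices: the dimension bound makes them
  span the kernel, and uniqueness from jets makes their Wronski matrix invertible.\<close>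

lemma vker_basis:
  assumes "n > 0" and carrier: "\<And>i x. i \<le> k \<Longrightarrow> a i x \<in> carrier_mat n n"
    and reg: "\<forall>\<^sub>\<approx>x. regular_at n k (entries a) x"
    and f: "\<And>j. j < n * k \<Longrightarrow> f j \<in> vker n k a" and ind: "indep n (n * k) (\<lambda>j. comps (f j))"
  shows "is_basis n (vker n k a) (n * k) f" "nondegenerate n k (vker n k a)"
proof -
  have ker: "\<And>j. j < n * k \<Longrightarrow> comps (f j) \<in> okernel n k (entries a)"
    using f vker_iff[of k a n] carrier by blast
  show *: "is_basis n (vker n k a) (n * k) f"
  proof (subst is_basis_iff)
    show "vker n k a \<subseteq> {g. \<forall>x. g x \<in> carrier_vec n}"
      using vker_iff[of k a n] carrier by blast
    have "inspan n (n * k) (\<lambda>j. comps (f j)) (comps g)" if "g \<in> vker n k a" for g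
    proof -
      have "comps g \<in> okernel n k (entries a)" using that vker_iff[of k a n g] carrier by blast
      thus ?thesis using reg ker ind by (intro okernel_inspan)
    qed
    thus "(\<forall>j<n * k. f j \<in> vker n k a) \<and> indep n (n * k) (\<lambda>j. comps (f j)) \<and>
      (\<forall>g\<in>vker n k a. inspan n (n * k) (\<lambda>j. comps (f j)) (comps g))"
      using f ind by blast
  qed
  have "\<forall>\<^sub>\<approx>x. nonsing (n * k) (\<lambda>t j. (deriv ^^ (t div n)) (comps (f j) (t mod n)) x)"
    by (rule wronskian_nonsing[OF reg]) (use ker ind in auto)
  hence "\<forall>\<^sub>\<approx>x. det (wronski_mat n k f x) \<noteq> 0"
    by (simp add: nonsing_iff_det wronski_mat_eq[OF assms(1)])
  hence "invertible_mat_fun (wronski_mat n k f)"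
    unfolding invertible_mat_fun_def using ae_imp_not_ae_not by fastforce
  with * show "nondegenerate n k (vker n k a)" by (auto simp: nondegenerate_def)
qed

text \<open>The determinant is meromorphic, so not being the zero function already means being
  nonzero off a sparse set.\<close>

lemma rational_mat_invertible:
  assumes "rational_mat n A" "invertible_mat_fun A"
  shows "\<forall>\<^sub>\<approx>x. nonsing n (\<lambda>r s. A x $$ (r, s))"
proof -
  have "rational_fun (\<lambda>x. det (A x))"
    using assms(1) by (intro rational_fun_det[of A n]) (auto simp: rational_mat_def)
  hence "(\<lambda>x. det (A x)) meromorphic_on UNIV" by (rule rational_fun_meromorphic)
  hence "(\<forall>\<^sub>\<approx>x. det (A x) = 0) \<or> (\<forall>\<^sub>\<approx>x. det (A x) \<noteq> 0)"
    by (intro meromorphic_imp_constant_or_avoid) auto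
  hence "\<forall>\<^sub>\<approx>x. det (A x) \<noteq> 0"
    using assms(2) by (auto simp: invertible_mat_fun_def)
  moreover have "sqmat n (\<lambda>r s. A x $$ (r, s)) = A x" for x
  proof -
    have "A x \<in> carrier_mat n n" using assms(1) by (simp add: rational_mat_def)
    thus ?thesis by (intro eq_matI) auto
  qed
  ultimately show ?thesis by (simp add: nonsing_iff_det)
qed

lemma rational_mat_regular:
  assumes "\<And>i. i \<le> k \<Longrightarrow> rational_mat n (a i)" "invertible_mat_fun (a k)"
  shows "ratc n k (entries a)" "\<forall>\<^sub>\<approx>x. regular_at n k (entries a) x"
proof -
  show *: "ratc n k (entries a)"
    using assms by (auto simp: ratc_def rational_mat_def)
  have "\<forall>\<^sub>\<approx>x. nonsing n (\<lambda>r s. a k x $$ (r, s))"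
    using assms by (intro rational_mat_invertible) auto
  with meroc_analytic[OF ratc_meroc[OF *]] show "\<forall>\<^sub>\<approx>x. regular_at n k (entries a) x"
    by eventually_elim (simp add: regular_at_def)
qed

lemma nonsing_one: "(\<And>r s. r < n \<Longrightarrow> s < n \<Longrightarrow> A r s = (if r = s then 1 else 0)) \<Longrightarrow> nonsing n A"
  by (auto simp: nonsing_def if_distrib[of "\<lambda>c. c * _"] cong: if_cong sum.cong_simp)

lemma mult_mat_entry:
  "A \<in> carrier_mat n n \<Longrightarrow> B \<in> carrier_mat n n \<Longrightarrow> r < n \<Longrightarrow> s < n \<Longrightarrow>
    (A * B) $$ (r, s) = (\<Sum>u<n. A $$ (r, u) * B $$ (u, s))"
  by (simp add: scalar_prod_def atLeast0LessThan)

text \<open>No derivative falls on \<open>W\<close>, as it multiplies from the left; the identity is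
  therefore pointwise in \<open>x\<close>.\<close>

lemma dop_mat_left_mult:
  assumes "W x \<in> carrier_mat n n" "\<And>i. i \<le> k \<Longrightarrow> P i x \<in> carrier_mat n n"
    "\<And>i. i \<le> k \<Longrightarrow> B i x = W x * P i x"
  shows "dop_mat n k B F x = W x * dop_mat n k P F x"
proof (rule eq_matI)
  fix r s assume "r < dim_row (W x * dop_mat n k P F x)" "s < dim_col (W x * dop_mat n k P F x)"
  hence rs: "r < n" "s < n" using assms(1) by (auto simp: dop_mat_def)
  have D: "mat_deriv n i F x \<in> carrier_mat n n" for i by (simp add: mat_deriv_def)
  have PD: "P i x * mat_deriv n i F x \<in> carrier_mat n n" if "i \<le> k" for i
    using assms(2)[OF that] D by simp
  have "dop_mat n k B F x $$ (r, s) = (\<Sum>i\<le>k. (W x * (P i x * mat_deriv n i F x)) $$ (r, s))"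
    using rs assms D assoc_mult_mat[OF assms(1) assms(2) D]
    by (simp add: dop_mat_def cong: sum.cong_simp)
  also have "\<dots> = (\<Sum>i\<le>k. \<Sum>u<n. W x $$ (r, u) * (P i x * mat_deriv n i F x) $$ (u, s))"
    using rs assms(1) PD by (intro sum.cong refl mult_mat_entry) auto
  also have "\<dots> = (\<Sum>u<n. \<Sum>i\<le>k. W x $$ (r, u) * (P i x * mat_deriv n i F x) $$ (u, s))"
    by (rule sum.swap)
  also have "\<dots> = (W x * dop_mat n k P F x) $$ (r, s)"
    using rs assms(1) by (simp add: dop_mat_def scalar_prod_def atLeast0LessThan sum_distrib_left)
  finally show "dop_mat n k B F x $$ (r, s) = (W x * dop_mat n k P F x) $$ (r, s)" .
qed (use assms in \<open>auto simp: dop_mat_def\<close>)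

lemma okernel_left_mult:
  assumes f: "f \<in> okernel n k C"
    and D: "\<forall>\<^sub>\<approx>x. \<forall>i\<le>k. \<forall>r<n. \<forall>s<n. D i r s x = (\<Sum>u<n. W r u x * C i u s x)"
  shows "f \<in> okernel n k D"
proof -
  have "\<forall>\<^sub>\<approx>x. \<forall>r<n. opr n k C f r x = 0"
    using f by (intro eventually_cosparse_all_less) (auto simp: okernel_def nullf_def)
  with D have "\<forall>\<^sub>\<approx>x. \<forall>r<n. opr n k D f r x = 0"
  proof eventually_elim
    case (elim x)
    show ?case
    proof (intro allI impI)
      fix r assume r: "r < n"
      have "opr n k D f r x = (\<Sum>i\<le>k. \<Sum>s<n. \<Sum>u<n. W r u x * (C i u s x * (deriv ^^ i) (f s) x))"
        unfolding opr_def using elim(1) r by (intro sum.cong refl) (simp add: sum_distrib_right mult.assoc)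
      also have "\<dots> = (\<Sum>i\<le>k. \<Sum>u<n. \<Sum>s<n. W r u x * (C i u s x * (deriv ^^ i) (f s) x))"
        by (rule sum.cong[OF refl], rule sum.swap)
      also have "\<dots> = (\<Sum>u<n. \<Sum>i\<le>k. \<Sum>s<n. W r u x * (C i u s x * (deriv ^^ i) (f s) x))"
        by (rule sum.swap)
      also have "\<dots> = (\<Sum>u<n. W r u x * opr n k C f u x)"
        by (simp add: opr_def sum_distrib_left)
      finally show "opr n k D f r x = 0" using elim(2) by simp
    qed
  qed
  thus ?thesis using f by (auto simp: okernel_def nullf_def elim: eventually_mono)
qed

section \<open>The two implications for matrix-valued functions\<close>

text \<open>\<open>W\<close> is the leading coefficient of the right factor, and the monic operator
  is the right factor multiplied from the left by the inverse of \<open>W\<close>. Solutions of the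
  former remain solutions of the latter, so the exponential basis carries over.\<close>

lemma darboux_imp_kernel:
  fixes n :: nat and \<Phi> :: "complex \<Rightarrow> complex \<Rightarrow> complex mat"
  assumes "n > 0" "bispectral_darboux n \<Phi>"
  shows "\<exists>(W :: complex \<Rightarrow> complex mat) (k :: nat) (P :: nat \<Rightarrow> complex \<Rightarrow> complex mat).
       rational_mat n W \<and> invertible_mat_fun W \<and>
       monic_dop n k P \<and>
       nondegenerate n k (vker n k P) \<and>
       (\<exists>(\<alpha> :: nat \<Rightarrow> complex) (p :: nat \<Rightarrow> complex poly vec).
          (\<forall>j<n * k. p j \<in> carrier_vec n) \<and>
          is_basis n (vker n k P) (n * k) (\<lambda>j. quasi_exp n (\<alpha> j) (p j))) \<and>
       (\<forall>\<^sub>\<approx>x. \<forall>z. \<Phi> x z = W x * dop_mat n k P (exp_mat n z) x)"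
proof -
  obtain l q k L Q P where L: "\<And>i. i \<le> l \<Longrightarrow> L i \<in> carrier_mat n n"
    and Q: "\<And>i. i \<le> q \<Longrightarrow> rational_mat n (Q i)" "invertible_mat_fun (Q q)"
    and P: "\<And>i. i \<le> k \<Longrightarrow> rational_mat n (P i)" "invertible_mat_fun (P k)"
    and L_inv: "invertible_mat_fun (\<lambda>x. L l)"
    and factor: "factorization n l (\<lambda>i x. L i) q Q k P"
    and \<Phi>: "\<forall>\<^sub>\<approx>x. \<forall>z. \<Phi> x z = dop_mat n k P (exp_mat n z) x"
    using assms(2) unfolding bispectral_darboux_def by blast
  have carrier: "\<And>i x. i \<le> q \<Longrightarrow> Q i x \<in> carrier_mat n n" "\<And>i x. i \<le> k \<Longrightarrow> P i x \<in> carrier_mat n n"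
    using P(1) Q(1) by (auto simp: rational_mat_def)
  define L' where "L' i r s = L i $$ (r, s)" for i r s
  have "sqmat n (L' l) = L l" using L[of l] by (intro eq_matI) (auto simp: L'_def)
  hence L'_nonsing: "nonsing n (L' l)"
    using L_inv by (auto simp: nonsing_iff_det invertible_mat_fun_def)
  have Qr: "ratc n q (entries Q)" "\<forall>\<^sub>\<approx>x. regular_at n q (entries Q) x"
    using rational_mat_regular[of q n Q] Q by blast+
  have Pr: "ratc n k (entries P)" "\<forall>\<^sub>\<approx>x. regular_at n k (entries P) x"
    using rational_mat_regular[of k n P] P by blast+
  have factor': "\<forall>\<^sub>\<approx>x. opr n l (constc L') f r x = opr n q (entries Q) (opr n k (entries P) f) r x"
    if f: "merov n f" and r: "r < n" for f r
  proof -
    \<comment> \<open>The factorization speaks about vectors of dimension \<open>n\<close>, so the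
      components of \<open>f\<close> are packed into one; only indices below \<open>n\<close>
      survive, and only these enter \<open>opr\<close>.\<close>
    define g where "g x = Matrix.vec n (\<lambda>s. f s x)" for x
    have comps_g: "comps g s = f s" if "s < n" for s using that by (simp add: g_def)
    have "meromorphic_vec n g"
      using f comps_g by (simp add: meromorphic_vec_iff merov_def) (simp add: g_def)
    hence ev: "\<forall>\<^sub>\<approx>x. dop_vec n l (\<lambda>i x. L i) g x = dop_vec n q Q (dop_vec n k P g) x"
      using factor by (simp add: factorization_def)
    have Pg: "dop_vec n k P g = (\<lambda>x. Matrix.vec n (\<lambda>r. opr n k (entries P) f r x))"
      using carrier(2) opr_cong[of n "comps g" f k "entries P"] comps_g by (auto simp: dop_vec_eq)
    have "opr n q (entries Q) (comps (dop_vec n k P g)) = opr n q (entries Q) (opr n k (entries P) f)"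
      by (rule opr_cong) (auto simp: Pg)
    hence "dop_vec n q Q (dop_vec n k P g) x =
        Matrix.vec n (\<lambda>r. opr n q (entries Q) (opr n k (entries P) f) r x)" for x
      using carrier(1) by (simp add: dop_vec_eq)
    moreover have "dop_vec n l (\<lambda>i x. L i) g x = Matrix.vec n (\<lambda>r. opr n l (constc L') f r x)" for x
      using L opr_cong[of n "comps g" f l "constc L'"] comps_g by (simp add: dop_vec_eq L'_def)
    ultimately show ?thesis using ev r by (simp add: ae_vec_eq_iff)
  qed
  obtain \<alpha> w where w: "\<And>j. j < n * k \<Longrightarrow> (\<lambda>s. qe (\<alpha> j) (w j s)) \<in> okernel n k (entries P)"
    "indep n (n * k) (\<lambda>j s. qe (\<alpha> j) (w j s))"
  proof (rule right_factor_kernel_basis[where n = n and L = L' and l = l and q = q and Q = "entries Q"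
        and p = k and P = "entries P"])
    show "rational_fun (\<lambda>x. P i x $$ (r, s))" if "i \<le> k" "r < n" "s < n" for i r s
      using Pr(1) that by (simp add: ratc_def)
  qed (use assms(1) L'_nonsing ratc_meroc[OF Qr(1)] Qr(2) Pr(2) factor' in auto)
  have "\<forall>\<^sub>\<approx>x. nonsing n (\<lambda>r s. P k x $$ (r, s))"
    using Pr(2) by eventually_elim (simp add: regular_at_def)
  then obtain Y where Y: "\<And>r s. r < n \<Longrightarrow> s < n \<Longrightarrow> rational_fun (Y r s)"
    "\<forall>\<^sub>\<approx>x. \<forall>r<n. \<forall>s<n. (\<Sum>t<n. P k x $$ (r, t) * Y t s x) = (if r = s then 1 else 0)"
    "\<forall>\<^sub>\<approx>x. \<forall>r<n. \<forall>s<n. (\<Sum>t<n. Y r t x * P k x $$ (t, s)) = (if r = s then 1 else 0)"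
    using rational_inverse[of n "\<lambda>r s x. P k x $$ (r, s)"] P(1)[of k] by (auto simp: rational_mat_def)
  define Z where "Z x = sqmat n (\<lambda>r s. Y r s x)" for x
  have Z: "Z x \<in> carrier_mat n n" for x by (simp add: Z_def)
  define R where "R i x = Z x * P i x" for i x
  have R: "R i x \<in> carrier_mat n n" if "i \<le> k" for i x
    unfolding R_def using Z carrier(2)[OF that] by (rule mult_carrier_mat)
  have R_entry: "R i x $$ (r, s) = (\<Sum>u<n. Y r u x * P i x $$ (u, s))"
    if "i \<le> k" "r < n" "s < n" for i r s x
    unfolding R_def Z_def using carrier(2)[OF that(1), of x] that
    by (simp add: scalar_prod_def atLeast0LessThan)
  have PZ: "\<forall>\<^sub>\<approx>x. P k x * Z x = 1\<^sub>m n"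
    using Y(2)
  proof eventually_elim
    case (elim x)
    show ?case
      using carrier(2)[of k x] Z[of x] elim
      by (intro eq_matI) (auto simp: Z_def scalar_prod_def atLeast0LessThan)
  qed
  have R_top: "\<forall>\<^sub>\<approx>x. R k x = 1\<^sub>m n"
    using Y(3)
  proof eventually_elim
    case (elim x)
    show ?case using R[of k x] elim by (intro eq_matI) (auto simp: R_entry)
  qed
  have R_rat: "ratc n k (entries R)"
    unfolding ratc_def
  proof (intro allI impI)
    fix i r s assume *: "i \<le> k" "r < n" "s < n"
    show "rational_fun (\<lambda>x. R i x $$ (r, s))"
      unfolding R_entry[OF *] using * Y(1) P(1)
      by (intro rational_fun_sum rational_fun_mult) (auto simp: rational_mat_def)
  qed
  have monic: "monic_dop n k R"
    using ratc_meroc[OF R_rat] R R_top by (auto simp: monic_dop_def meromorphic_mat_def meroc_def)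
  have R_reg: "\<forall>\<^sub>\<approx>x. regular_at n k (entries R) x"
    using meroc_analytic[OF ratc_meroc[OF R_rat]] R_top
    by eventually_elim (auto simp: regular_at_def intro!: nonsing_one)
  define p where "p j = Matrix.vec n (w j)" for j
  have comps_eq: "comps (quasi_exp n (\<alpha> j) (p j)) s = qe (\<alpha> j) (w j s)" if "s < n" for j s
    using quasi_exp_comps[OF that, of "\<alpha> j" "p j"] that by (simp add: p_def)
  have in_vker: "quasi_exp n (\<alpha> j) (p j) \<in> vker n k R" if "j < n * k" for j
  proof -
    have "(\<lambda>s. qe (\<alpha> j) (w j s)) \<in> okernel n k (entries R)"
      by (rule okernel_left_mult[OF w(1)[OF that], where W = Y]) (simp add: R_entry)
    hence "comps (quasi_exp n (\<alpha> j) (p j)) \<in> okernel n k (entries R)"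
      using okernel_cong'[of n "comps (quasi_exp n (\<alpha> j) (p j))" "\<lambda>s. qe (\<alpha> j) (w j s)"] comps_eq by blast
    thus ?thesis using R by (subst vker_iff) (auto simp: quasi_exp_def)
  qed
  have "indep n (n * k) (\<lambda>j. comps (quasi_exp n (\<alpha> j) (p j)))"
    using w(2) indep_cong[of "n * k" n "\<lambda>j. comps (quasi_exp n (\<alpha> j) (p j))" "\<lambda>j s. qe (\<alpha> j) (w j s)"]
      comps_eq by blast
  with assms(1) R R_reg in_vker
  have basis: "is_basis n (vker n k R) (n * k) (\<lambda>j. quasi_exp n (\<alpha> j) (p j))"
    "nondegenerate n k (vker n k R)"
    by (rule_tac [!] vker_basis[where f = "\<lambda>j. quasi_exp n (\<alpha> j) (p j)"]) auto
  have "\<forall>\<^sub>\<approx>x. \<forall>z. \<Phi> x z = P k x * dop_mat n k R (exp_mat n z) x"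
    using \<Phi> PZ
  proof eventually_elim
    case (elim x)
    have "P i x = P k x * R i x" if "i \<le> k" for i
    proof -
      have "P k x * R i x = (P k x * Z x) * P i x"
        unfolding R_def by (rule assoc_mult_mat[symmetric, of _ n n _ n _ n]) (use carrier(2) Z that in auto)
      thus ?thesis using elim(2) carrier(2)[OF that, of x] by simp
    qed
    hence "dop_mat n k P (exp_mat n z) x = P k x * dop_mat n k R (exp_mat n z) x" for z
      by (intro dop_mat_left_mult carrier(2) R order_refl)
    thus ?case using elim(1) by simp
  qed
  moreover have "rational_mat n (P k)" using P(1) by simp
  moreover have "p j \<in> carrier_vec n" for j by (simp add: p_def)
  ultimately show ?thesis using P(2) monic basis by blast
qed

text \<open>The right factor is \<open>B = W P\<close>, whose leading coefficient agrees with
  \<open>W\<close> off a sparse set and is thus invertible; the constant operator is d(\<partial>)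
  I.\<close>

lemma kernel_imp_darboux:
  fixes n :: nat and \<Phi> :: "complex \<Rightarrow> complex \<Rightarrow> complex mat"
  assumes "n > 0" and W: "rational_mat n W" "invertible_mat_fun W"
    and monic: "monic_dop n k P"
    and p: "\<And>j. j < n * k \<Longrightarrow> p j \<in> carrier_vec n"
    and basis: "is_basis n (vker n k P) (n * k) (\<lambda>j. quasi_exp n (\<alpha> j) (p j))"
    and \<Phi>: "\<forall>\<^sub>\<approx>x. \<forall>z. \<Phi> x z = W x * dop_mat n k P (exp_mat n z) x"
  shows "bispectral_darboux n \<Phi>"
proof -
  have P: "P i x \<in> carrier_mat n n" if "i \<le> k" for i x
    using monic that by (auto simp: monic_dop_def meromorphic_mat_def)
  have P_mero: "meroc n k (entries P)"
    using monic by (auto simp: monic_dop_def meromorphic_mat_def meroc_def)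
  have P_top: "\<forall>\<^sub>\<approx>x. \<forall>r<n. \<forall>s<n. P k x $$ (r, s) = (if r = s then 1 else 0)"
    using monic unfolding monic_dop_def by (auto elim!: eventually_mono)
  have P_reg: "\<forall>\<^sub>\<approx>x. regular_at n k (entries P) x"
    using meroc_analytic[OF P_mero] P_top
    by eventually_elim (auto simp: regular_at_def intro!: nonsing_one)
  have Wc: "W x \<in> carrier_mat n n" for x using W(1) by (simp add: rational_mat_def)
  define w where "w j s = p j $ s" for j s
  have comps_eq: "comps (quasi_exp n (\<alpha> j) (p j)) s = qe (\<alpha> j) (w j s)" if "s < n" for j s
    using quasi_exp_comps[OF that, of "\<alpha> j" "p j"] by (simp add: w_def)
  have vker_carrier: "vker n k P \<subseteq> {g. \<forall>x. g x \<in> carrier_vec n}"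
    using vker_iff[of k P n] P by blast
  have ker: "(\<lambda>s. qe (\<alpha> j) (w j s)) \<in> okernel n k (entries P)" if "j < n * k" for j
  proof -
    have "quasi_exp n (\<alpha> j) (p j) \<in> vker n k P" using basis that by (auto simp: is_basis_def)
    hence "comps (quasi_exp n (\<alpha> j) (p j)) \<in> okernel n k (entries P)"
      using vker_iff[of k P n] P by blast
    thus ?thesis
      using okernel_cong'[of n "comps (quasi_exp n (\<alpha> j) (p j))" "\<lambda>s. qe (\<alpha> j) (w j s)"] comps_eq by blast
  qed
  have "indep n (n * k) (\<lambda>j. comps (quasi_exp n (\<alpha> j) (p j)))"
    using basis by (simp add: is_basis_iff[OF vker_carrier])
  hence ind: "indep n (n * k) (\<lambda>j s. qe (\<alpha> j) (w j s))"
    using indep_cong[of "n * k" n "\<lambda>j. comps (quasi_exp n (\<alpha> j) (p j))" "\<lambda>j s. qe (\<alpha> j) (w j s)"]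
      comps_eq by blast
  have P_rat: "ratc n k (entries P)"
    by (rule rational_coefficients_of_kernel[OF P_reg P_top ker ind])
  define B where "B i x = W x * P i x" for i x
  have B: "B i x \<in> carrier_mat n n" if "i \<le> k" for i x
    unfolding B_def using Wc P[OF that] by (rule mult_carrier_mat)
  have B_entry: "B i x $$ (r, s) = (\<Sum>u<n. W x $$ (r, u) * P i x $$ (u, s))"
    if "i \<le> k" "r < n" "s < n" for i r s x
    unfolding B_def using Wc[of x] P[OF that(1), of x] that
    by (simp add: scalar_prod_def atLeast0LessThan)
  have B_rat: "rational_mat n (B i)" if "i \<le> k" for i
    unfolding rational_mat_def
  proof (intro conjI allI impI)
    show "B i x \<in> carrier_mat n n" for x by (rule B[OF that])
    fix r s assume rs: "r < n" "s < n"
    show "rational_fun (\<lambda>x. B i x $$ (r, s))"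
      unfolding B_entry[OF that rs] using that rs W(1) P_rat
      by (intro rational_fun_sum rational_fun_mult) (auto simp: rational_mat_def ratc_def)
  qed
  have "\<forall>\<^sub>\<approx>x. B k x = W x"
    using monic right_mult_one_mat[OF Wc] unfolding monic_dop_def B_def
    by (auto elim!: eventually_mono)
  hence "\<forall>\<^sub>\<approx>x. det (B k x) = 0 \<longleftrightarrow> det (W x) = 0" by eventually_elim simp
  hence "(\<forall>\<^sub>\<approx>x. det (B k x) = 0) \<longleftrightarrow> (\<forall>\<^sub>\<approx>x. det (W x) = 0)" by (rule eventually_subst)
  hence B_inv: "invertible_mat_fun (B k)"
    using W(2) by (simp add: invertible_mat_fun_def)
  have Br: "ratc n k (entries B)" "\<forall>\<^sub>\<approx>x. regular_at n k (entries B) x"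
    using rational_mat_regular[of k n B] B_rat B_inv by blast+
  have B_ker: "(\<lambda>s. qe (\<alpha> j) (w j s)) \<in> okernel n k (entries B)" if "j < n * k" for j
    by (rule okernel_left_mult[OF ker[OF that], where W = "\<lambda>r s x. W x $$ (r, s)"]) (simp add: B_entry)
  \<comment> \<open>The sum of the component degrees bounds the degree of every component at once.
    The successor makes the exponent exceed each degree and also be at least 1, whence the degree of
    \<open>d\<close> is at least \<open>n * k\<close> and so at least \<open>k\<close>, as the
    division requires.\<close>
  define m where "m j = Suc (\<Sum>s<n. degree (w j s))" for j
  define d where "d = (\<Prod>j<n * k. [:- \<alpha> j, 1:] ^ m j)"
  have d0: "d \<noteq> 0" by (simp add: d_def)
  have "degree d = (\<Sum>j<n * k. m j)"
    unfolding d_def by (subst degree_prod_eq_sum_degree) (auto simp: degree_power_eq)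
  also have "\<dots> \<ge> (\<Sum>j<n * k. 1)" by (intro sum_mono) (simp add: m_def)
  finally have "n * k \<le> degree d" by simp
  moreover have "k \<le> n * k" using assms(1) by simp
  ultimately obtain t where t: "degree d = k + t" by (metis le_trans le_iff_add)
  have d_ker: "(\<lambda>s. qe (\<alpha> j) (w j s)) \<in> okernel n (degree d) (dconst d)" if j: "j < n * k" for j
  proof -
    have "[:- \<alpha> j, 1:] ^ m j dvd d" unfolding d_def using j by (intro dvd_prodI) auto
    moreover have "degree (w j s) < m j" if "s < n" for s
      using that by (auto simp: m_def less_Suc_eq_le intro!: member_le_sum)
    ultimately have "opr n (degree d) (dconst d) (\<lambda>s. qe (\<alpha> j) (w j s)) r x = 0" if "r < n" for r x
      using that by (intro opr_dconst_eq_0) auto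
    thus ?thesis by (auto simp: okernel_def merov_def nullf_def intro: qe_meromorphic)
  qed
  obtain Q where Q: "ratc n t Q" "\<forall>\<^sub>\<approx>x. nonsing n (\<lambda>r s. Q t r s x)"
    and QB: "\<And>f r. merov n f \<Longrightarrow> r < n \<Longrightarrow>
      \<forall>\<^sub>\<approx>x. opr n (degree d) (dconst d) f r x = opr n t Q (opr n k (entries B) f) r x"
    using opr_eq_of_kernel[OF Br B_ker ind d0 t d_ker] by blast
  define L where "L i = coeff d i \<cdot>\<^sub>m 1\<^sub>m n" for i
  define Q' where "Q' i x = sqmat n (\<lambda>r s. Q i r s x)" for i x
  have "factorization n (degree d) (\<lambda>i x. L i) t Q' k B"
    unfolding factorization_def
  proof (intro allI impI)
    fix f assume f: "meromorphic_vec n f"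
    hence fm: "merov n (comps f)" by (simp add: meromorphic_vec_iff)
    have "opr n (degree d) (constc (\<lambda>i r s. L i $$ (r, s))) (comps f) r x = opr n (degree d) (dconst d) (comps f) r x"
      if "r < n" for r x
      using that by (auto simp: opr_def L_def dconst_def intro!: sum.cong)
    hence Lf: "dop_vec n (degree d) (\<lambda>i x. L i) f x =
        Matrix.vec n (\<lambda>r. opr n (degree d) (dconst d) (comps f) r x)" for x
      by (subst dop_vec_eq) (auto simp: L_def)
    have Bf: "dop_vec n k B f = (\<lambda>x. Matrix.vec n (\<lambda>r. opr n k (entries B) (comps f) r x))"
      using B by (auto simp: dop_vec_eq)
    have "opr n t (entries Q') (comps (dop_vec n k B f)) r x = opr n t Q (opr n k (entries B) (comps f)) r x"
      if "r < n" for r x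
    proof -
      have "opr n t (entries Q') (comps (dop_vec n k B f)) = opr n t (entries Q') (opr n k (entries B) (comps f))"
        by (rule opr_cong) (auto simp: Bf)
      thus ?thesis using that by (auto simp: opr_def Q'_def intro!: sum.cong)
    qed
    hence "dop_vec n t Q' (dop_vec n k B f) x =
        Matrix.vec n (\<lambda>r. opr n t Q (opr n k (entries B) (comps f)) r x)" for x
      by (subst dop_vec_eq) (auto simp: Q'_def)
    thus "\<forall>\<^sub>\<approx>x. dop_vec n (degree d) (\<lambda>i x. L i) f x = dop_vec n t Q' (dop_vec n k B f) x"
      using QB[OF fm] by (simp add: Lf ae_vec_eq_iff)
  qed
  moreover have "L i \<in> carrier_mat n n" for i by (simp add: L_def)
  moreover have "rational_mat n (Q' i)" if "i \<le> t" for i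
    using Q(1) that by (auto simp: rational_mat_def Q'_def ratc_def)
  moreover have "invertible_mat_fun (\<lambda>x. L (degree d))"
    using d0 by (simp add: invertible_mat_fun_def L_def)
  moreover have "invertible_mat_fun (Q' t)"
    unfolding invertible_mat_fun_def Q'_def using ae_imp_not_ae_not[OF Q(2)]
    by (simp add: nonsing_iff_det)
  moreover have "\<forall>\<^sub>\<approx>x. \<forall>z. \<Phi> x z = dop_mat n k B (exp_mat n z) x"
    using \<Phi>
  proof eventually_elim
    case (elim x)
    have "dop_mat n k B (exp_mat n z) x = W x * dop_mat n k P (exp_mat n z) x" for z
      using Wc P by (intro dop_mat_left_mult) (auto simp: B_def)
    thus ?case using elim by simp
  qed
  ultimately show ?thesis
    unfolding bispectral_darboux_def using B_rat B_inv by blast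
qed

theorem theorem1p2:
  fixes n :: nat and \<Phi> :: "complex \<Rightarrow> complex \<Rightarrow> complex mat"
  assumes "n > 0"
  shows "bispectral_darboux n \<Phi> \<longleftrightarrow>
    (\<exists>(W :: complex \<Rightarrow> complex mat) (k :: nat) (P :: nat \<Rightarrow> complex \<Rightarrow> complex mat).
       rational_mat n W \<and> invertible_mat_fun W \<and>
       monic_dop n k P \<and>
       nondegenerate n k (vker n k P) \<and>
       (\<exists>(\<alpha> :: nat \<Rightarrow> complex) (p :: nat \<Rightarrow> complex poly vec).
          (\<forall>j<n * k. p j \<in> carrier_vec n) \<and>
          is_basis n (vker n k P) (n * k) (\<lambda>j. quasi_exp n (\<alpha> j) (p j))) \<and>
       (\<forall>\<^sub>\<approx>x. \<forall>z. \<Phi> x z = W x * dop_mat n k P (exp_mat n z) x))"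
proof (intro iffI, goal_cases)
  case 1
  with assms show ?case by (rule darboux_imp_kernel)
next
  case 2
  then obtain W k P \<alpha> p where "rational_mat n W" "invertible_mat_fun W" "monic_dop n k P"
    "\<forall>j<n * k. p j \<in> carrier_vec n" "is_basis n (vker n k P) (n * k) (\<lambda>j. quasi_exp n (\<alpha> j) (p j))"
    "\<forall>\<^sub>\<approx>x. \<forall>z. \<Phi> x z = W x * dop_mat n k P (exp_mat n z) x"
    by (elim exE conjE) (rule that)
  with assms show ?case
    by (intro kernel_imp_darboux[of n W k P p \<alpha> \<Phi>]) simp_all
qed

end
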